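(* Let $\mathcal U,\mathcal Y$ be separable Hilbert spaces and let $F,G\in S(\mathcal U,\mathcal Y)$. Then $F\stackrel{\infty}{\prec}G$ if and only if one of the following four equivalent conditions holds: (SCPOi) there is a bounded $\mathcal L(\mathcal D_G,\mathcal D_G^* )$-valued function $Q$ on $\mathbb D$ with $F(\lambda)-G(\lambda)=D_{G(\lambda)^*}Q(\lambda)D_{G(\lambda)}$ for all $\lambda\in\mathbb D$; (SCPOii) there is a bounded $\mathcal L(\mathcal D_G)$-valued function $R$ on $\mathbb D$ with $I-F(\lambda)^*G(\lambda)=D_{G(\lambda)}R(\lambda)D_{G(\lambda)}$ for all $\lambda\in\mathbb D$; (SCPOiii) there exists $r>0$ such that $(1-\varepsilon)G+\varepsilon F\in S(\mathcal U,\mathcal Y)$ for all $\varepsilon\in\mathbb C$ with $|\varepsilon|\le r$; (SCPOiv) there exists $r>0$ such that $(1-\varepsilon)G+\varepsilon F\in S(\mathcal U,\mathcal Y)$ for all $\varepsilon\in\mathbb C$ with $|\varepsilon|=r$. Moreover, if $F\stackrel{\infty}{\prec}G$, then the functions $Q$ and $R$ and the constant $r>0$ can be chosen in such a way that $$\|Q\|_\infty\le\|R\|_\infty+\sqrt{2\|\mathrm{Re}(R)\|_\infty-1},\qquad \|R\|_\infty\le 1+\|Q\|_\infty,$$ $$\|Q\|_\infty\le\frac{2+2\sqrt r+r}{2r},\qquad \|R\|_\infty\le\frac{2+r}{2r},$$ $$r\ge\Big(\|R\|_\infty+\sqrt{\|R\|_\infty^2+2\|\mathrm{Re}(R)\|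_\infty-1}\Big)^{-1}.$$
   Context: Operators are bounded linear maps between Hilbert spaces; $\mathcal L(\mathcal H_1,\mathcal H_2)$ is the space of operators from $\mathcal H_1$ to $\mathcal H_2$, $\mathcal L(\mathcal H)=\mathcal L(\mathcal H,\mathcal H)$, and $\mathcal L_1(\mathcal H_1,\mathcal H_2)$ is the set of contractions. For a contraction $C$, $D_C=(I-C^*C)^{1/2}$ and $\mathcal D_C=\overline{\mathrm{Ran}}\,D_C$; $D_C$ is also viewed as an operator into or out of $\mathcal D_C$. For contractions $A,B\in\mathcal L_1(\mathcal H_1,\mathcal H_2)$, $A\prec B$ means $A-B=D_{B^*}XD_B$ for some bounded operator $X:\mathcal D_B\to\mathcal D_{B^*}$. $\mathrm{Re}(A)=\frac12(A+A^* )$. The Schur class $S(\mathcal U,\mathcal Y)$ consists of all $\mathcal L_1(\mathcal U,\mathcal Y)$-valued analytic functions on the open unit disc $\mathbb D$. For $F\in S(\mathcal U,\mathcal Y)$, $T_F:H^2_{\mathcal U}\to H^2_{\mathcal Y}$ is the operator between vector-valued Hardy spaces given by $(T_Fh)(\lambda)=F(\lambda)h(\lambda)$. For $F,G\in S(\mathcal U,\mathcal Y)$, $F\stackrel{\infty}{\prec}G$ means $T_F\prec T_G$. For $G\in S(\mathcal U,\mathcal Y)$ the ranges of $D_{G(\lambda)}$ and of $D_{G(\lambda)^*}$ do not depend on $\lambda\in\mathbb D$; put $\mathcal D_G=\overline{\mathrm{Ran}}\,D_{G(\lambda)}\subset\mathcal U$ and $\mathcal D_G^*=\overline{\mathrm{Ran}}\,D_{G(\lambda)^*}\subset\mathcal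 Y$ (any $\lambda\in\mathbb D$). For a bounded operator-valued function on $\mathbb D$, $\|\cdot\|_\infty$ is the supremum of the operator norms over $\mathbb D$, and $\mathrm{Re}(R)$ is taken pointwise.
   Formalization: The first bound on ‖Q‖ and the lower bound on r are asserted only when D_G ≠ {0}; if D_G = {0} then R = 0 and both square roots would be of −1, so those two bounds have no meaning. *)

theory Defs
  imports "HOL-Analysis.Analysis"
begin

section \<open>Complex Hilbert spaces\<close>

class complex_vector = real_vector +
  fixes scaleC :: "complex \<Rightarrow> 'a \<Rightarrow> 'a" (infixr "*\<^sub>C" 75)
  assumes scaleC_add_right: "c *\<^sub>C (x + y) = c *\<^sub>C x + c *\<^sub>C y"
    and scaleC_add_left: "(c + d) *\<^sub>C x = c *\<^sub>C x + d *\<^sub>C x"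
    and scaleC_scaleC: "c *\<^sub>C d *\<^sub>C x = (c * d) *\<^sub>C x"
    and scaleC_of_real: "complex_of_real r *\<^sub>C x = r *\<^sub>R x"

text \<open>The complex inner product is linear in its first argument.  Positive definiteness and
  the formula for the norm come from \<^class>\<open>real_inner\<close>, since the real inner
  product is required to be the real part of the complex one.\<close>

class complex_inner = complex_vector + real_inner +
  fixes cinner :: "'a \<Rightarrow> 'a \<Rightarrow> complex"
  assumes cinner_commute: "cinner x y = cnj (cinner y x)"
    and cinner_add_left: "cinner (x + y) z = cinner x z + cinner y z"
    and cinner_scaleC_left: "cinner (c *\<^sub>C x) y = c * cinner x y"
    and inner_eq_Re_cinner: "x \<bullet> y = Re (cinner x y)"

class complex_hilbert = complex_inner + complete_space

instance complex_hilbert \<subseteq> banach ..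

lemma cinner_scaleC_right: "cinner x (c *\<^sub>C y) = cnj c * cinner x y"
  by (metis cinner_commute cinner_scaleC_left complex_cnj_mult)

lemma cinner_self: "cinner x x = complex_of_real ((norm x)\<^sup>2)"
proof -
  have "Im (cinner x x) = - Im (cinner x x)"
    by (metis cinner_commute cnj.simps(2))
  then show ?thesis
    by (simp add: complex_eq_iff power2_norm_eq_inner inner_eq_Re_cinner)
qed

lemma norm_scaleC: "norm (c *\<^sub>C x) = cmod c * norm (x :: 'a :: complex_inner)"
proof -
  have "complex_of_real ((norm (c *\<^sub>C x))\<^sup>2) = complex_of_real ((cmod c * norm x)\<^sup>2)"
    unfolding cinner_self[symmetric] cinner_scaleC_left cinner_scaleC_right
    by (simp add: cinner_self power_mult_distrib complex_norm_square mult.assoc del: of_real_power)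
  then show ?thesis
    by (simp only: of_real_eq_iff) (simp add: power2_eq_iff_nonneg)
qed

lemma bounded_linear_scaleC: "bounded_linear (\<lambda>x :: 'a :: complex_inner. c *\<^sub>C x)"
proof
  show "c *\<^sub>C (r *\<^sub>R x) = r *\<^sub>R (c *\<^sub>C x)" for r and x :: 'a
    by (metis mult.commute scaleC_of_real scaleC_scaleC)
  show "\<exists>K. \<forall>x::'a. norm (c *\<^sub>C x) \<le> norm x * K"
    by (metis norm_scaleC mult.commute order_refl)
qed (rule scaleC_add_right)

lemma cinner_eq_inner: "cinner x y = Complex (x \<bullet> y) (x \<bullet> (\<i> *\<^sub>C y))"
  by (simp add: complex_eq_iff inner_eq_Re_cinner cinner_scaleC_right)

section \<open>Operators\<close>

text \<open>Operators between complex Hilbert spaces are those elements of the library type of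
  bounded real-linear maps that are complex linear; their norm is the library's operator
  norm.\<close>

definition is_clinear :: "('a::complex_vector \<Rightarrow> 'b::complex_vector) \<Rightarrow> bool"
  where "is_clinear f \<longleftrightarrow> Vector_Spaces.linear scaleC scaleC f"

instantiation blinfun :: (real_normed_vector, complex_inner) complex_vector
begin

lift_definition scaleC_blinfun :: "complex \<Rightarrow> ('a \<Rightarrow>\<^sub>L 'b) \<Rightarrow> ('a \<Rightarrow>\<^sub>L 'b)"
  is "\<lambda>c f x. c *\<^sub>C f x"
  by (rule bounded_linear_compose[OF bounded_linear_scaleC])

instance
  by standard
    (transfer, simp add: scaleC_add_right scaleC_add_left scaleC_scaleC scaleC_of_real)+

end

definition contractions :: "('a::complex_inner \<Rightarrow>\<^sub>L 'b::complex_inner) set"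
  where "contractions = {A. is_clinear (blinfun_apply A) \<and> norm A \<le> 1}"

definition adj :: "('a::complex_inner \<Rightarrow>\<^sub>L 'b::complex_inner) \<Rightarrow> ('b \<Rightarrow>\<^sub>L 'a)"
  where "adj A = (THE B. \<forall>x y. cinner (blinfun_apply A x) y = cinner x (blinfun_apply B y))"

definition Re_op :: "('a::complex_inner \<Rightarrow>\<^sub>L 'a) \<Rightarrow> ('a \<Rightarrow>\<^sub>L 'a)"
  where "Re_op A = (1/2) *\<^sub>R (A + adj A)"

text \<open>On a complex space a positive operator is automatically self-adjoint.\<close>

definition positive_op :: "('a::complex_inner \<Rightarrow>\<^sub>L 'a) \<Rightarrow> bool"
  where "positive_op A \<longleftrightarrow> is_clinear (blinfun_apply A) \<and> (\<forall>x. cinner (blinfun_apply A x) x \<in> \<real>\<^sub>\<ge>\<^sub>0)"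

definition sqrt_op :: "('a::complex_inner \<Rightarrow>\<^sub>L 'a) \<Rightarrow> ('a \<Rightarrow>\<^sub>L 'a)"
  where "sqrt_op P = (THE S. positive_op S \<and> S o\<^sub>L S = P)"

definition defect :: "('a::complex_inner \<Rightarrow>\<^sub>L 'b::complex_inner) \<Rightarrow> ('a \<Rightarrow>\<^sub>L 'a)"
  where "defect C = sqrt_op (id_blinfun - (adj C o\<^sub>L C))"

definition defect_space :: "('a::complex_inner \<Rightarrow>\<^sub>L 'b::complex_inner) \<Rightarrow> 'a set"
  where "defect_space C = closure (range (blinfun_apply (defect C)))"

text \<open>For closed subspaces \<open>M\<close> and \<open>N\<close>, an operator from \<open>M\<close> to \<open>N\<close> is represented by its
  extension by zero on the orthogonal complement of \<open>M\<close>, viewed as an operator between the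
  ambient spaces.  This identification is linear, preserves operator norms and is compatible
  with composition and adjoints.\<close>

definition ops_between ::
    "'a::complex_inner set \<Rightarrow> 'b::complex_inner set \<Rightarrow> ('a \<Rightarrow>\<^sub>L 'b) set"
  where "ops_between M N =
    {X. is_clinear (blinfun_apply X) \<and> range (blinfun_apply X) \<subseteq> N \<and>
        (\<forall>x. (\<forall>m\<in>M. cinner x m = 0) \<longrightarrow> blinfun_apply X x = 0)}"

definition prec :: "('a::complex_inner \<Rightarrow>\<^sub>L 'b::complex_inner) \<Rightarrow> ('a \<Rightarrow>\<^sub>L 'b) \<Rightarrow> bool"
    (infix "\<prec>" 50)
  where "A \<prec> B \<longleftrightarrow>
    (\<exists>X \<in> ops_between (defect_space B) (defect_space (adj B)).
       A - B = defect (adj B) o\<^sub>L X o\<^sub>L defect B)"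

section \<open>The Schur class\<close>

text \<open>Functions on the open unit disc are total functions on the complex plane of which only
  the values on the disc are relevant.  Analyticity is complex differentiability with respect
  to the operator norm.\<close>

abbreviation unit_disc :: "complex set" ("\<D>")
  where "\<D> \<equiv> ball 0 1"

definition analytic_on_disc :: "(complex \<Rightarrow> 'a::complex_inner \<Rightarrow>\<^sub>L 'b::complex_inner) \<Rightarrow> bool"
  where "analytic_on_disc F \<longleftrightarrow>
    (\<forall>z\<in>\<D>. \<exists>F'. (F has_derivative (\<lambda>h. h *\<^sub>C F')) (at z))"

definition schur :: "(complex \<Rightarrow> 'a::complex_inner \<Rightarrow>\<^sub>L 'b::complex_inner) set"
  where "schur = {F. analytic_on_disc F \<and> F ` \<D> \<subseteq> contractions}"

definition sup_norm :: "(complex \<Rightarrow> 'a::real_normed_vector) \<Rightarrow> real"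
  where "sup_norm Q = (SUP z\<in>\<D>. norm (Q z))"

section \<open>Vector-valued Hardy spaces\<close>

text \<open>An element \<open>h(z) = (\<Sum>n. z^n h\<^sub>n)\<close> of the Hardy space is stored through its
  square-summable sequence of Taylor coefficients; \<open>hardy_eval\<close> below recovers the function
  on the disc (injectively, see \<open>hardy_eval_inject\<close>).\<close>

typedef (overloaded) ('a::complex_inner) hardy =
    "{a :: nat \<Rightarrow> 'a. summable (\<lambda>n. (norm (a n))\<^sup>2)}"
  morphisms hcoeffs Abs_hardy
  by (rule exI[of _ "\<lambda>_. 0"]) simp

setup_lifting type_definition_hardy

lemma summable_hcoeffs: "summable (\<lambda>n. (norm (hcoeffs h n))\<^sup>2)"
  using hcoeffs by blast

lemma summable_sq_add:
  fixes a b :: "nat \<Rightarrow> 'a::real_inner"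
  assumes "summable (\<lambda>n. (norm (a n))\<^sup>2)" "summable (\<lambda>n. (norm (b n))\<^sup>2)"
  shows "summable (\<lambda>n. (norm (a n + b n))\<^sup>2)"
proof (rule summable_comparison_test'[where N = 0])
  show "summable (\<lambda>n. 2 * (norm (a n))\<^sup>2 + 2 * (norm (b n))\<^sup>2)"
    using assms by (intro summable_add summable_mult)
  show "norm ((norm (a n + b n))\<^sup>2) \<le> 2 * (norm (a n))\<^sup>2 + 2 * (norm (b n))\<^sup>2" for n
  proof -
    have "(norm (a n + b n))\<^sup>2 + (norm (a n - b n))\<^sup>2 = 2 * (norm (a n))\<^sup>2 + 2 * (norm (b n))\<^sup>2"
      by (simp add: power2_norm_eq_inner inner_diff_left inner_diff_right inner_add_left
          inner_add_right)
    moreover have "0 \<le> (norm (a n - b n))\<^sup>2"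
      by simp
    ultimately show ?thesis
      unfolding real_norm_def abs_power2 by linarith
  qed
qed

lemma summable_inner:
  fixes a b :: "nat \<Rightarrow> 'a::real_inner"
  assumes "summable (\<lambda>n. (norm (a n))\<^sup>2)" "summable (\<lambda>n. (norm (b n))\<^sup>2)"
  shows "summable (\<lambda>n. a n \<bullet> b n)"
proof (rule summable_comparison_test'[where N = 0])
  show "summable (\<lambda>n. (norm (a n))\<^sup>2 + (norm (b n))\<^sup>2)"
    using assms by (intro summable_add)
  show "norm (a n \<bullet> b n) \<le> (norm (a n))\<^sup>2 + (norm (b n))\<^sup>2" for n
  proof -
    have "\<bar>a n \<bullet> b n\<bar> \<le> norm (a n) * norm (b n)"
      by (rule Cauchy_Schwarz_ineq2)
    moreover have "0 \<le> (norm (a n) - norm (b n))\<^sup>2" "0 \<le> norm (a n) * norm (b n)"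
      by auto
    ultimately show ?thesis
      by (simp add: power2_diff)
  qed
qed

lemma summable_cinner:
  assumes "summable (\<lambda>n. (norm (a n))\<^sup>2)" "summable (\<lambda>n. (norm (b n))\<^sup>2)"
  shows "summable (\<lambda>n. cinner (a n) (b n))"
proof -
  have "summable (\<lambda>n. a n \<bullet> (\<i> *\<^sub>C b n))"
    using assms by (intro summable_inner) (auto simp: norm_scaleC)
  then show ?thesis
    using summable_inner[OF assms] by (simp add: cinner_eq_inner summable_complex_iff)
qed

instantiation hardy :: (complex_inner) complex_inner
begin

lift_definition zero_hardy :: "'a hardy" is "\<lambda>_. 0" by simp

lift_definition plus_hardy :: "'a hardy \<Rightarrow> 'a hardy \<Rightarrow> 'a hardy" is "\<lambda>a b n. a n + b n"
  by (rule summable_sq_add)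

lift_definition uminus_hardy :: "'a hardy \<Rightarrow> 'a hardy" is "\<lambda>a n. - a n" by simp

lift_definition minus_hardy :: "'a hardy \<Rightarrow> 'a hardy \<Rightarrow> 'a hardy" is "\<lambda>a b n. a n - b n"
  using summable_sq_add[of _ "\<lambda>n. - _ n"] by fastforce

lift_definition scaleR_hardy :: "real \<Rightarrow> 'a hardy \<Rightarrow> 'a hardy" is "\<lambda>r a n. r *\<^sub>R a n"
  by (simp add: power_mult_distrib summable_mult)

lift_definition scaleC_hardy :: "complex \<Rightarrow> 'a hardy \<Rightarrow> 'a hardy" is "\<lambda>c a n. c *\<^sub>C a n"
  by (simp add: norm_scaleC power_mult_distrib summable_mult)

definition cinner_hardy :: "'a hardy \<Rightarrow> 'a hardy \<Rightarrow> complex"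
  where "cinner_hardy g h = (\<Sum>n. cinner (hcoeffs g n) (hcoeffs h n))"

definition inner_hardy :: "'a hardy \<Rightarrow> 'a hardy \<Rightarrow> real"
  where "inner_hardy g h = (\<Sum>n. hcoeffs g n \<bullet> hcoeffs h n)"

definition norm_hardy :: "'a hardy \<Rightarrow> real" where "norm_hardy h = sqrt (h \<bullet> h)"

definition sgn_hardy :: "'a hardy \<Rightarrow> 'a hardy" where "sgn_hardy h = inverse (norm h) *\<^sub>R h"

definition dist_hardy :: "'a hardy \<Rightarrow> 'a hardy \<Rightarrow> real" where "dist_hardy g h = norm (g - h)"

definition uniformity_hardy :: "('a hardy \<times> 'a hardy) filter"
  where "uniformity_hardy = (INF e\<in>{0<..}. principal {(g :: 'a hardy, h). dist g h < e})"

definition open_hardy :: "'a hardy set \<Rightarrow> bool"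
  where "open_hardy U \<longleftrightarrow> (\<forall>g\<in>U. \<forall>\<^sub>F (g', h) in uniformity. g' = g \<longrightarrow> h \<in> U)"

instance
proof
  fix f g h :: "'a hardy" and r s :: real and c d :: complex
  note coeff_simps = plus_hardy.rep_eq scaleR_hardy.rep_eq scaleC_hardy.rep_eq
  show "f + g + h = f + (g + h)" by transfer (simp add: add.assoc)
  show "f + g = g + f" by transfer (simp add: add.commute)
  show "0 + f = f" by transfer simp
  show "- f + f = 0" by transfer simp
  show "f - g = f + - g" by transfer simp
  show "r *\<^sub>R (f + g) = r *\<^sub>R f + r *\<^sub>R g" by transfer (simp add: scaleR_add_right)
  show "(r + s) *\<^sub>R f = r *\<^sub>R f + s *\<^sub>R f" by transfer (simp add: scaleR_add_left)
  show "r *\<^sub>R s *\<^sub>R f = (r * s) *\<^sub>R f" by transfer simp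
  show "1 *\<^sub>R f = f" by transfer simp
  show "c *\<^sub>C (f + g) = c *\<^sub>C f + c *\<^sub>C g" by transfer (simp add: scaleC_add_right)
  show "(c + d) *\<^sub>C f = c *\<^sub>C f + d *\<^sub>C f" by transfer (simp add: scaleC_add_left)
  show "c *\<^sub>C d *\<^sub>C f = (c * d) *\<^sub>C f" by transfer (simp add: scaleC_scaleC)
  show "complex_of_real r *\<^sub>C f = r *\<^sub>R f" by transfer (simp add: scaleC_of_real)
  show "dist f g = norm (f - g)" by (rule dist_hardy_def)
  show "sgn f = inverse (norm f) *\<^sub>R f" by (rule sgn_hardy_def)
  show "uniformity = (INF e\<in>{0<..}. principal {(g :: 'a hardy, h). dist g h < e})"
    by (rule uniformity_hardy_def)
  show "open U \<longleftrightarrow> (\<forall>g\<in>U. \<forall>\<^sub>F (g', h) in uniformity. g' = g \<longrightarrow> h \<in> U)"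
    for U :: "'a hardy set"
    by (rule open_hardy_def)
  note sum_inner = summable_inner[OF summable_hcoeffs summable_hcoeffs]
  note sum_cinner = summable_cinner[OF summable_hcoeffs summable_hcoeffs]
  show "f \<bullet> g = g \<bullet> f" by (simp add: inner_hardy_def inner_commute)
  show "(f + g) \<bullet> h = f \<bullet> h + g \<bullet> h"
    by (simp add: inner_hardy_def coeff_simps inner_add_left suminf_add[OF sum_inner sum_inner])
  show "r *\<^sub>R f \<bullet> g = r * (f \<bullet> g)"
    by (simp add: inner_hardy_def coeff_simps suminf_mult[OF sum_inner])
  show "0 \<le> f \<bullet> f"
    by (simp add: inner_hardy_def suminf_nonneg[OF sum_inner])
  show "f \<bullet> f = 0 \<longleftrightarrow> f = 0"
  proof -
    have "f \<bullet> f = 0 \<longleftrightarrow> (\<forall>n. hcoeffs f n = 0)"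
      by (simp add: inner_hardy_def suminf_eq_zero_iff[OF sum_inner])
    also have "\<dots> \<longleftrightarrow> f = 0"
      by transfer auto
    finally show ?thesis .
  qed
  show "norm f = sqrt (f \<bullet> f)" by (rule norm_hardy_def)
  show "cinner f g = cnj (cinner g f)"
    unfolding cinner_hardy_def bounded_linear.suminf[OF bounded_linear_cnj sum_cinner]
    by (rule suminf_cong) (rule cinner_commute)
  show "cinner (f + g) h = cinner f h + cinner g h"
    by (simp add: cinner_hardy_def coeff_simps cinner_add_left
        suminf_add[OF sum_cinner sum_cinner])
  show "cinner (c *\<^sub>C f) g = c * cinner f g"
    by (simp add: cinner_hardy_def coeff_simps cinner_scaleC_left suminf_mult[OF sum_cinner])
  show "f \<bullet> g = Re (cinner f g)"
    unfolding cinner_hardy_def bounded_linear.suminf[OF bounded_linear_Re sum_cinner]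
    by (simp add: inner_hardy_def inner_eq_Re_cinner)
qed

end

lemma norm_hardy_eq: "(norm h)\<^sup>2 = (\<Sum>n. (norm (hcoeffs h n))\<^sup>2)"
  by (simp add: power2_norm_eq_inner inner_hardy_def)

lemma sum_hcoeffs_le: "(\<Sum>n<N. (norm (hcoeffs h n))\<^sup>2) \<le> (norm h)\<^sup>2"
  unfolding norm_hardy_eq by (rule sum_le_suminf[OF summable_hcoeffs]) auto

lemma norm_hcoeffs_le: "norm (hcoeffs h n) \<le> norm h"
proof -
  have "(norm (hcoeffs h n))\<^sup>2 \<le> (\<Sum>k<Suc n. (norm (hcoeffs h k))\<^sup>2)"
    by (rule member_le_sum) auto
  then show ?thesis
    using sum_hcoeffs_le[of h "Suc n"] by (metis norm_ge_zero order_trans power2_le_imp_le)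
qed

instance hardy :: (complex_hilbert) complex_hilbert
proof
  fix X :: "nat \<Rightarrow> 'a hardy"
  assume X: "Cauchy X"
  have "Cauchy (\<lambda>k. hcoeffs (X k) n)" for n
    unfolding Cauchy_def
  proof (intro allI impI)
    fix e :: real
    assume "e > 0"
    then obtain M where M: "\<And>j k. j \<ge> M \<Longrightarrow> k \<ge> M \<Longrightarrow> dist (X j) (X k) < e"
      using X unfolding Cauchy_def by blast
    have "dist (hcoeffs (X j) n) (hcoeffs (X k) n) \<le> dist (X j) (X k)" for j k
      using norm_hcoeffs_le[of "X j - X k" n] by (simp add: dist_norm minus_hardy.rep_eq)
    then show "\<exists>M. \<forall>j\<ge>M. \<forall>k\<ge>M. dist (hcoeffs (X j) n) (hcoeffs (X k) n) < e"
      using M by (meson le_less_trans)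
  qed
  then have "\<exists>a. \<forall>n. (\<lambda>k. hcoeffs (X k) n) \<longlonglongrightarrow> a n"
    by (intro choice) (metis Cauchy_convergent_iff convergent_def)
  then obtain a where a: "\<And>n. (\<lambda>k. hcoeffs (X k) n) \<longlonglongrightarrow> a n"
    by blast
  have tail: "\<exists>M. \<forall>k\<ge>M. \<forall>N. (\<Sum>n<N. (norm (hcoeffs (X k) n - a n))\<^sup>2) \<le> e\<^sup>2" if "e > 0" for e :: real
  proof -
    obtain M where M: "\<And>j k. j \<ge> M \<Longrightarrow> k \<ge> M \<Longrightarrow> dist (X j) (X k) < e"
      using X \<open>e > 0\<close> unfolding Cauchy_def by blast
    have "(\<Sum>n<N. (norm (hcoeffs (X k) n - a n))\<^sup>2) \<le> e\<^sup>2" if "k \<ge> M" for k N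
    proof (rule LIMSEQ_le_const2)
      show "(\<lambda>j. \<Sum>n<N. (norm (hcoeffs (X k) n - hcoeffs (X j) n))\<^sup>2)
          \<longlonglongrightarrow> (\<Sum>n<N. (norm (hcoeffs (X k) n - a n))\<^sup>2)"
        by (intro tendsto_intros a)
      have "(\<Sum>n<N. (norm (hcoeffs (X k) n - hcoeffs (X j) n))\<^sup>2) \<le> e\<^sup>2" if "j \<ge> M" for j
      proof -
        have "(\<Sum>n<N. (norm (hcoeffs (X k) n - hcoeffs (X j) n))\<^sup>2) \<le> (norm (X k - X j))\<^sup>2"
          using sum_hcoeffs_le[of "X k - X j" N] by (simp add: minus_hardy.rep_eq)
        also have "\<dots> \<le> e\<^sup>2"
          using M[OF \<open>k \<ge> M\<close> \<open>j \<ge> M\<close>] by (intro power_mono) (auto simp: dist_norm)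
        finally show ?thesis .
      qed
      then show "\<exists>M. \<forall>j\<ge>M. (\<Sum>n<N. (norm (hcoeffs (X k) n - hcoeffs (X j) n))\<^sup>2) \<le> e\<^sup>2"
        by blast
    qed
    then show ?thesis by blast
  qed
  have diff_sum: "summable (\<lambda>n. (norm (hcoeffs (X k) n - a n))\<^sup>2)"
    if "\<forall>N. (\<Sum>n<N. (norm (hcoeffs (X k) n - a n))\<^sup>2) \<le> e\<^sup>2" for k and e :: real
    using that
    by (intro bounded_imp_summable[where B = "e\<^sup>2"])
       (auto simp: lessThan_Suc_atMost[symmetric] simp del: sum.lessThan_Suc)
  obtain k0 where "\<forall>N. (\<Sum>n<N. (norm (hcoeffs (X k0) n - a n))\<^sup>2) \<le> 1\<^sup>2"
    using tail[OF zero_less_one] by blast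
  from diff_sum[OF this] have "summable (\<lambda>n. (norm (a n - hcoeffs (X k0) n + hcoeffs (X k0) n))\<^sup>2)"
    by (intro summable_sq_add summable_hcoeffs) (simp add: norm_minus_commute)
  then have "summable (\<lambda>n. (norm (a n))\<^sup>2)"
    by simp
  then have ca: "hcoeffs (Abs_hardy a) = a"
    by (simp add: Abs_hardy_inverse)
  have "X \<longlonglongrightarrow> Abs_hardy a"
  proof (rule metric_LIMSEQ_I)
    fix e :: real
    assume "e > 0"
    then obtain M where M: "\<forall>k\<ge>M. \<forall>N. (\<Sum>n<N. (norm (hcoeffs (X k) n - a n))\<^sup>2) \<le> (e/2)\<^sup>2"
      using tail[of "e/2"] by auto
    have "dist (X k) (Abs_hardy a) < e" if "k \<ge> M" for k
    proof -
      have "(norm (X k - Abs_hardy a))\<^sup>2 \<le> (e/2)\<^sup>2"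
        unfolding norm_hardy_eq minus_hardy.rep_eq ca
        using M that diff_sum by (intro suminf_le_const) blast+
      then have "norm (X k - Abs_hardy a) \<le> e/2"
        using \<open>e > 0\<close> by (metis half_gt_zero less_imp_le power2_le_imp_le)
      then show ?thesis
        using \<open>e > 0\<close> by (simp add: dist_norm)
    qed
    then show "\<exists>M. \<forall>k\<ge>M. dist (X k) (Abs_hardy a) < e" by blast
  qed
  then show "convergent X" by (rule convergentI)
qed

definition hardy_eval :: "'a::complex_hilbert hardy \<Rightarrow> complex \<Rightarrow> 'a"
  where "hardy_eval h z = (\<Sum>n. z ^ n *\<^sub>C hcoeffs h n)"

lemma summable_hardy_eval:
  fixes h :: "'a::complex_hilbert hardy"
  assumes "z \<in> \<D>"
  shows "summable (\<lambda>n. z ^ n *\<^sub>C hcoeffs h n)"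
proof (rule summable_norm_cancel, rule summable_comparison_test'[where N = 0])
  show "summable (\<lambda>n. norm h * cmod z ^ n)"
    using assms by (intro summable_mult summable_geometric) auto
  show "norm (norm (z ^ n *\<^sub>C hcoeffs h n)) \<le> norm h * cmod z ^ n" for n
    using mult_right_mono[OF norm_hcoeffs_le[of h n], of "cmod z ^ n"]
    by (simp add: norm_scaleC norm_power mult.commute)
qed

lemma bounded_linear_cinner_left: "bounded_linear (\<lambda>x. cinner x y)"
proof -
  have "bounded_linear (\<lambda>x. complex_of_real (x \<bullet> y) + \<i> * complex_of_real (x \<bullet> (\<i> *\<^sub>C y)))"
    by (intro bounded_linear_add bounded_linear_compose[OF bounded_linear_of_real]
        bounded_linear_compose[OF bounded_linear_mult_right]
        bounded_linear_inner_left)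
  then show ?thesis
    by (simp add: cinner_eq_inner Complex_eq)
qed

lemma hardy_eval_inject:
  fixes g h :: "'a::complex_hilbert hardy"
  assumes "\<And>z. z \<in> \<D> \<Longrightarrow> hardy_eval g z = hardy_eval h z"
  shows "g = h"
proof -
  have "cinner (hcoeffs g n) v = cinner (hcoeffs h n) v" for n v
  proof -
    define p where "p = (\<lambda>f :: 'a hardy. Abs_fps (\<lambda>n. cinner (hcoeffs f n) v))"
    have sums: "(\<lambda>n. fps_nth (p f) n * z ^ n) sums cinner (hardy_eval f z) v"
      if "z \<in> \<D>" for f z
      using bounded_linear.sums[OF bounded_linear_cinner_left[of v]
          summable_sums[OF summable_hardy_eval[OF that, of f]]]
      by (simp add: p_def hardy_eval_def cinner_scaleC_left mult.commute)
    have "ereal (norm (1/2 :: complex)) \<le> fps_conv_radius (p f)" for f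
      unfolding fps_conv_radius_def
      by (rule conv_radius_geI, rule sums_summable, rule sums) simp
    then have pos: "0 < fps_conv_radius (p f)" for f
      by (metis ereal_less(2) less_le_trans zero_less_norm_iff zero_neq_one divide_eq_0_iff zero_neq_numeral)
    have "p g = p h"
    proof (rule eval_fps_eqD[OF pos pos])
      have "eval_fps (p g) z = eval_fps (p h) z" if "z \<in> \<D>" for z
        using sums_unique[OF sums[OF that, of g]] sums_unique[OF sums[OF that, of h]] assms[OF that]
        by (simp add: eval_fps_def)
      then show "\<forall>\<^sub>F z in nhds 0. eval_fps (p g) z = eval_fps (p h) z"
        by (intro eventually_nhds[THEN iffD2] exI[of _ \<D>]) auto
    qed
    then have "fps_nth (p g) n = fps_nth (p h) n"
      by simp
    then show ?thesis
      by (simp add: p_def)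
  qed
  then have "cinner (hcoeffs g n - hcoeffs h n) (hcoeffs g n - hcoeffs h n) = 0" for n
    by (simp add: bounded_linear.linear[OF bounded_linear_cinner_left, THEN linear_diff])
  then have "hcoeffs g n = hcoeffs h n" for n
    by (simp add: cinner_self)
  then show ?thesis
    by (metis hcoeffs_inject ext)
qed

text \<open>The operator \<open>T\<^sub>F\<close> of multiplication by \<open>F\<close> between Hardy spaces.\<close>

definition mult_op ::
    "(complex \<Rightarrow> 'a::complex_hilbert \<Rightarrow>\<^sub>L 'b::complex_hilbert) \<Rightarrow> 'a hardy \<Rightarrow>\<^sub>L 'b hardy"
  where "mult_op F =
    (THE T. \<forall>h. \<forall>z\<in>\<D>. hardy_eval (blinfun_apply T h) z = blinfun_apply (F z) (hardy_eval h z))"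

definition prec_inf ::
    "(complex \<Rightarrow> 'a::complex_hilbert \<Rightarrow>\<^sub>L 'b::complex_hilbert) \<Rightarrow> (complex \<Rightarrow> 'a \<Rightarrow>\<^sub>L 'b) \<Rightarrow> bool"
    (infix "\<prec>\<^sub>\<infinity>" 50)
  where "F \<prec>\<^sub>\<infinity> G \<longleftrightarrow> mult_op F \<prec> mult_op G"

section \<open>The conditions on a pair of Schur class functions\<close>

text \<open>For \<open>G\<close> in the Schur class the defect spaces of \<open>G z\<close> and of its adjoint are the same for
  all \<open>z\<close> in the disc, so evaluating at the origin involves no loss of generality.

  If \<open>schur_defect G = {0}\<close> then the only possible \<open>R\<close> is zero and \<open>2 * sup_norm (Re R) - 1\<close> is
  negative; bounds involving its square root only make sense when \<open>schur_defect G \<noteq> {0}\<close>.\<close>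

definition schur_defect ::
    "(complex \<Rightarrow> 'a::complex_hilbert \<Rightarrow>\<^sub>L 'b::complex_hilbert) \<Rightarrow> 'a set"
  where "schur_defect G = defect_space (G 0)"

definition schur_codefect ::
    "(complex \<Rightarrow> 'a::complex_hilbert \<Rightarrow>\<^sub>L 'b::complex_hilbert) \<Rightarrow> 'b set"
  where "schur_codefect G = defect_space (adj (G 0))"

definition SCPO_i ::
    "(complex \<Rightarrow> 'a::complex_hilbert \<Rightarrow>\<^sub>L 'b::complex_hilbert) \<Rightarrow> (complex \<Rightarrow> 'a \<Rightarrow>\<^sub>L 'b) \<Rightarrow>
      (complex \<Rightarrow> 'a \<Rightarrow>\<^sub>L 'b) \<Rightarrow> bool"
  where "SCPO_i F G Q \<longleftrightarrow>
    Q ` \<D> \<subseteq> ops_between (schur_defect G) (schur_codefect G) \<and> bounded (Q ` \<D>) \<and>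
    (\<forall>z\<in>\<D>. F z - G z = defect (adj (G z)) o\<^sub>L Q z o\<^sub>L defect (G z))"

definition SCPO_ii ::
    "(complex \<Rightarrow> 'a::complex_hilbert \<Rightarrow>\<^sub>L 'b::complex_hilbert) \<Rightarrow> (complex \<Rightarrow> 'a \<Rightarrow>\<^sub>L 'b) \<Rightarrow>
      (complex \<Rightarrow> 'a \<Rightarrow>\<^sub>L 'a) \<Rightarrow> bool"
  where "SCPO_ii F G R \<longleftrightarrow>
    R ` \<D> \<subseteq> ops_between (schur_defect G) (schur_defect G) \<and> bounded (R ` \<D>) \<and>
    (\<forall>z\<in>\<D>. id_blinfun - (adj (F z) o\<^sub>L G z) = defect (G z) o\<^sub>L R z o\<^sub>L defect (G z))"

definition SCPO_iii ::
    "(complex \<Rightarrow> 'a::complex_hilbert \<Rightarrow>\<^sub>L 'b::complex_hilbert) \<Rightarrow> (complex \<Rightarrow> 'a \<Rightarrow>\<^sub>L 'b) \<Rightarrow>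
      real \<Rightarrow> bool"
  where "SCPO_iii F G r \<longleftrightarrow>
    r > 0 \<and> (\<forall>\<epsilon>. cmod \<epsilon> \<le> r \<longrightarrow> (\<lambda>z. (1 - \<epsilon>) *\<^sub>C G z + \<epsilon> *\<^sub>C F z) \<in> schur)"

definition SCPO_iv ::
    "(complex \<Rightarrow> 'a::complex_hilbert \<Rightarrow>\<^sub>L 'b::complex_hilbert) \<Rightarrow> (complex \<Rightarrow> 'a \<Rightarrow>\<^sub>L 'b) \<Rightarrow>
      real \<Rightarrow> bool"
  where "SCPO_iv F G r \<longleftrightarrow>
    r > 0 \<and> (\<forall>\<epsilon>. cmod \<epsilon> = r \<longrightarrow> (\<lambda>z. (1 - \<epsilon>) *\<^sub>C G z + \<epsilon> *\<^sub>C F z) \<in> schur)"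

end

theory Submission
  imports Defs "HOL-Complex_Analysis.Conformal_Mappings"
begin

text \<open>Everything is reduced to inequalities for forms.  For a contraction \<open>B\<close> with defect operator
  \<open>D\<close> the only identity needed is \<open>\<parallel>D x\<parallel>\<^sup>2 = \<parallel>x\<parallel>\<^sup>2 - \<parallel>B x\<parallel>\<^sup>2\<close>, and by a two-sided version of Douglas'
  lemma an operator \<open>T\<close> factors as \<open>D\<^sub>2 X D\<^sub>1\<close> with \<open>\<parallel>X\<parallel> \<le> c\<close> as soon as
  \<open>\<bar>\<langle>T x, y\<rangle>\<bar> \<le> c \<parallel>D\<^sub>1 x\<parallel> \<parallel>D\<^sub>2 y\<parallel>\<close>.  This gives the equivalences, with bounds, for a single pair of
  contractions, hence for the values of \<open>F\<close> and \<open>G\<close> uniformly on the disc (the defect spaces do not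
  depend on the point by the maximum principle).  The same equivalences applied to the
  multiplication operators settle \<open>F \<prec>\<^sub>\<infinity> G\<close>, because \<open>(1 - \<epsilon>) T\<^sub>G + \<epsilon> T\<^sub>F\<close> is a contraction if and
  only if \<open>(1 - \<epsilon>) G + \<epsilon> F\<close> is in the Schur class.  Finally, all estimates in which \<open>r\<close> occurs
  hold for \<open>1 / r = \<parallel>R\<parallel> + sqrt (\<parallel>R\<parallel>\<^sup>2 + 2 \<parallel>Re R\<parallel> - 1)\<close>.\<close>

section \<open>Riesz representation and factorization of operators\<close>

text \<open>The defect operator of a multiplication operator is in general not multiplication by the
  pointwise defects, so a factor \<open>X\<close> for \<open>mult_op F \<prec> mult_op G\<close>
  cannot be cut into values \<open>Q z\<close> or \<open>R z\<close>. Condition (iii) involves norms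
  only, and norms do pass between \<open>mult_op\<close> and the values; hence it is the one that
  connects \<open>\<prec>\<^sub>\<infinity>\<close> with the disc. For a pair of contractions the
  hub is condition (ii), \<open>id - adj A B = D Y D\<close>. Contractivity of \<open>A\<close>
  gives \<open>\<parallel>(A - B) x\<parallel>\<^sup>2 \<le> 2 \<langle>Y D x, D x\<rangle> -
  \<parallel>D x\<parallel>\<^sup>2\<close>, with real inner products. So the real part of
  \<open>Y\<close> is at least 1/2 on the range of \<open>D\<close>, and an upper bound \<tau> for
  it produces every \<open>2 * \<tau> - 1\<close>. The special \<open>r\<close> is the positive
  solution of \<open>2 * \<rho> * r + (2 * \<tau> - 1) * r\<^sup>2 = 1\<close>, the largest radius
  for which the norm estimate of a perturbation closes. The Hilbert space theory is developed for
  the real inner product; complex linearity is recovered from commutation with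
  \<open>\<i>\<close>.\<close>

lemma linear_coeff_zero_of_nonneg_quadratic:
  fixes a b :: real
  assumes "\<And>t. 0 \<le> 2 * t * a + t\<^sup>2 * b"
  shows "a = 0"
proof (rule ccontr)
  assume "a \<noteq> 0"
  \<comment> \<open>A step in the direction where the linear term is negative, short enough for it
    to dominate; the \<open>+ 1\<close> covers \<open>b = 0\<close>.\<close>
  define t where "t = - a / (\<bar>b\<bar> + 1)"
  have e: "2 * t * a + t\<^sup>2 * b = a\<^sup>2 * (b - 2 * (\<bar>b\<bar> + 1)) / (\<bar>b\<bar> + 1)\<^sup>2"
    unfolding t_def by (simp add: divide_simps power2_eq_square) (simp add: algebra_simps)
  have "a\<^sup>2 * (b - 2 * (\<bar>b\<bar> + 1)) < 0"
    using \<open>a \<noteq> 0\<close> by (intro mult_pos_neg) auto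
  then have "a\<^sup>2 * (b - 2 * (\<bar>b\<bar> + 1)) / (\<bar>b\<bar> + 1)\<^sup>2 < 0"
    by (intro divide_neg_pos) auto
  then show False
    using assms[of t] e by linarith
qed

text \<open>Direct method: \<open>J\<close> is bounded below, a minimizing sequence is Cauchy by the
  parallelogram law, and the vanishing first variation at the minimizer is the representation.
  \<open>M = UNIV\<close> gives Riesz' theorem, an inner product as \<open>f\<close> gives
  orthogonal projections.\<close>

lemma riesz_closed_subspace:
  fixes f :: "'a::{real_inner,banach} \<Rightarrow> real"
  assumes M: "closed M" "subspace M" and f: "bounded_linear f"
  obtains m where "m \<in> M" "\<And>v. v \<in> M \<Longrightarrow> f v = m \<bullet> v"
proof -
  interpret f: bounded_linear f by fact
  define J where "J m = m \<bullet> m - 2 * f m" for m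
  obtain K where K: "\<And>x. norm (f x) \<le> norm x * K"
    using f.bounded by blast
  have low: "- K\<^sup>2 \<le> J m" for m
  proof -
    have "f m \<le> norm m * K" using K[of m] by simp
    moreover have "0 \<le> (norm m - K)\<^sup>2" by simp
    ultimately show ?thesis
      by (simp add: J_def power2_diff power2_norm_eq_inner)
  qed
  define d where "d = (INF m\<in>M. J m)"
  have bdd: "bdd_below (J ` M)"
    using low by (intro bdd_belowI2)
  have ne: "M \<noteq> {}"
    using M(2) subspace_0 by blast
  have d_le: "d \<le> J m" if "m \<in> M" for m
    unfolding d_def using bdd that by (rule cINF_lower)
  have "\<exists>m\<in>M. J m < d + 1 / Suc n" for n
    using cINF_less_iff[OF ne bdd, of "d + 1 / Suc n"] by (simp add: d_def)
  then obtain s where s: "\<And>n. s n \<in> M" "\<And>n. J (s n) < d + 1 / Suc n"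
    by metis
  \<comment> \<open>The linear part of \<open>J\<close> cancels against the midpoint, so almost
    minimal values force closeness.\<close>
  have par: "(norm (m - m'))\<^sup>2 \<le> 2 * (J m - d) + 2 * (J m' - d)" if "m \<in> M" "m' \<in> M" for m m'
  proof -
    define p where "p = (1/2) *\<^sub>R (m + m')"
    have "p \<in> M"
      unfolding p_def using that M(2) by (simp add: subspace_add subspace_scale)
    then have "d \<le> J p" by (rule d_le)
    moreover have "(norm (m - m'))\<^sup>2 = 2 * J m + 2 * J m' - 4 * J p"
      by (simp add: p_def J_def power2_norm_eq_inner f.add f.scaleR inner_simps inner_commute algebra_simps)
    ultimately show ?thesis by (simp add: algebra_simps)
  qed
  have "Cauchy s"
  proof (rule metric_CauchyI)
    fix e :: real assume "e > 0"
    then obtain N where N: "1 / Suc N < e\<^sup>2 / 4"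
      by (metis nat_approx_posE zero_less_power zero_less_divide_iff zero_less_numeral)
    have "dist (s j) (s k) < e" if "j \<ge> N" "k \<ge> N" for j k
    proof -
      have "1 / Suc j \<le> 1 / Suc N" "1 / Suc k \<le> 1 / Suc N"
        using that by (auto simp: frac_le)
      then have "(norm (s j - s k))\<^sup>2 < e\<^sup>2"
        using par[OF s(1) s(1), of j k] s(2)[of j] s(2)[of k] N by argo
      then show ?thesis
        using \<open>e > 0\<close> by (simp add: dist_norm power2_less_imp_less)
    qed
    then show "\<exists>N. \<forall>j\<ge>N. \<forall>k\<ge>N. dist (s j) (s k) < e" by blast
  qed
  then obtain m where m: "s \<longlonglongrightarrow> m"
    by (metis Cauchy_convergent_iff convergent_def)
  have mM: "m \<in> M"
    using M(1) s(1) m closed_sequentially by blast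
  have "(\<lambda>n. J (s n)) \<longlonglongrightarrow> J m"
    unfolding J_def by (intro tendsto_intros f.tendsto m)
  moreover have "(\<lambda>n. d + 1 / Suc n) \<longlonglongrightarrow> d + 0"
    by (intro tendsto_intros LIMSEQ_Suc lim_1_over_n)
  ultimately have "J m \<le> d"
    using s(2) by (intro LIMSEQ_le) (auto intro: less_imp_le)
  have "f v = m \<bullet> v" if "v \<in> M" for v
  proof -
    have "0 \<le> 2 * t * (m \<bullet> v - f v) + t\<^sup>2 * (v \<bullet> v)" for t
    proof -
      have "d \<le> J (m + t *\<^sub>R v)"
        using mM that M(2) by (intro d_le) (simp add: subspace_add subspace_scale)
      then show ?thesis
        using \<open>J m \<le> d\<close>
        by (simp add: J_def f.add f.scaleR inner_simps inner_commute algebra_simps power2_eq_square)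
    qed
    then show ?thesis
      using linear_coeff_zero_of_nonneg_quadratic by fastforce
  qed
  then show ?thesis using that mM by blast
qed

lemma orthogonal_decomposition:
  fixes x :: "'a::{real_inner,banach}"
  assumes "closed M" "subspace M"
  obtains m where "m \<in> M" "\<And>v. v \<in> M \<Longrightarrow> (x - m) \<bullet> v = 0"
  by (rule riesz_closed_subspace[OF assms bounded_linear_inner_right[of x]])
     (metis diff_self inner_diff_left)

lemma real_adjoint_exists:
  fixes A :: "'a::{real_inner,banach} \<Rightarrow>\<^sub>L 'b::real_inner"
  obtains B :: "'b \<Rightarrow>\<^sub>L 'a" where "\<And>x y. A x \<bullet> y = x \<bullet> B y"
proof -
  have "\<exists>w. \<forall>x. A x \<bullet> y = x \<bullet> w" for y
  proof -
    have "bounded_linear (\<lambda>x. A x \<bullet> y)"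
      by (intro bounded_linear_compose[OF bounded_linear_inner_left blinfun.bounded_linear_right])
    from riesz_closed_subspace[OF closed_UNIV subspace_UNIV this] show ?thesis
      by (metis UNIV_I inner_commute)
  qed
  then obtain b where b: "\<And>x y. A x \<bullet> y = x \<bullet> b y"
    by metis
  have eqI: "u = v" if "\<And>x. x \<bullet> u = x \<bullet> v" for u v :: 'a
    by (metis that vector_eq_ldot)
  have "bounded_linear b"
  proof
    show "b (x + y) = b x + b y" for x y
      by (rule eqI) (simp add: b[symmetric] inner_add_right)
    show "b (r *\<^sub>R x) = r *\<^sub>R b x" for r x
      by (rule eqI) (simp add: b[symmetric])
    show "\<exists>K. \<forall>x. norm (b x) \<le> norm x * K"
    proof (intro exI allI)
      fix x
      have "norm (b x) * norm (b x) = A (b x) \<bullet> x"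
        by (simp add: b power2_norm_eq_inner[symmetric] power2_eq_square)
      also have "\<dots> \<le> norm (A (b x)) * norm x"
        by (rule norm_cauchy_schwarz)
      also have "\<dots> \<le> (norm A * norm (b x)) * norm x"
        by (intro mult_right_mono norm_blinfun) simp
      finally have "norm (b x) * norm (b x) \<le> norm (b x) * (norm x * norm A)"
        by (simp add: mult_ac)
      then show "norm (b x) \<le> norm x * norm A"
        by (cases "norm (b x) = 0") (simp_all add: mult_le_cancel_left)
    qed
  qed
  then have "A x \<bullet> y = x \<bullet> Blinfun b y" for x y
    by (simp add: b bounded_linear_Blinfun_apply)
  then show ?thesis using that by blast
qed

section \<open>Closures of ranges and one-sided Douglas factorization\<close>

lemma subspace_closure_range_blinfun:
  fixes D :: "'a::real_normed_vector \<Rightarrow>\<^sub>L 'b::real_normed_vector"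
  shows "subspace (closure (range D))"
proof -
  have sub: "subspace (range D)"
    by (auto simp: subspace_def image_iff simp flip: blinfun.add_right blinfun.scaleR_right)
      (rule exI[of _ 0], simp)
  show ?thesis
  proof (rule subspaceI)
    show "0 \<in> closure (range D)"
      by (rule subsetD[OF closure_subset subspace_0[OF sub]])
  next
    fix x y assume "x \<in> closure (range D)" "y \<in> closure (range D)"
    then obtain s t where "\<forall>n. s n \<in> range D" "s \<longlonglongrightarrow> x" "\<forall>n. t n \<in> range D" "t \<longlonglongrightarrow> y"
      unfolding closure_sequential by blast
    moreover from this have "s n + t n \<in> range D" for n
      by (simp add: subspace_add[OF sub])
    ultimately show "x + y \<in> closure (range D)"
      unfolding closure_sequential by (intro exI[of _ "\<lambda>n. s n + t n"]) (auto intro: tendsto_add)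
  next
    fix c x assume "x \<in> closure (range D)"
    then obtain s where "\<forall>n. s n \<in> range D" "s \<longlonglongrightarrow> x"
      unfolding closure_sequential by blast
    moreover from this have "c *\<^sub>R s n \<in> range D" for n
      by (simp add: subspace_scale[OF sub])
    ultimately show "c *\<^sub>R x \<in> closure (range D)"
      unfolding closure_sequential by (intro exI[of _ "\<lambda>n. c *\<^sub>R s n"]) (auto intro: tendsto_intros)
  qed
qed

lemma orthogonal_closure:
  fixes x :: "'a::real_inner"
  assumes "\<And>v. v \<in> S \<Longrightarrow> x \<bullet> v = 0" and "v \<in> closure S"
  shows "x \<bullet> v = 0"
proof -
  have "closed {v. x \<bullet> v = 0}"
    by (intro closed_Collect_eq continuous_intros)
  then have "closure S \<subseteq> {v. x \<bullet> v = 0}"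
    using assms(1) by (intro closure_minimal) auto
  then show ?thesis using assms(2) by blast
qed

lemma range_decomposition:
  fixes D :: "'a::real_normed_vector \<Rightarrow>\<^sub>L 'b::{real_inner,banach}"
  obtains m where "m \<in> closure (range D)" "\<forall>v. (u - m) \<bullet> D v = 0"
  using orthogonal_decomposition[OF closed_closure subspace_closure_range_blinfun, of D u]
  by (metis closure_subset rangeI subsetD)

text \<open>The closure of the range is the double orthogonal complement of the range: the component
  of \<open>w\<close> orthogonal to the range is itself orthogonal to \<open>w\<close>, hence
  zero.\<close>

lemma in_closure_rangeI:
  fixes D :: "'a::real_normed_vector \<Rightarrow>\<^sub>L 'b::{real_inner,banach}"
  assumes "\<And>u. (\<And>v. u \<bullet> D v = 0) \<Longrightarrow> u \<bullet> w = 0"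
  shows "w \<in> closure (range D)"
proof -
  obtain m where m: "m \<in> closure (range D)" "\<forall>v. (w - m) \<bullet> D v = 0"
    by (rule range_decomposition[of D w])
  have "(w - m) \<bullet> w = 0" using assms m(2) by blast
  moreover have "(w - m) \<bullet> m = 0"
    by (rule orthogonal_closure[OF _ m(1)]) (use m(2) in auto)
  ultimately have "(w - m) \<bullet> (w - m) = 0"
    by (simp add: inner_diff_right)
  then show ?thesis using m(1) by simp
qed

text \<open>The closure of the range and its orthogonal complement span the space, so factors
  extended by zero are determined on the range.\<close>

lemma blinfun_eq_on_range_and_complement:
  fixes D :: "'a::real_normed_vector \<Rightarrow>\<^sub>L 'b::{real_inner,banach}" and X Y :: "'b \<Rightarrow>\<^sub>L 'c::real_normed_vector"
  assumes "\<And>x. X (D x) = Y (D x)" and "\<And>u. (\<And>v. u \<bullet> D v = 0) \<Longrightarrow> X u = Y u"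
  shows "X = Y"
proof (rule blinfun_eqI)
  fix u
  obtain m where m: "m \<in> closure (range D)" "\<forall>v. (u - m) \<bullet> D v = 0"
    by (rule range_decomposition[of D u])
  have "closed {m. X m = Y m}"
    by (intro closed_Collect_eq continuous_intros)
  then have "closure (range D) \<subseteq> {m. X m = Y m}"
    using assms(1) by (intro closure_minimal) auto
  then have "X m = Y m" using m(1) by blast
  moreover have "X (u - m) = Y (u - m)"
    using assms(2) m(2) by blast
  ultimately show "X u = Y u"
    by (simp add: blinfun.diff_right)
qed

text \<open>The factor is the closure of the relation \<open>D x \<mapsto> T x\<close>, extended by zero on the orthogonal
  complement of the range of \<open>D\<close>.\<close>

lemma douglas_factorization:
  fixes D :: "'a::real_normed_vector \<Rightarrow>\<^sub>L 'c::{real_inner,banach}" and T :: "'a \<Rightarrow>\<^sub>L 'b::banach"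
  assumes le: "\<And>x. norm (T x) \<le> c * norm (D x)" and c: "0 \<le> c"
  obtains X :: "'c \<Rightarrow>\<^sub>L 'b"
    where "X o\<^sub>L D = T" "\<And>u. (\<And>v. u \<bullet> D v = 0) \<Longrightarrow> X u = 0"
      "norm X \<le> c" "range X \<subseteq> closure (range T)"
proof -
  define P where "P s m u v \<longleftrightarrow> (\<lambda>n. D (s n)) \<longlonglongrightarrow> m \<and> (\<lambda>n. T (s n)) \<longlonglongrightarrow> v
    \<and> (\<forall>w. (u - m) \<bullet> D w = 0)" for s m u v
  define R where "R u v \<longleftrightarrow> (\<exists>s m. P s m u v)" for u v
  have total: "\<exists>v. R u v" for u
  proof -
    obtain m where m: "m \<in> closure (range D)" "\<forall>v. (u - m) \<bullet> D v = 0"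
      by (rule range_decomposition[of D u])
    then obtain t where "\<And>n. t n \<in> range D" "t \<longlonglongrightarrow> m"
      unfolding closure_sequential by blast
    then have "\<forall>n. \<exists>x. t n = D x" by blast
    then obtain s where "\<And>n. t n = D (s n)" by metis
    then have s: "(\<lambda>n. D (s n)) \<longlonglongrightarrow> m"
      using \<open>t \<longlonglongrightarrow> m\<close> by presburger
    have "Cauchy (\<lambda>n. T (s n))"
    proof (rule metric_CauchyI)
      fix e :: real assume "e > 0"
      \<comment> \<open>\<open>c + 1\<close> instead of \<open>c\<close>, which may be zero.\<close>
      with c have "e / (c + 1) > 0" by simp
      moreover have "Cauchy (\<lambda>n. D (s n))" using s by (rule LIMSEQ_imp_Cauchy)
      ultimately obtain N where N: "\<And>j k. j \<ge> N \<Longrightarrow> k \<ge> N \<Longrightarrow> dist (D (s j)) (D (s k)) < e / (c + 1)"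
        unfolding Cauchy_def by meson
      have "dist (T (s j)) (T (s k)) < e" if "j \<ge> N" "k \<ge> N" for j k
      proof -
        have "dist (T (s j)) (T (s k)) \<le> c * dist (D (s j)) (D (s k))"
          using le[of "s j - s k"] by (simp add: dist_norm blinfun.diff_right)
        also have "\<dots> \<le> (c + 1) * dist (D (s j)) (D (s k))"
          by (intro mult_right_mono) auto
        also have "\<dots> < (c + 1) * (e / (c + 1))"
          using N[OF that] c by (intro mult_strict_left_mono) auto
        finally show ?thesis using c by simp
      qed
      then show "\<exists>N. \<forall>j\<ge>N. \<forall>k\<ge>N. dist (T (s j)) (T (s k)) < e" by blast
    qed
    then show ?thesis
      using s m(2) unfolding R_def P_def by (metis Cauchy_convergent_iff convergent_def)
  qed
  \<comment> \<open>\<open>m\<close> is the projection of \<open>u\<close> onto the closure of the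
    range, so the extension by zero keeps the constant \<open>c\<close>. Applied to a difference
    \<open>v - v'\<close> over zero, the bound also makes the relation single-valued.\<close>
  have bound: "norm v \<le> c * norm u" if uv: "R u v" for u v
  proof -
    obtain s m where "P s m u v"
      using uv unfolding R_def by blast
    then have s: "(\<lambda>n. D (s n)) \<longlonglongrightarrow> m" "(\<lambda>n. T (s n)) \<longlonglongrightarrow> v"
      and m: "\<forall>w. (u - m) \<bullet> D w = 0"
      by (auto simp: P_def)
    have "(\<lambda>n. (u - m) \<bullet> D (s n)) \<longlonglongrightarrow> (u - m) \<bullet> m"
      by (intro tendsto_intros s)
    then have "(u - m) \<bullet> m = 0"
      using LIMSEQ_unique[of "\<lambda>_. 0::real"] by (simp add: m)
    then have "norm m * norm m = u \<bullet> m"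
      by (simp add: inner_diff_left power2_norm_eq_inner[symmetric] power2_eq_square)
    also have "\<dots> \<le> norm u * norm m" by (rule norm_cauchy_schwarz)
    finally have "norm m \<le> norm u"
      by (cases "norm m = 0") (simp_all add: mult_le_cancel_right)
    have "norm v \<le> c * norm m"
      by (rule LIMSEQ_le[OF tendsto_norm[OF s(2)] tendsto_mult_left[OF tendsto_norm[OF s(1)]]])
         (use le in blast)
    also have "\<dots> \<le> c * norm u"
      using \<open>norm m \<le> norm u\<close> c by (rule mult_left_mono)
    finally show ?thesis .
  qed
  have lin: "R (a *\<^sub>R u + b *\<^sub>R u') (a *\<^sub>R v + b *\<^sub>R v')" if uv: "R u v" "R u' v'" for u u' v v' a b
  proof -
    obtain s m s' m' where "P s m u v" "P s' m' u' v'"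
      using uv unfolding R_def by blast
    then have s: "(\<lambda>n. D (s n)) \<longlonglongrightarrow> m" "(\<lambda>n. T (s n)) \<longlonglongrightarrow> v"
      "\<forall>w. (u - m) \<bullet> D w = 0" "(\<lambda>n. D (s' n)) \<longlonglongrightarrow> m'" "(\<lambda>n. T (s' n)) \<longlonglongrightarrow> v'"
      "\<forall>w. (u' - m') \<bullet> D w = 0"
      by (auto simp: P_def)
    have "(\<lambda>n. D (a *\<^sub>R s n + b *\<^sub>R s' n)) \<longlonglongrightarrow> a *\<^sub>R m + b *\<^sub>R m'"
      "(\<lambda>n. T (a *\<^sub>R s n + b *\<^sub>R s' n)) \<longlonglongrightarrow> a *\<^sub>R v + b *\<^sub>R v'"
      unfolding blinfun.add_right blinfun.scaleR_right by (intro tendsto_intros s)+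
    moreover have "(a *\<^sub>R u + b *\<^sub>R u' - (a *\<^sub>R m + b *\<^sub>R m')) \<bullet> D w = 0" for w
    proof -
      have "a *\<^sub>R u + b *\<^sub>R u' - (a *\<^sub>R m + b *\<^sub>R m') = a *\<^sub>R (u - m) + b *\<^sub>R (u' - m')"
        by (simp add: algebra_simps)
      then show ?thesis using s(3,6) by (simp add: inner_add_left)
    qed
    ultimately show ?thesis
      unfolding R_def P_def
      by (intro exI[of _ "\<lambda>n. a *\<^sub>R s n + b *\<^sub>R s' n"] exI[of _ "a *\<^sub>R m + b *\<^sub>R m'"]) blast
  qed
  have uniq: "v = v'" if "R u v" "R u v'" for u v v'
  proof -
    have "R (1 *\<^sub>R u + (-1) *\<^sub>R u) (1 *\<^sub>R v + (-1) *\<^sub>R v')"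
      using that by (rule lin)
    then have "norm (v - v') \<le> 0" using bound by fastforce
    then show ?thesis by simp
  qed
  obtain g where g: "\<And>u. R u (g u)" using total by metis
  have geq: "g u = v" if "R u v" for u v using g that uniq by blast
  have bl: "bounded_linear g"
  proof
    show "g (x + y) = g x + g y" for x y
      using lin[OF g[of x] g[of y], of 1 1] by (intro geq) simp
    show "g (r *\<^sub>R x) = r *\<^sub>R g x" for r x
      using lin[OF g[of x] g[of x], of r 0] by (intro geq) simp
    show "\<exists>K. \<forall>x. norm (g x) \<le> norm x * K"
      using bound[OF g] by (metis mult.commute)
  qed
  have app: "Blinfun g u = g u" for u by (simp add: bounded_linear_Blinfun_apply bl)
  show ?thesis
  proof (rule that[of "Blinfun g"])
    show "Blinfun g o\<^sub>L D = T"
    proof (rule blinfun_eqI)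
      fix x
      have "R (D x) (T x)"
        unfolding R_def P_def by (intro exI[of _ "\<lambda>_. x"] exI[of _ "D x"]) auto
      then show "(Blinfun g o\<^sub>L D) x = T x" using geq by (simp add: app)
    qed
    show "Blinfun g u = 0" if "\<And>v. u \<bullet> D v = 0" for u
    proof -
      have "R u 0"
        unfolding R_def P_def using that by (intro exI[of _ "\<lambda>_. 0"] exI[of _ "0"]) auto
      then show ?thesis using geq by (simp add: app)
    qed
    show "norm (Blinfun g) \<le> c"
      using bound[OF g] c by (intro norm_blinfun_bound) (auto simp: app)
    show "range (Blinfun g) \<subseteq> closure (range T)"
    proof
      fix y assume "y \<in> range (Blinfun g)"
      then obtain u where y: "y = g u" by (auto simp: app)
      from g[of u] obtain s m where "P s m u (g u)"
        unfolding R_def by blast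
      then have "(\<lambda>n. T (s n)) \<longlonglongrightarrow> g u"
        by (simp add: P_def)
      then show "y \<in> closure (range T)"
        unfolding y closure_sequential by (intro exI[of _ "\<lambda>n. T (s n)"]) auto
    qed
  qed
qed

section \<open>Complex linear operators and adjoints\<close>

lemma scaleC_one [simp]: "1 *\<^sub>C x = x"
  by (metis of_real_1 scaleC_of_real scaleR_one)

lemma scaleC_ii_ii [simp]: "\<i> *\<^sub>C \<i> *\<^sub>C x = - x"
  by (metis i_squared of_real_1 of_real_minus scaleC_of_real scaleC_scaleC scaleR_minus1_left)

lemma scaleC_eq_scaleR: "c *\<^sub>C x = Re c *\<^sub>R x + Im c *\<^sub>R (\<i> *\<^sub>C x)"
proof -
  have "c = of_real (Re c) + of_real (Im c) * \<i>"
    by (simp add: complex_eq_iff)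
  then have "c *\<^sub>C x = (of_real (Re c) + of_real (Im c) * \<i>) *\<^sub>C x"
    by simp
  then show ?thesis
    by (simp only: scaleC_add_left scaleC_scaleC[symmetric] scaleC_of_real)
qed

lemma inner_scaleC_left: "(c *\<^sub>C x) \<bullet> (y :: 'a :: complex_inner) = x \<bullet> (cnj c *\<^sub>C y)"
  by (simp add: inner_eq_Re_cinner cinner_scaleC_left cinner_scaleC_right)

lemma scaleC_minus_left: "(- c) *\<^sub>C x = - (c *\<^sub>C (x :: 'a :: complex_vector))"
  by (metis add_diff_cancel_left' add_uminus_conv_diff diff_zero diff_self
      scaleC_add_left scaleR_zero_left scaleC_of_real of_real_0)

lemma scaleC_zero_right [simp]: "c *\<^sub>C (0::'a::complex_vector) = 0"
  by (metis add_cancel_right_right scaleC_add_right)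

lemma scaleC_minus_right: "c *\<^sub>C (- x) = - (c *\<^sub>C (x :: 'a :: complex_vector))"
  by (metis add.left_inverse add_eq_0_iff scaleC_add_right scaleC_zero_right)

lemma scaleC_diff_right: "c *\<^sub>C (x - y) = c *\<^sub>C x - c *\<^sub>C (y :: 'a :: complex_vector)"
  by (simp only: diff_conv_add_uminus scaleC_add_right scaleC_minus_right)

lemma inner_ii_left: "(\<i> *\<^sub>C x) \<bullet> y = - (x \<bullet> (\<i> *\<^sub>C (y :: 'a :: complex_inner)))"
  by (simp add: inner_scaleC_left scaleC_minus_left)

lemma inner_ii_ii [simp]: "(\<i> *\<^sub>C x) \<bullet> (\<i> *\<^sub>C y) = x \<bullet> (y :: 'a :: complex_inner)"
  by (simp add: inner_ii_left)

lemma vector_space_scaleC: "vector_space (scaleC :: complex \<Rightarrow> 'a::complex_vector \<Rightarrow> 'a)"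
  by unfold_locales (simp_all add: scaleC_add_right scaleC_add_left scaleC_scaleC)

lemma is_clinear_iff_scaleC:
  fixes A :: "'a::complex_inner \<Rightarrow>\<^sub>L 'b::complex_inner"
  shows "is_clinear (blinfun_apply A) \<longleftrightarrow> (\<forall>c x. A (c *\<^sub>C x) = c *\<^sub>C A x)"
  by (auto simp: is_clinear_def Vector_Spaces.linear_def module_hom_def module_hom_axioms_def
      module_iff_vector_space vector_space_scaleC blinfun.add_right)

text \<open>Real linearity is built into the type, so commuting with \<open>\<i>\<close> suffices.
  This is a closed condition on the operator and survives norm limits.\<close>

lemma is_clinear_iff_ii:
  fixes A :: "'a::complex_inner \<Rightarrow>\<^sub>L 'b::complex_inner"
  shows "is_clinear (blinfun_apply A) \<longleftrightarrow> (\<forall>x. A (\<i> *\<^sub>C x) = \<i> *\<^sub>C A x)"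
proof
  assume *: "\<forall>x. A (\<i> *\<^sub>C x) = \<i> *\<^sub>C A x"
  have "A (c *\<^sub>C x) = c *\<^sub>C A x" for c x
    using * by (simp add: scaleC_eq_scaleR[of c] blinfun.add_right blinfun.scaleR_right)
  then show "is_clinear (blinfun_apply A)"
    by (simp add: is_clinear_iff_scaleC)
qed (simp add: is_clinear_iff_scaleC)

lemma is_clinear_scaleC:
  fixes A :: "'a::complex_inner \<Rightarrow>\<^sub>L 'b::complex_inner"
  shows "is_clinear (blinfun_apply A) \<Longrightarrow> A (c *\<^sub>C x) = c *\<^sub>C A x"
  by (simp add: is_clinear_iff_scaleC)

lemma is_clinear_id_blinfun: "is_clinear (blinfun_apply (id_blinfun :: 'a::complex_inner \<Rightarrow>\<^sub>L 'a))"
  unfolding is_clinear_iff_scaleC by simp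

lemma is_clinear_compose:
  fixes A :: "'b::complex_inner \<Rightarrow>\<^sub>L 'c::complex_inner" and B :: "'a::complex_inner \<Rightarrow>\<^sub>L 'b"
  assumes "is_clinear (blinfun_apply A)" "is_clinear (blinfun_apply B)"
  shows "is_clinear (blinfun_apply (A o\<^sub>L B))"
  using assms by (simp add: is_clinear_iff_scaleC)

lemma is_clinear_diff:
  fixes A B :: "'a::complex_inner \<Rightarrow>\<^sub>L 'b::complex_inner"
  assumes "is_clinear (blinfun_apply A)" "is_clinear (blinfun_apply B)"
  shows "is_clinear (blinfun_apply (A - B))"
  using assms by (simp add: is_clinear_iff_scaleC blinfun.diff_left scaleC_diff_right)

lemma cinner_eqI:
  fixes u v :: "'a::complex_inner"
  assumes "\<And>x. cinner x u = cinner x v"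
  shows "u = v"
  by (metis assms inner_eq_Re_cinner vector_eq_ldot)

text \<open>Moving \<open>\<i>\<close> across the real inner product only changes a sign, so
  \<open>B\<close> commutes with \<open>\<i>\<close> as well; the real adjoint is therefore the
  complex one.\<close>

lemma real_adjoint_of_clinear:
  fixes A :: "'a::complex_inner \<Rightarrow>\<^sub>L 'b::complex_inner" and B :: "'b \<Rightarrow>\<^sub>L 'a"
  assumes A: "is_clinear (blinfun_apply A)" and B: "\<And>x y. A x \<bullet> y = x \<bullet> B y"
  shows "is_clinear (blinfun_apply B)" and "cinner (A x) y = cinner x (B y)"
proof -
  have i: "B (\<i> *\<^sub>C y) = \<i> *\<^sub>C B y" for y
  proof -
    have "x \<bullet> B (\<i> *\<^sub>C y) = x \<bullet> (\<i> *\<^sub>C B y)" for x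
    proof -
      have "x \<bullet> B (\<i> *\<^sub>C y) = - (A (\<i> *\<^sub>C x) \<bullet> y)"
        unfolding is_clinear_scaleC[OF A] inner_ii_left by (simp add: B)
      also have "\<dots> = x \<bullet> (\<i> *\<^sub>C B y)"
        by (simp add: B inner_ii_left)
      finally show ?thesis .
    qed
    then show ?thesis by (metis vector_eq_ldot)
  qed
  then show "is_clinear (blinfun_apply B)"
    by (simp add: is_clinear_iff_ii)
  show "cinner (A x) y = cinner x (B y)"
    unfolding cinner_eq_inner by (simp add: B i)
qed

text \<open>\<open>adj\<close> is a definite description; the real adjoint relation is enough to
  identify it.\<close>

lemma adj_eqI:
  fixes A :: "'a::complex_inner \<Rightarrow>\<^sub>L 'b::complex_inner" and B :: "'b \<Rightarrow>\<^sub>L 'a"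
  assumes A: "is_clinear (blinfun_apply A)" and B: "\<And>x y. A x \<bullet> y = x \<bullet> B y"
  shows "adj A = B"
  unfolding adj_def
proof (rule the_equality)
  show "\<forall>x y. cinner (A x) y = cinner x (B y)"
    using real_adjoint_of_clinear(2)[OF assms] by blast
  show "C = B" if "\<forall>x y. cinner (A x) y = cinner x (C y)" for C :: "'b \<Rightarrow>\<^sub>L 'a"
    by (rule blinfun_eqI, rule cinner_eqI) (metis that real_adjoint_of_clinear(2)[OF assms])
qed

lemma adj_inner:
  fixes A :: "'a::complex_hilbert \<Rightarrow>\<^sub>L 'b::complex_inner"
  assumes A: "is_clinear (blinfun_apply A)"
  shows "A x \<bullet> y = x \<bullet> adj A y"
proof -
  obtain B :: "'b \<Rightarrow>\<^sub>L 'a" where "\<And>x y. A x \<bullet> y = x \<bullet> B y"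
    using real_adjoint_exists[of A] by blast
  with adj_eqI[OF A this] show ?thesis by simp
qed

lemma is_clinear_adj:
  fixes A :: "'a::complex_hilbert \<Rightarrow>\<^sub>L 'b::complex_inner"
  assumes "is_clinear (blinfun_apply A)"
  shows "is_clinear (blinfun_apply (adj A))"
  using real_adjoint_of_clinear(1)[OF assms adj_inner[OF assms]] .

lemma cinner_adj:
  fixes A :: "'a::complex_hilbert \<Rightarrow>\<^sub>L 'b::complex_inner"
  assumes "is_clinear (blinfun_apply A)"
  shows "cinner (A x) y = cinner x (adj A y)"
  using real_adjoint_of_clinear(2)[OF assms adj_inner[OF assms]] .

lemma adj_adj:
  fixes A :: "'a::complex_hilbert \<Rightarrow>\<^sub>L 'b::complex_inner"
  assumes "is_clinear (blinfun_apply A)"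
  shows "adj (adj A) = A"
  by (rule adj_eqI[OF is_clinear_adj[OF assms]]) (metis adj_inner[OF assms] inner_commute)

lemma norm_adj_le:
  fixes A :: "'a::complex_hilbert \<Rightarrow>\<^sub>L 'b::complex_inner"
  assumes "is_clinear (blinfun_apply A)"
  shows "norm (adj A) \<le> norm A"
proof (rule norm_blinfun_bound)
  fix y
  have "norm (adj A y) * norm (adj A y) = A (adj A y) \<bullet> y"
    by (simp add: adj_inner[OF assms] power2_norm_eq_inner[symmetric] power2_eq_square)
  also have "\<dots> \<le> norm (A (adj A y)) * norm y"
    by (rule norm_cauchy_schwarz)
  also have "\<dots> \<le> (norm A * norm (adj A y)) * norm y"
    by (intro mult_right_mono norm_blinfun) simp
  finally have "norm (adj A y) * norm (adj A y) \<le> norm (adj A y) * (norm A * norm y)"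
    by (simp add: mult_ac)
  then show "norm (adj A y) \<le> norm A * norm y"
    by (cases "norm (adj A y) = 0") (simp_all add: mult_le_cancel_left)
qed simp

lemma adj_contractions:
  fixes A :: "'a::complex_hilbert \<Rightarrow>\<^sub>L 'b::complex_inner"
  assumes "A \<in> contractions"
  shows "adj A \<in> contractions"
  using assms norm_adj_le[of A] is_clinear_adj[of A] by (auto simp: contractions_def)

lemma norm_Re_op_le:
  fixes A :: "'a::complex_hilbert \<Rightarrow>\<^sub>L 'a"
  assumes "is_clinear (blinfun_apply A)"
  shows "norm (Re_op A) \<le> norm A"
  using norm_triangle_ineq[of A "adj A"] norm_adj_le[OF assms] by (simp add: Re_op_def)

text \<open>The real quadratic form does not distinguish \<open>A\<close> from
  \<open>Re_op A\<close>. Through this estimate the norm of the real part, not that of the operator,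
  enters the radicands.\<close>

lemma inner_le_norm_Re_op:
  fixes A :: "'a::complex_hilbert \<Rightarrow>\<^sub>L 'a"
  assumes "is_clinear (blinfun_apply A)"
  shows "A x \<bullet> x \<le> norm (Re_op A) * (norm x)\<^sup>2"
proof -
  have "adj A x \<bullet> x = A x \<bullet> x"
    using adj_inner[OF assms, of x x] by (simp add: inner_commute)
  then have "A x \<bullet> x = Re_op A x \<bullet> x"
    by (simp add: Re_op_def blinfun.scaleR_left blinfun.add_left inner_add_left)
  also have "\<dots> \<le> norm (Re_op A x) * norm x"
    by (rule norm_cauchy_schwarz)
  also have "\<dots> \<le> norm (Re_op A) * norm x * norm x"
    by (intro mult_right_mono norm_blinfun) simp
  finally show ?thesis by (simp add: power2_eq_square mult_ac)
qed

section \<open>Square roots and defect operators\<close>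

text \<open>The imaginary part of \<open>cinner (S x) x\<close> is
  \<open>S x \<bullet> (\<i> *\<^sub>C x)\<close>, and its vanishing for all \<open>x\<close> is
  equivalent to symmetry.\<close>

lemma positive_op_iff:
  fixes S :: "'a::complex_inner \<Rightarrow>\<^sub>L 'a"
  shows "positive_op S \<longleftrightarrow>
    is_clinear (blinfun_apply S) \<and> (\<forall>x y. S x \<bullet> y = x \<bullet> S y) \<and> (\<forall>x. 0 \<le> S x \<bullet> x)"
proof (cases "is_clinear (blinfun_apply S)")
  case True
  note i = is_clinear_scaleC[OF True]
  have "(\<forall>x y. S x \<bullet> y = x \<bullet> S y) \<longleftrightarrow> (\<forall>x. S x \<bullet> (\<i> *\<^sub>C x) = 0)"
  proof safe
    fix x
    assume sym: "\<forall>x y. S x \<bullet> y = x \<bullet> S y"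
    then have "S x \<bullet> (\<i> *\<^sub>C x) = x \<bullet> (\<i> *\<^sub>C S x)" by (simp add: i)
    also have "\<dots> = - (S x \<bullet> (\<i> *\<^sub>C x))"
      by (metis inner_commute inner_ii_left minus_minus)
    finally show "S x \<bullet> (\<i> *\<^sub>C x) = 0" by simp
  next
    fix x y
    assume z: "\<forall>x. S x \<bullet> (\<i> *\<^sub>C x) = 0"
    \<comment> \<open>Polarization: the mixed terms vanish too, and
      \<open>w = \<i> *\<^sub>C y\<close> turns them into the symmetry relation.\<close>
    have "S (x + w) \<bullet> (\<i> *\<^sub>C (x + w)) = 0" for w using z by blast
    then have "S x \<bullet> (\<i> *\<^sub>C w) + S w \<bullet> (\<i> *\<^sub>C x) = 0" for w
      using z by (simp add: blinfun.add_right scaleC_add_right inner_simps add.commute)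
    from this[of "\<i> *\<^sub>C y"] show "S x \<bullet> y = x \<bullet> S y"
      by (simp add: i inner_commute)
  qed
  then show ?thesis
    using True
    by (auto simp: positive_op_def complex_nonneg_Reals_iff cinner_eq_inner)
qed (simp add: positive_op_def)

text \<open>Equality case of Cauchy-Schwarz for the form of \<open>S\<close>: along
  \<open>y + t *\<^sub>R S y\<close> the linear coefficient is the squared norm of
  \<open>S y\<close>, and positivity for all \<open>t\<close> kills it.\<close>

lemma positive_form_zero:
  fixes S :: "'a::real_inner \<Rightarrow>\<^sub>L 'a"
  assumes sym: "\<And>x y. S x \<bullet> y = x \<bullet> S y" and pos: "\<And>x. 0 \<le> S x \<bullet> x" and zero: "S y \<bullet> y = 0"
  shows "S y = 0"
proof -
  have "0 \<le> 2 * t * (S y \<bullet> S y) + t\<^sup>2 * (S (S y) \<bullet> S y)" for t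
  proof -
    have "S y \<bullet> S y = S (S y) \<bullet> y" by (simp add: sym)
    then show ?thesis
      using pos[of "y + t *\<^sub>R S y"] zero
      by (simp add: blinfun.add_right blinfun.scaleR_right inner_simps power2_eq_square algebra_simps)
  qed
  then have "S y \<bullet> S y = 0" by (rule linear_coeff_zero_of_nonneg_quadratic)
  then show ?thesis by simp
qed

text \<open>If \<open>W = (K + W\<^sup>2) / 2\<close> then \<open>(I - W)\<^sup>2 = I - K\<close>.  The iteration for \<open>W\<close> converges in
  norm even when \<open>norm K = 1\<close>, because its increments are dominated by those of the scalar
  iteration for \<open>K = 1\<close>, which is increasing and bounded.\<close>

lemma sqrt_iteration_fixpoint:
  fixes K :: "'a::banach \<Rightarrow>\<^sub>L 'a"
  assumes K: "norm K \<le> 1"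
  obtains W where "W = (1/2) *\<^sub>R (K + (W o\<^sub>L W))" "norm W \<le> 1"
    "\<And>S. closed S \<Longrightarrow> 0 \<in> S \<Longrightarrow> (\<And>V. V \<in> S \<Longrightarrow> (1/2) *\<^sub>R (K + (V o\<^sub>L V)) \<in> S) \<Longrightarrow> W \<in> S"
proof -
  define f where "f V = (1/2) *\<^sub>R (K + (V o\<^sub>L V))" for V
  define g where "g t = (1 + t\<^sup>2) / 2" for t :: real
  define W where "W n = (f ^^ n) 0" for n
  define w where "w n = (g ^^ n) 0" for n
  have W: "W 0 = 0" "\<And>n. W (Suc n) = f (W n)" and w: "w 0 = 0" "\<And>n. w (Suc n) = g (w n)"
    by (simp_all add: W_def w_def)
  have w01: "0 \<le> w n \<and> w n \<le> 1" for n
  proof (induction n)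
    case (Suc n)
    then have "(w n)\<^sup>2 \<le> 1" by (intro power_le_one) auto
    then show ?case by (simp add: w g_def)
  qed (simp add: w)
  have w_mono: "w n \<le> w (Suc n)" for n
  proof (induction n)
    case (Suc n)
    then have "(w n)\<^sup>2 \<le> (w (Suc n))\<^sup>2" using w01 by (intro power_mono) auto
    then show ?case by (simp add: w(2)[of n] w(2)[of "Suc n"] g_def)
  qed (simp add: w g_def)
  have Ww: "norm (W n) \<le> w n" for n
  proof (induction n)
    case (Suc n)
    have "norm (W n o\<^sub>L W n) \<le> norm (W n) * norm (W n)" by (rule norm_blinfun_compose)
    also have "\<dots> \<le> w n * w n" using Suc w01[of n] by (intro mult_mono) auto
    finally have "norm (K + (W n o\<^sub>L W n)) \<le> 1 + w n * w n"
      using K norm_triangle_ineq[of K "W n o\<^sub>L W n"] by linarith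
    then show ?case by (simp add: W w f_def g_def power2_eq_square)
  qed (simp add: W w)
  have step: "norm (W (Suc n) - W n) \<le> w (Suc n) - w n" for n
  proof (induction n)
    case (Suc n)
    let ?V = "W (Suc n)" and ?U = "W n" and ?v = "w (Suc n)" and ?u = "w n"
    have "W (Suc (Suc n)) - ?V = f ?V - f ?U"
      by (simp only: W)
    \<comment> \<open>A difference of squares written without commutation; its scalar counterpart
      gives the increment of the dominating sequence.\<close>
    also have "\<dots> = (1/2) *\<^sub>R ((?V o\<^sub>L (?V - ?U)) + ((?V - ?U) o\<^sub>L ?U))"
      by (simp add: f_def bounded_bilinear.diff_left[OF bounded_bilinear_blinfun_compose]
          bounded_bilinear.diff_right[OF bounded_bilinear_blinfun_compose] scaleR_diff_right
          scaleR_add_right)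
    finally have e: "W (Suc (Suc n)) - ?V = \<dots>" .
    have "norm ((?V o\<^sub>L (?V - ?U)) + ((?V - ?U) o\<^sub>L ?U))
        \<le> norm ?V * norm (?V - ?U) + norm (?V - ?U) * norm ?U"
      by (intro order_trans[OF norm_triangle_ineq] add_mono norm_blinfun_compose)
    also have "\<dots> \<le> ?v * (?v - ?u) + (?v - ?u) * ?u"
      using Suc Ww[of n] Ww[of "Suc n"] w01[of n] w01[of "Suc n"] w_mono[of n]
      by (intro add_mono mult_mono) auto
    also have "\<dots> = ?v\<^sup>2 - ?u\<^sup>2" by (simp add: power2_eq_square algebra_simps)
    finally show ?case
      unfolding e by (simp add: w(2)[of "Suc n"] w(2)[of n] g_def diff_divide_distrib add_divide_distrib)
  qed (use Ww[of 1] in \<open>simp add: W w\<close>)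
  have diff: "norm (W (n + k) - W n) \<le> w (n + k) - w n" for n k
  proof (induction k)
    case (Suc k)
    then show ?case
      using step[of "n + k"] norm_triangle_ineq[of "W (Suc (n + k)) - W (n + k)" "W (n + k) - W n"]
      by simp
  qed simp
  have "Cauchy w"
  proof -
    have "incseq w" using w_mono by (rule incseq_SucI)
    moreover have "bdd_above (range w)" using w01 by (intro bdd_aboveI[of _ 1]) auto
    ultimately show ?thesis
      using LIMSEQ_incseq_SUP LIMSEQ_imp_Cauchy by blast
  qed
  have "Cauchy W"
    unfolding Cauchy_altdef2
  proof (intro allI impI)
    fix e :: real assume "e > 0"
    then obtain N where N: "\<forall>n\<ge>N. dist (w n) (w N) < e"
      using \<open>Cauchy w\<close> unfolding Cauchy_altdef2 by blast
    have "dist (W n) (W N) < e" if "n \<ge> N" for n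
    proof -
      from that obtain k where n: "n = N + k" using le_Suc_ex by blast
      have "dist (W n) (W N) \<le> w n - w N" using diff[of N k] by (simp add: dist_norm n)
      also have "\<dots> \<le> dist (w n) (w N)" by (simp add: dist_real_def)
      also have "\<dots> < e" using N that by blast
      finally show ?thesis .
    qed
    then show "\<exists>N. \<forall>n\<ge>N. dist (W n) (W N) < e" by blast
  qed
  then obtain L where L: "W \<longlonglongrightarrow> L"
    by (metis Cauchy_convergent_iff convergent_def)
  have "(\<lambda>n. f (W n)) \<longlonglongrightarrow> f L"
    unfolding f_def by (intro tendsto_intros L bounded_bilinear.tendsto[OF bounded_bilinear_blinfun_compose])
  moreover have "(\<lambda>n. f (W n)) \<longlonglongrightarrow> L"
    using LIMSEQ_Suc[OF L] by (simp add: W)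
  ultimately have "L = f L" using LIMSEQ_unique by blast
  moreover have "norm L \<le> 1"
  proof (rule LIMSEQ_le_const2[OF tendsto_norm[OF L]])
    show "\<exists>N. \<forall>n\<ge>N. norm (W n) \<le> 1" using Ww w01 order_trans by blast
  qed
  \<comment> \<open>Closed properties preserved by the iteration hold for the limit. Complex
    linearity, symmetry and commutation with a competing square root are obtained this way.\<close>
  moreover have "L \<in> S" if "closed S" "0 \<in> S" "\<And>V. V \<in> S \<Longrightarrow> f V \<in> S" for S
  proof -
    have "W n \<in> S" for n by (induction n) (simp_all add: W that)
    then show ?thesis using \<open>closed S\<close> L closed_sequentially by blast
  qed
  ultimately show ?thesis using that[of L] unfolding f_def by blast
qed

text \<open>Existence: with \<open>K = adj C o\<^sub>L C\<close> and the fixed point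
  \<open>W\<close>, the operator \<open>id_blinfun - W\<close> is a root, positive because
  \<open>W\<close> has norm at most 1. Uniqueness: another positive root \<open>T\<close> commutes
  with its square, hence with \<open>K\<close>, with \<open>W\<close> and with \<open>S\<close>, so
  \<open>S + T\<close> annihilates every \<open>y = S x - T x\<close>; by positivity
  \<open>S y = T y = 0\<close>, and symmetry gives \<open>y = 0\<close>.\<close>

lemma positive_sqrt_unique_existence:
  fixes C :: "'a::complex_hilbert \<Rightarrow>\<^sub>L 'b::complex_hilbert"
  assumes C: "C \<in> contractions"
  shows "\<exists>!S. positive_op S \<and> S o\<^sub>L S = id_blinfun - (adj C o\<^sub>L C)"
proof -
  define K where "K = adj C o\<^sub>L C"
  have Cc: "is_clinear (blinfun_apply C)" and C1: "norm C \<le> 1"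
    using C by (auto simp: contractions_def)
  have Kc: "K (\<i> *\<^sub>C x) = \<i> *\<^sub>C K x" for x
    by (simp add: K_def is_clinear_scaleC Cc is_clinear_adj)
  have Ksym: "K x \<bullet> y = x \<bullet> K y" for x y
    by (simp add: K_def adj_inner[OF Cc, symmetric]) (metis adj_inner[OF Cc] inner_commute)
  have "norm K \<le> norm (adj C) * norm C" unfolding K_def by (rule norm_blinfun_compose)
  also have "\<dots> \<le> 1"
    using C1 norm_adj_le[OF Cc] by (intro mult_le_one) auto
  finally have K1: "norm K \<le> 1" .
  obtain W where W: "W = (1/2) *\<^sub>R (K + (W o\<^sub>L W))" "norm W \<le> 1" and
    ind: "\<And>S. closed S \<Longrightarrow> 0 \<in> S \<Longrightarrow> (\<And>V. V \<in> S \<Longrightarrow> (1/2) *\<^sub>R (K + (V o\<^sub>L V)) \<in> S) \<Longrightarrow> W \<in> S"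
    using sqrt_iteration_fixpoint[OF K1] by metis
  have "W \<in> {V :: 'a \<Rightarrow>\<^sub>L 'a. \<forall>x. V (\<i> *\<^sub>C x) = \<i> *\<^sub>C V x}"
  proof (rule ind)
    have "continuous_on UNIV (\<lambda>V :: 'a \<Rightarrow>\<^sub>L 'a. \<i> *\<^sub>C V x)" for x
      by (intro linear_continuous_on bounded_linear_compose[OF bounded_linear_scaleC]
          blinfun.bounded_linear_left)
    then show "closed {V :: 'a \<Rightarrow>\<^sub>L 'a. \<forall>x. V (\<i> *\<^sub>C x) = \<i> *\<^sub>C V x}"
      by (intro closed_Collect_all closed_Collect_eq continuous_intros)
  qed (auto simp: Kc blinfun.add_left blinfun.scaleR_left scaleC_add_right
      linear_scale[OF bounded_linear.linear[OF bounded_linear_scaleC]])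
  then have Wc: "W (\<i> *\<^sub>C x) = \<i> *\<^sub>C W x" for x by blast
  have "W \<in> {V :: 'a \<Rightarrow>\<^sub>L 'a. \<forall>x y. V x \<bullet> y = x \<bullet> V y}"
  proof (rule ind)
    show "closed {V :: 'a \<Rightarrow>\<^sub>L 'a. \<forall>x y. V x \<bullet> y = x \<bullet> V y}"
      by (intro closed_Collect_all closed_Collect_eq continuous_intros)
  qed (auto simp: Ksym blinfun.add_left blinfun.scaleR_left inner_simps)
  then have Wsym: "W x \<bullet> y = x \<bullet> W y" for x y by blast
  define S where "S = id_blinfun - W"
  have SS: "S o\<^sub>L S = id_blinfun - K"
  proof (rule blinfun_eqI)
    fix x
    have "W x = (1/2) *\<^sub>R (K x + W (W x))"
      using arg_cong[OF W(1), of "\<lambda>V. blinfun_apply V x"] by (simp add: blinfun.add_left blinfun.scaleR_left)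
    from arg_cong[OF this, of "\<lambda>v. 2 *\<^sub>R v"] have "W x + W x = K x + W (W x)"
      by (simp add: scaleR_2)
    then show "(S o\<^sub>L S) x = (id_blinfun - K) x"
      by (simp add: S_def blinfun.diff_left blinfun.diff_right algebra_simps)
  qed
  have Spos: "positive_op S"
    unfolding positive_op_iff is_clinear_iff_ii
  proof (intro conjI allI)
    fix x y
    show "S (\<i> *\<^sub>C x) = \<i> *\<^sub>C S x" by (simp add: S_def blinfun.diff_left scaleC_diff_right Wc)
    show "S x \<bullet> y = x \<bullet> S y" by (simp add: S_def blinfun.diff_left inner_simps Wsym)
    have "W x \<bullet> x \<le> norm (W x) * norm x" by (rule norm_cauchy_schwarz)
    also have "\<dots> \<le> norm x * norm x"
    proof (rule mult_right_mono)
      show "norm (W x) \<le> norm x"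
        using norm_blinfun[of W x] W(2) mult_right_mono[of "norm W" 1 "norm x"] by simp
    qed simp
    finally show "0 \<le> S x \<bullet> x"
      by (simp add: S_def blinfun.diff_left inner_simps power2_norm_eq_inner[symmetric] power2_eq_square)
  qed
  show ?thesis
    unfolding K_def[symmetric]
  proof (rule ex1I[of _ S])
    show "positive_op S \<and> S o\<^sub>L S = id_blinfun - K" using Spos SS by blast
    fix T
    assume T: "positive_op T \<and> T o\<^sub>L T = id_blinfun - K"
    have TT: "T (T x) = x - K x" for x
      using arg_cong[of _ _ "\<lambda>V. blinfun_apply V x", OF conjunct2[OF T]] by (simp add: blinfun.diff_left)
    have SSx: "S (S x) = x - K x" for x
      using arg_cong[of _ _ "\<lambda>V. blinfun_apply V x", OF SS] by (simp add: blinfun.diff_left)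
    have KT: "K (T x) = T (K x)" for x
      using TT[of "T x"] arg_cong[OF TT[of x], of T] by (simp add: blinfun.diff_right)
    have "W \<in> {V :: 'a \<Rightarrow>\<^sub>L 'a. \<forall>x. V (T x) = T (V x)}"
    proof (rule ind)
      show "closed {V :: 'a \<Rightarrow>\<^sub>L 'a. \<forall>x. V (T x) = T (V x)}"
        by (intro closed_Collect_all closed_Collect_eq continuous_intros)
    qed (auto simp: KT blinfun.add_left blinfun.scaleR_left blinfun.add_right blinfun.scaleR_right)
    then have ST: "S (T x) = T (S x)" for x
      by (simp add: S_def blinfun.diff_left blinfun.diff_right)
    note S' = Spos[unfolded positive_op_iff] and T' = conjunct1[OF T, unfolded positive_op_iff]
    show "T = S"
    proof (rule blinfun_eqI)
      fix x
      define y where "y = S x - T x"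
      have "S y + T y = 0"
        by (simp add: y_def blinfun.diff_right ST TT SSx)
      then have "S y \<bullet> y + T y \<bullet> y = 0" by (metis inner_add_left inner_zero_left)
      then have "S y \<bullet> y = 0" "T y \<bullet> y = 0"
        using S' T' by (metis add_nonneg_eq_0_iff)+
      then have "S y = 0" "T y = 0"
        using S' T' positive_form_zero by blast+
      then have "y \<bullet> y = 0"
        using S' T' by (metis y_def inner_diff_right inner_zero_left diff_self)
      then show "T x = S x" by (simp add: y_def)
    qed
  qed
qed

lemma defect_sqrt:
  fixes C :: "'a::complex_hilbert \<Rightarrow>\<^sub>L 'b::complex_hilbert"
  assumes "C \<in> contractions"
  shows "positive_op (defect C)" "defect C (defect C x) = x - adj C (C x)"
proof -
  have *: "positive_op (defect C) \<and> defect C o\<^sub>L defect C = id_blinfun - (adj C o\<^sub>L C)"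
    unfolding defect_def sqrt_op_def by (rule theI'[OF positive_sqrt_unique_existence[OF assms]])
  then show "positive_op (defect C)" by blast
  show "defect C (defect C x) = x - adj C (C x)"
    using arg_cong[OF conjunct2[OF *], of "\<lambda>V. blinfun_apply V x"] by (simp add: blinfun.diff_left)
qed

lemma defect_symmetric:
  fixes C :: "'a::complex_hilbert \<Rightarrow>\<^sub>L 'b::complex_hilbert"
  assumes "C \<in> contractions"
  shows "defect C x \<bullet> y = x \<bullet> defect C y"
  using defect_sqrt(1)[OF assms] unfolding positive_op_iff by blast

lemma is_clinear_defect:
  fixes C :: "'a::complex_hilbert \<Rightarrow>\<^sub>L 'b::complex_hilbert"
  assumes "C \<in> contractions"
  shows "is_clinear (blinfun_apply (defect C))"
  using defect_sqrt(1)[OF assms] unfolding positive_op_iff by blast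

lemma inner_defect:
  fixes C :: "'a::complex_hilbert \<Rightarrow>\<^sub>L 'b::complex_hilbert"
  assumes "C \<in> contractions"
  shows "defect C x \<bullet> defect C y = x \<bullet> y - C x \<bullet> C y"
proof -
  have "is_clinear (blinfun_apply C)" using assms by (simp add: contractions_def)
  then show ?thesis
    using adj_inner[of C x "C y"]
    by (simp add: defect_symmetric[OF assms] defect_sqrt(2)[OF assms] inner_diff_right)
qed

lemma norm_defect_sq:
  fixes C :: "'a::complex_hilbert \<Rightarrow>\<^sub>L 'b::complex_hilbert"
  assumes "C \<in> contractions"
  shows "(norm (defect C x))\<^sup>2 = (norm x)\<^sup>2 - (norm (C x))\<^sup>2"
  unfolding power2_norm_eq_inner by (rule inner_defect[OF assms])

lemma norm_defect_le:
  fixes C :: "'a::complex_hilbert \<Rightarrow>\<^sub>L 'b::complex_hilbert"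
  assumes "C \<in> contractions"
  shows "norm (defect C x) \<le> norm x"
  using norm_defect_sq[OF assms, of x] by (auto intro!: power2_le_imp_le[OF _ norm_ge_zero])

text \<open>Norm form of the intertwining of \<open>C\<close> with the two defect operators; after
  squaring it is the nonnegativity of the squared norm of \<open>x - adj C (C x)\<close>.\<close>

lemma norm_codefect_apply_le:
  fixes C :: "'a::complex_hilbert \<Rightarrow>\<^sub>L 'b::complex_hilbert"
  assumes C: "C \<in> contractions"
  shows "norm (defect (adj C) (C x)) \<le> norm (defect C x)"
proof (rule power2_le_imp_le)
  have Cc: "is_clinear (blinfun_apply C)" using C by (simp add: contractions_def)
  have "0 \<le> (norm (x - adj C (C x)))\<^sup>2" by simp
  also have "\<dots> = (norm x)\<^sup>2 - 2 * (norm (C x))\<^sup>2 + (norm (adj C (C x)))\<^sup>2"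
    using adj_inner[OF Cc, of x "C x"]
    unfolding power2_norm_eq_inner by (simp add: inner_diff_left inner_diff_right inner_commute)
  finally show "(norm (defect (adj C) (C x)))\<^sup>2 \<le> (norm (defect C x))\<^sup>2"
    unfolding norm_defect_sq[OF C] norm_defect_sq[OF adj_contractions[OF C]] by linarith
qed simp

lemma norm_defect_adj_apply_le:
  fixes C :: "'a::complex_hilbert \<Rightarrow>\<^sub>L 'b::complex_hilbert"
  assumes C: "C \<in> contractions"
  shows "norm (defect C (adj C y)) \<le> norm (defect (adj C) y)"
  using norm_codefect_apply_le[OF adj_contractions[OF C]] C
  by (simp add: adj_adj contractions_def)

section \<open>Factorization through defect operators\<close>

text \<open>The range of a complex linear operator is invariant under \<open>\<i>\<close>, so real
  and complex orthogonality to it coincide. This ties \<open>ops_between\<close> to the real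
  factorization lemmas.\<close>

lemma cinner_orthogonal_closure_range_iff:
  fixes D :: "'c::complex_inner \<Rightarrow>\<^sub>L 'a::complex_inner"
  assumes D: "is_clinear (blinfun_apply D)"
  shows "(\<forall>m\<in>closure (range D). cinner x m = 0) \<longleftrightarrow> (\<forall>v. x \<bullet> D v = 0)"
proof safe
  fix v assume "\<forall>m\<in>closure (range D). cinner x m = 0"
  moreover have "D v \<in> closure (range D)"
    using closure_subset by (rule subsetD) simp
  ultimately show "x \<bullet> D v = 0"
    by (simp add: inner_eq_Re_cinner)
next
  fix m assume z: "\<forall>v. x \<bullet> D v = 0" and m: "m \<in> closure (range D)"
  have i: "x \<bullet> (\<i> *\<^sub>C v) = 0" if "v \<in> range D" for v
    using that z by (auto simp: is_clinear_scaleC[OF D, symmetric])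
  have 1: "x \<bullet> m = 0"
    by (rule orthogonal_closure[OF _ m]) (use z in auto)
  have "(- (\<i> *\<^sub>C x)) \<bullet> m = 0"
    by (rule orthogonal_closure[OF _ m]) (simp add: inner_ii_left i)
  then show "cinner x m = 0"
    using 1 by (simp add: cinner_eq_inner inner_ii_left complex_eq_iff)
qed

lemma ops_between_closure_range:
  fixes D1 :: "'c::complex_inner \<Rightarrow>\<^sub>L 'a::complex_inner" and D2 :: "'d::complex_inner \<Rightarrow>\<^sub>L 'b::complex_inner"
  assumes "is_clinear (blinfun_apply D1)"
  shows "X \<in> ops_between (closure (range D1)) (closure (range D2)) \<longleftrightarrow>
    is_clinear (blinfun_apply X) \<and> range X \<subseteq> closure (range D2) \<and>
    (\<forall>u. (\<forall>v. u \<bullet> D1 v = 0) \<longrightarrow> X u = 0)"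
  by (simp add: ops_between_def cinner_orthogonal_closure_range_iff[OF assms])

text \<open>\<open>X\<close> after \<open>\<i>\<close> and \<open>\<i>\<close> after
  \<open>X\<close> agree on the range of \<open>D\<close>, and both vanish on its orthogonal
  complement, which is invariant under \<open>\<i>\<close>.\<close>

lemma is_clinear_factor:
  fixes D :: "'c::complex_inner \<Rightarrow>\<^sub>L 'a::complex_hilbert" and X :: "'a \<Rightarrow>\<^sub>L 'b::complex_inner"
  assumes D: "is_clinear (blinfun_apply D)" and T: "is_clinear (blinfun_apply (X o\<^sub>L D))"
    and X: "\<And>u. (\<forall>v. u \<bullet> D v = 0) \<Longrightarrow> X u = 0"
  shows "is_clinear (blinfun_apply X)"
proof -
  have "X o\<^sub>L (\<i> *\<^sub>C id_blinfun) = \<i> *\<^sub>C X"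
  proof (rule blinfun_eq_on_range_and_complement[of _ D])
    show "(X o\<^sub>L (\<i> *\<^sub>C id_blinfun)) (D x) = (\<i> *\<^sub>C X) (D x)" for x
      using is_clinear_scaleC[OF T, of \<i> x]
      by (simp add: scaleC_blinfun.rep_eq is_clinear_scaleC[OF D])
    fix u assume u: "\<And>v. u \<bullet> D v = 0"
    then have "\<forall>v. (\<i> *\<^sub>C u) \<bullet> D v = 0"
      by (simp add: inner_ii_left is_clinear_scaleC[OF D, symmetric])
    then show "(X o\<^sub>L (\<i> *\<^sub>C id_blinfun)) u = (\<i> *\<^sub>C X) u"
      using u X by (simp add: scaleC_blinfun.rep_eq)
  qed
  then have "X (\<i> *\<^sub>C x) = \<i> *\<^sub>C X x" for x
    using arg_cong[of _ _ "\<lambda>V. blinfun_apply V x"]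
    by (metis blinfun_apply_blinfun_compose blinfun_apply_id_blinfun id_apply scaleC_blinfun.rep_eq)
  then show ?thesis by (simp add: is_clinear_iff_ii)
qed

lemma inner_le_on_closure_range:
  fixes D :: "'a::real_normed_vector \<Rightarrow>\<^sub>L 'b::real_inner"
  assumes "\<And>y. u \<bullet> D y \<le> c * norm (D y)" and w: "w \<in> closure (range D)"
  shows "u \<bullet> w \<le> c * norm w"
proof -
  have "closed {w. u \<bullet> w \<le> c * norm w}"
    by (intro closed_Collect_le continuous_intros)
  then have "closure (range D) \<subseteq> {w. u \<bullet> w \<le> c * norm w}"
    using assms(1) by (intro closure_minimal) auto
  then show ?thesis using w by blast
qed

text \<open>Douglas' lemma is used twice: \<open>adj T\<close> through \<open>D2\<close> gives
  \<open>T = D2 W\<close> with \<open>W = adj V\<close>, then \<open>W\<close> through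
  \<open>D1\<close> gives \<open>X\<close>. A one-sided real inequality is enough as a hypothesis,
  since \<open>x\<close> may be replaced by its unimodular multiples.\<close>

lemma two_sided_factorization:
  fixes T :: "'a::complex_hilbert \<Rightarrow>\<^sub>L 'b::complex_hilbert"
    and D1 :: "'a \<Rightarrow>\<^sub>L 'c::complex_hilbert" and D2 :: "'b \<Rightarrow>\<^sub>L 'b"
  assumes T: "is_clinear (blinfun_apply T)" and D1: "is_clinear (blinfun_apply D1)"
    and D2: "is_clinear (blinfun_apply D2)" and sym: "\<And>x y. D2 x \<bullet> y = x \<bullet> D2 y"
    and le: "\<And>x y. T x \<bullet> y \<le> c * norm (D1 x) * norm (D2 y)" and c: "0 \<le> c"
  obtains X where "X \<in> ops_between (closure (range D1)) (closure (range D2))"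
    "T = D2 o\<^sub>L X o\<^sub>L D1" "norm X \<le> c"
proof -
  note aT = adj_inner[OF T]
  \<comment> \<open>Crude constant; it only secures the existence of \<open>V\<close> and does not
    enter the bound for \<open>X\<close>.\<close>
  have le1: "norm (adj T y) \<le> (c * norm D1) * norm (D2 y)" for y
  proof -
    have "norm (adj T y) * norm (adj T y) = T (adj T y) \<bullet> y"
      by (simp add: aT power2_norm_eq_inner[symmetric] power2_eq_square)
    also have "\<dots> \<le> c * norm (D1 (adj T y)) * norm (D2 y)" by (rule le)
    also have "\<dots> \<le> c * (norm D1 * norm (adj T y)) * norm (D2 y)"
      using c by (intro mult_right_mono mult_left_mono norm_blinfun) auto
    finally have "norm (adj T y) * norm (adj T y) \<le> norm (adj T y) * ((c * norm D1) * norm (D2 y))"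
      by (simp add: mult_ac)
    then show ?thesis
      using c by (cases "norm (adj T y) = 0") (auto simp: mult_le_cancel_left)
  qed
  have "0 \<le> c * norm D1" using c by simp
  from douglas_factorization[of "adj T" "c * norm D1" D2, OF le1 this]
  obtain V where V: "V o\<^sub>L D2 = adj T" and V0: "\<forall>u. (\<forall>v. u \<bullet> D2 v = 0) \<longrightarrow> V u = 0"
    by metis
  have Vc: "is_clinear (blinfun_apply V)"
    by (rule is_clinear_factor[OF D2]) (use V V0 is_clinear_adj[OF T] in simp_all)
  define W where "W = adj V"
  have W: "V x \<bullet> y = x \<bullet> W y" for x y
    unfolding W_def by (rule adj_inner[OF Vc])
  have Wc: "is_clinear (blinfun_apply W)"
    unfolding W_def by (rule is_clinear_adj[OF Vc])
  have D2W: "D2 (W x) = T x" for x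
  proof -
    have "y \<bullet> D2 (W x) = y \<bullet> T x" for y
    proof -
      have "y \<bullet> D2 (W x) = V (D2 y) \<bullet> x" by (simp add: sym[symmetric] W)
      also have "\<dots> = adj T y \<bullet> x"
        using arg_cong[OF V, of "\<lambda>V. blinfun_apply V y"] by simp
      also have "\<dots> = y \<bullet> T x" by (simp add: aT[symmetric] inner_commute)
      finally show ?thesis .
    qed
    then show ?thesis by (metis vector_eq_ldot)
  qed
  have Wcl: "W x \<in> closure (range D2)" for x
  proof (rule in_closure_rangeI)
    fix u assume "\<And>v. u \<bullet> D2 v = 0"
    then have "V u = 0" using V0 by blast
    then show "u \<bullet> W x = 0" by (simp add: W[symmetric])
  qed
  \<comment> \<open>The sharp constant returns: \<open>W x\<close> lies in the closure of the range
    of \<open>D2\<close>, so its norm is found by testing against \<open>D2 y\<close>, where it acts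
    as \<open>T x\<close> does on \<open>y\<close>.\<close>
  have le2: "norm (W x) \<le> c * norm (D1 x)" for x
  proof -
    have "W x \<bullet> W x \<le> (c * norm (D1 x)) * norm (W x)"
    proof (rule inner_le_on_closure_range[OF _ Wcl])
      show "W x \<bullet> D2 y \<le> (c * norm (D1 x)) * norm (D2 y)" for y
        using le[of x y] by (simp add: sym[symmetric] D2W)
    qed
    then have "norm (W x) * norm (W x) \<le> (c * norm (D1 x)) * norm (W x)"
      by (simp add: power2_norm_eq_inner[symmetric] power2_eq_square)
    then show ?thesis
      using c by (cases "norm (W x) = 0") (auto simp: mult_le_cancel_right)
  qed
  from douglas_factorization[of W c D1, OF le2 c]
  obtain X where X: "X o\<^sub>L D1 = W" and X0: "\<forall>u. (\<forall>v. u \<bullet> D1 v = 0) \<longrightarrow> X u = 0"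
    and Xn: "norm X \<le> c" and Xr: "range X \<subseteq> closure (range W)"
    by metis
  have Xc: "is_clinear (blinfun_apply X)"
    by (rule is_clinear_factor[OF D1]) (use X X0 Wc in simp_all)
  have "closure (range W) \<subseteq> closure (range D2)"
    using Wcl by (intro closure_minimal) auto
  then have "X \<in> ops_between (closure (range D1)) (closure (range D2))"
    using Xr Xc X0 by (auto simp: ops_between_closure_range[OF D1])
  moreover have "T = D2 o\<^sub>L X o\<^sub>L D1"
    using D2W by (intro blinfun_eqI) (simp add: X[symmetric])
  ultimately show ?thesis using that Xn by blast
qed

text \<open>By symmetry the kernel of \<open>D2\<close> is orthogonal to its range, so
  \<open>D2\<close> is injective on the closure of its range and can be cancelled; \<open>D1\<close>
  is cancelled by density.\<close>

lemma two_sided_factor_unique: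
  fixes D1 :: "'a::complex_hilbert \<Rightarrow>\<^sub>L 'c::complex_hilbert" and D2 :: "'b::complex_hilbert \<Rightarrow>\<^sub>L 'b"
  assumes D1: "is_clinear (blinfun_apply D1)" and sym: "\<And>x y. D2 x \<bullet> y = x \<bullet> D2 y"
    and X: "X \<in> ops_between (closure (range D1)) (closure (range D2))"
    and Y: "Y \<in> ops_between (closure (range D1)) (closure (range D2))"
    and eq: "D2 o\<^sub>L X o\<^sub>L D1 = D2 o\<^sub>L Y o\<^sub>L D1"
  shows "X = Y"
proof (rule blinfun_eq_on_range_and_complement[of _ D1])
  fix x
  define w where "w = X (D1 x) - Y (D1 x)"
  have "X (D1 x) \<in> closure (range D2)" "Y (D1 x) \<in> closure (range D2)"
    using X Y by (auto simp: ops_between_closure_range[OF D1])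
  then have wcl: "w \<in> closure (range D2)"
    unfolding w_def by (rule subspace_diff[OF subspace_closure_range_blinfun])
  have "D2 w = 0"
    using arg_cong[OF eq, of "\<lambda>V. blinfun_apply V x"] by (simp add: w_def blinfun.diff_right)
  then have "w \<bullet> D2 v = 0" for v
    by (simp add: sym[symmetric])
  then have "w \<bullet> w = 0"
    by (intro orthogonal_closure[OF _ wcl]) auto
  then show "X (D1 x) = Y (D1 x)" by (simp add: w_def)
next
  fix u assume "\<And>v. u \<bullet> D1 v = 0"
  then show "X u = Y u"
    using X Y by (simp add: ops_between_closure_range[OF D1])
qed

section \<open>The relation for a pair of contractions\<close>

lemma is_clinear_id_minus_adj_compose:
  fixes A B :: "'a::complex_hilbert \<Rightarrow>\<^sub>L 'b::complex_hilbert"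
  assumes "A \<in> contractions" "B \<in> contractions"
  shows "is_clinear (blinfun_apply (id_blinfun - (adj A o\<^sub>L B)))"
  using assms
  by (auto simp: contractions_def intro!: is_clinear_diff is_clinear_id_blinfun is_clinear_compose
      is_clinear_adj)

lemma inner_id_minus_adj_compose:
  fixes A B :: "'a::complex_hilbert \<Rightarrow>\<^sub>L 'b::complex_hilbert"
  assumes "A \<in> contractions"
  shows "(id_blinfun - (adj A o\<^sub>L B)) x \<bullet> y = x \<bullet> y - B x \<bullet> A y"
proof -
  have "is_clinear (blinfun_apply A)" using assms by (simp add: contractions_def)
  from adj_inner[OF this, of y "B x"] have "adj A (B x) \<bullet> y = B x \<bullet> A y"
    by (simp add: inner_commute)
  then show ?thesis
    by (simp add: blinfun.diff_left inner_diff_left)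
qed

text \<open>Substituting \<open>A = B + E X D\<close>, where \<open>E\<close> is the codefect, the
  form of \<open>id - adj A B\<close> at \<open>x, y\<close> becomes
  \<open>D x \<bullet> D y - E (B x) \<bullet> X (D y)\<close>; the first term contributes the 1,
  the second \<open>norm X\<close>, because \<open>norm (E (B x)) \<le> norm (D x)\<close>.\<close>

lemma factor_id_of_factor_difference:
  fixes A B :: "'a::complex_hilbert \<Rightarrow>\<^sub>L 'b::complex_hilbert"
  assumes A: "A \<in> contractions" and B: "B \<in> contractions"
    and eq: "A - B = defect (adj B) o\<^sub>L X o\<^sub>L defect B"
  obtains Y where "Y \<in> ops_between (defect_space B) (defect_space B)"
    "id_blinfun - (adj A o\<^sub>L B) = defect B o\<^sub>L Y o\<^sub>L defect B" "norm Y \<le> 1 + norm X"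
proof (rule two_sided_factorization[OF is_clinear_id_minus_adj_compose[OF A B] is_clinear_defect[OF B]
      is_clinear_defect[OF B] defect_symmetric[OF B]])
  fix x y
  let ?D = "defect B" and ?E = "defect (adj B)"
  have "A y - B y = ?E (X (?D y))"
    using arg_cong[OF eq, of "\<lambda>V. blinfun_apply V y"] by (simp add: blinfun.diff_left)
  then have Ay: "A y = B y + ?E (X (?D y))" by (simp add: algebra_simps)
  have "(id_blinfun - (adj A o\<^sub>L B)) x \<bullet> y = ?D x \<bullet> ?D y - B x \<bullet> ?E (X (?D y))"
    unfolding inner_id_minus_adj_compose[OF A] by (simp add: inner_defect[OF B] Ay inner_add_right)
  also have "\<dots> = ?D x \<bullet> ?D y - ?E (B x) \<bullet> X (?D y)"
    by (simp add: defect_symmetric[OF adj_contractions[OF B]])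
  also have "\<dots> \<le> norm (?D x) * norm (?D y) + norm (?E (B x)) * norm (X (?D y))"
    using norm_cauchy_schwarz[of "?D x" "?D y"] norm_cauchy_schwarz[of "- ?E (B x)" "X (?D y)"]
    by simp
  also have "\<dots> \<le> norm (?D x) * norm (?D y) + norm (?D x) * (norm X * norm (?D y))"
    by (intro add_left_mono mult_mono norm_blinfun norm_codefect_apply_le[OF B]) auto
  also have "\<dots> = (1 + norm X) * norm (?D x) * norm (?D y)"
    by (simp add: algebra_simps)
  finally show "(id_blinfun - (adj A o\<^sub>L B)) x \<bullet> y \<le> (1 + norm X) * norm (?D x) * norm (?D y)" .
qed (auto simp: defect_space_def that)

text \<open>Condition (ii) for a single pair of operators, instantiated both with the values of the
  functions and with the multiplication operators.\<close>

locale factored_id =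
  fixes A B :: "'a::complex_hilbert \<Rightarrow>\<^sub>L 'b::complex_hilbert" and Y :: "'a \<Rightarrow>\<^sub>L 'a"
  assumes A: "A \<in> contractions" and B: "B \<in> contractions"
    and Y: "Y \<in> ops_between (defect_space B) (defect_space B)"
    and eq: "id_blinfun - (adj A o\<^sub>L B) = defect B o\<^sub>L Y o\<^sub>L defect B"
begin

lemma form: "Y (defect B x) \<bullet> defect B y = x \<bullet> y - B x \<bullet> A y"
proof -
  have "(id_blinfun - (adj A o\<^sub>L B)) x \<bullet> y = defect B (Y (defect B x)) \<bullet> y"
    by (simp add: eq)
  then show ?thesis
    by (simp add: inner_id_minus_adj_compose[OF A] defect_symmetric[OF B])
qed

text \<open>Expand the square and replace \<open>norm (A x)\<close> by \<open>norm x\<close>; what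
  remains is twice the form of \<open>id - adj A B\<close> minus the defect form.\<close>

lemma norm_difference_sq_le:
  "(norm ((A - B) x))\<^sup>2 \<le> 2 * (Y (defect B x) \<bullet> defect B x) - (norm (defect B x))\<^sup>2"
proof -
  have "(norm (A x))\<^sup>2 \<le> (norm x)\<^sup>2"
    using A norm_blinfun[of A x] mult_right_mono[of "norm A" 1 "norm x"]
    by (intro power_mono) (auto simp: contractions_def)
  then show ?thesis
    unfolding form norm_defect_sq[OF B]
    by (simp add: power2_norm_eq_inner blinfun.diff_left inner_diff_left inner_diff_right inner_commute)
qed

lemma half_le_Re: "(norm (defect B x))\<^sup>2 \<le> 2 * (Y (defect B x) \<bullet> defect B x)"
  using norm_difference_sq_le[of x] zero_le_power2[of "norm ((A - B) x)"] by linarith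

text \<open>As the real part of \<open>Y\<close> is at least \<open>1/2\<close>, the operator \<open>I - Y\<close> is dominated by \<open>Y\<close>.\<close>

lemma norm_minus_factor_le: "norm (defect B x - Y (defect B x)) \<le> norm Y * norm (defect B x)"
proof -
  have "(norm (defect B x - Y (defect B x)))\<^sup>2 \<le> (norm (Y (defect B x)))\<^sup>2"
    using half_le_Re[of x]
    by (simp add: power2_norm_eq_inner inner_diff_left inner_diff_right inner_commute)
  then have "norm (defect B x - Y (defect B x)) \<le> norm (Y (defect B x))"
    by (rule power2_le_imp_le) simp
  then show ?thesis using norm_blinfun[of Y "defect B x"] by linarith
qed

text \<open>Against vectors in the range of \<open>B\<close> the difference is the form of
  \<open>id - Y\<close> on defect vectors, so the constant is \<open>norm Y\<close> and not
  \<open>1 + norm Y\<close>.\<close>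

lemma difference_inner_le: "(A - B) x \<bullet> B v \<le> norm Y * norm (defect B x) * norm (defect B v)"
proof -
  have "(A - B) x \<bullet> B v = B v \<bullet> A x - B v \<bullet> B x"
    by (simp add: blinfun.diff_left inner_commute[of _ "B v"] inner_diff_right)
  also have "\<dots> = (defect B v - Y (defect B v)) \<bullet> defect B x"
    by (simp add: inner_diff_left form inner_defect[OF B])
  also have "\<dots> \<le> norm (defect B v - Y (defect B v)) * norm (defect B x)"
    by (rule norm_cauchy_schwarz)
  also have "\<dots> \<le> norm Y * norm (defect B v) * norm (defect B x)"
    by (intro mult_right_mono norm_minus_factor_le) simp
  finally show ?thesis by (simp add: mult_ac)
qed

lemma factor_inner_le: "Y d \<bullet> d \<le> norm Y * (norm d)\<^sup>2"
proof -
  have "Y d \<bullet> d \<le> norm (Y d) * norm d" by (rule norm_cauchy_schwarz)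
  also have "\<dots> \<le> norm Y * norm d * norm d" by (intro mult_right_mono norm_blinfun) simp
  finally show ?thesis by (simp add: power2_eq_square mult.assoc)
qed

lemma norm_difference_le:
  assumes \<tau>: "\<And>x. Y (defect B x) \<bullet> defect B x \<le> \<tau> * (norm (defect B x))\<^sup>2"
  shows "(norm ((A - B) x))\<^sup>2 \<le> (2 * \<tau> - 1) * (norm (defect B x))\<^sup>2"
  using norm_difference_sq_le[of x] \<tau>[of x] by (simp add: algebra_simps)

text \<open>Split \<open>y = B (adj B y) + E (E y)\<close> with the codefect \<open>E\<close>. The
  first part lies in the range of \<open>B\<close> and contributes \<open>norm Y\<close>, since
  \<open>norm (D (adj B y)) \<le> norm (E y)\<close>; the second contributes the square root, the
  bound for \<open>A - B\<close> relative to \<open>D\<close>.\<close>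

lemma factor_difference:
  assumes \<tau>: "\<And>x. Y (defect B x) \<bullet> defect B x \<le> \<tau> * (norm (defect B x))\<^sup>2" and "1 \<le> 2 * \<tau>"
  obtains X where "X \<in> ops_between (defect_space B) (defect_space (adj B))"
    "A - B = defect (adj B) o\<^sub>L X o\<^sub>L defect B" "norm X \<le> norm Y + sqrt (2 * \<tau> - 1)"
proof (rule two_sided_factorization[of "A - B" "defect B" "defect (adj B)" "norm Y + sqrt (2 * \<tau> - 1)"])
  let ?D = "defect B" and ?E = "defect (adj B)"
  note B' = adj_contractions[OF B]
  have Bc: "is_clinear (blinfun_apply B)" using B by (simp add: contractions_def)
  show "is_clinear (blinfun_apply (A - B))"
    using A B by (simp add: contractions_def is_clinear_diff)
  show "?E x \<bullet> y = x \<bullet> ?E y" for x y by (rule defect_symmetric[OF B'])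
  fix x y
  have "norm ((A - B) x) \<le> sqrt ((2 * \<tau> - 1) * (norm (?D x))\<^sup>2)"
    using norm_difference_le[OF \<tau>] by (simp add: real_le_rsqrt)
  then have n: "norm ((A - B) x) \<le> sqrt (2 * \<tau> - 1) * norm (?D x)"
    by (simp add: real_sqrt_mult)
  have "y = B (adj B y) + ?E (?E y)"
    by (simp add: defect_sqrt(2)[OF B'] adj_adj[OF Bc])
  then have "(A - B) x \<bullet> y = (A - B) x \<bullet> B (adj B y) + (A - B) x \<bullet> ?E (?E y)"
    by (metis inner_add_right)
  also have "\<dots> \<le> norm Y * norm (?D x) * norm (?D (adj B y)) + norm ((A - B) x) * norm (?E (?E y))"
    by (intro add_mono difference_inner_le norm_cauchy_schwarz)
  also have "\<dots> \<le> norm Y * norm (?D x) * norm (?E y) + (sqrt (2 * \<tau> - 1) * norm (?D x)) * norm (?E y)"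
    using assms(2) by (intro add_mono mult_mono n norm_defect_le[OF B'] norm_defect_adj_apply_le[OF B]) auto
  also have "\<dots> = (norm Y + sqrt (2 * \<tau> - 1)) * norm (?D x) * norm (?E y)"
    by (simp add: algebra_simps)
  finally show "(A - B) x \<bullet> y \<le> (norm Y + sqrt (2 * \<tau> - 1)) * norm (?D x) * norm (?E y)" .
qed (use assms in \<open>auto simp: defect_space_def that is_clinear_defect[OF B] is_clinear_defect[OF adj_contractions[OF B]]\<close>)

text \<open>In the square of \<open>B x + \<epsilon> (A - B) x\<close> the mixed term and the last
  term are at most \<open>2 * \<rho> * r\<close> and \<open>(2 * \<tau> - 1) * r\<^sup>2\<close>
  times the squared norm of \<open>defect B x\<close>, and this squared norm is exactly what
  \<open>B x\<close> lacks to reach \<open>norm x\<close>.\<close>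

lemma perturbation_contraction:
  assumes \<rho>: "norm Y \<le> \<rho>" and r: "0 \<le> r"
    and \<tau>: "\<And>x. Y (defect B x) \<bullet> defect B x \<le> \<tau> * (norm (defect B x))\<^sup>2"
    and le: "2 * \<rho> * r + (2 * \<tau> - 1) * r\<^sup>2 \<le> 1" and \<epsilon>: "cmod \<epsilon> \<le> r"
  shows "norm ((1 - \<epsilon>) *\<^sub>C B + \<epsilon> *\<^sub>C A) \<le> 1"
proof (rule norm_blinfun_bound)
  fix x
  let ?d = "norm (defect B x)" and ?\<Delta> = "(A - B) x"
  have Bc: "is_clinear (blinfun_apply B)" using B by (simp add: contractions_def)
  have e: "((1 - \<epsilon>) *\<^sub>C B + \<epsilon> *\<^sub>C A) x = B x + \<epsilon> *\<^sub>C ?\<Delta>"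
    using scaleC_add_left[of "1 - \<epsilon>" \<epsilon> "B x"]
    by (simp add: blinfun.add_left blinfun.diff_left scaleC_blinfun.rep_eq scaleC_diff_right algebra_simps)
  have \<rho>0: "0 \<le> \<rho>" using \<rho> norm_ge_zero order_trans by blast
  \<comment> \<open>Moving \<epsilon> into the argument of \<open>B\<close> lets the real estimate
    serve complex \<epsilon>.\<close>
  have "\<epsilon> *\<^sub>C ?\<Delta> \<bullet> B x = ?\<Delta> \<bullet> B (cnj \<epsilon> *\<^sub>C x)"
    by (simp add: inner_scaleC_left is_clinear_scaleC[OF Bc])
  also have "\<dots> \<le> norm Y * ?d * norm (defect B (cnj \<epsilon> *\<^sub>C x))"
    by (rule difference_inner_le)
  also have "\<dots> = norm Y * cmod \<epsilon> * ?d\<^sup>2"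
    by (simp add: is_clinear_scaleC[OF is_clinear_defect[OF B]] norm_scaleC power2_eq_square)
  also have "\<dots> \<le> \<rho> * r * ?d\<^sup>2"
    using \<rho> \<rho>0 \<epsilon> by (intro mult_right_mono mult_mono) auto
  finally have 1: "\<epsilon> *\<^sub>C ?\<Delta> \<bullet> B x \<le> \<rho> * r * ?d\<^sup>2" .
  have "(norm (\<epsilon> *\<^sub>C ?\<Delta>))\<^sup>2 = (cmod \<epsilon>)\<^sup>2 * (norm ?\<Delta>)\<^sup>2"
    by (simp add: norm_scaleC power_mult_distrib)
  also have "\<dots> \<le> r\<^sup>2 * ((2 * \<tau> - 1) * ?d\<^sup>2)"
    using \<epsilon> by (intro mult_mono power_mono norm_difference_le \<tau>) auto
  finally have 2: "(norm (\<epsilon> *\<^sub>C ?\<Delta>))\<^sup>2 \<le> r\<^sup>2 * ((2 * \<tau> - 1) * ?d\<^sup>2)" .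
  have "(norm (B x + \<epsilon> *\<^sub>C ?\<Delta>))\<^sup>2 = (norm (B x))\<^sup>2 + 2 * (\<epsilon> *\<^sub>C ?\<Delta> \<bullet> B x) + (norm (\<epsilon> *\<^sub>C ?\<Delta>))\<^sup>2"
    by (simp add: power2_norm_eq_inner inner_add_left inner_add_right inner_commute)
  also have "\<dots> \<le> (norm (B x))\<^sup>2 + (2 * \<rho> * r + (2 * \<tau> - 1) * r\<^sup>2) * ?d\<^sup>2"
    using 1 2 by (simp add: algebra_simps)
  also have "\<dots> \<le> (norm (B x))\<^sup>2 + 1 * ?d\<^sup>2"
    using le by (intro add_left_mono mult_right_mono) auto
  also have "\<dots> = (norm x)\<^sup>2"
    by (simp add: norm_defect_sq[OF B])
  finally show "norm (((1 - \<epsilon>) *\<^sub>C B + \<epsilon> *\<^sub>C A) x) \<le> 1 * norm x"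
    unfolding e mult_1 by (rule power2_le_imp_le) simp
qed simp

end

text \<open>The infimum of \<open>t\<^sup>2 * p\<^sup>2 + q\<^sup>2 / t\<^sup>2\<close> over
  positive \<open>t\<close> is \<open>2 * p * q\<close>, approached as \<open>t\<^sup>2\<close>
  tends to \<open>q / p\<close>.\<close>

lemma le_two_mult_of_scaling:
  fixes m k p q :: real
  assumes le: "\<And>t. 0 < t \<Longrightarrow> m \<le> k * (t\<^sup>2 * p\<^sup>2 + q\<^sup>2 / t\<^sup>2)" and pq: "0 \<le> p" "0 \<le> q" and k: "0 \<le> k"
  shows "m \<le> 2 * k * p * q"
proof (rule field_le_epsilon)
  fix e :: real assume "e > 0"
  \<comment> \<open>Adding \<open>h\<close> to both \<open>p\<close> and \<open>q\<close> keeps the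
    choice of \<open>t\<close> meaningful when one of them vanishes; its size makes the total error
    at most \<open>e\<close>.\<close>
  define h where "h = e / (k * (p + q) + 1)"
  have kpq: "0 \<le> k * (p + q)" using k pq by simp
  then have h: "0 < h" using \<open>e > 0\<close> by (simp add: h_def)
  define t where "t = sqrt ((q + h) / (p + h))"
  have t: "0 < t" "t\<^sup>2 = (q + h) / (p + h)"
    using pq h by (simp_all add: t_def)
  have a: "t\<^sup>2 * p\<^sup>2 \<le> (q + h) * p"
  proof -
    have "t\<^sup>2 * p\<^sup>2 = (q + h) * p * (p / (p + h))"
      unfolding t(2) by (simp add: power2_eq_square)
    also have "\<dots> \<le> (q + h) * p * 1"
      using pq h by (intro mult_left_mono) auto
    finally show ?thesis by simp
  qed
  have b: "q\<^sup>2 / t\<^sup>2 \<le> (p + h) * q"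
  proof -
    have "q\<^sup>2 / t\<^sup>2 = (p + h) * q * (q / (q + h))"
      unfolding t(2) by (simp add: power2_eq_square)
    also have "\<dots> \<le> (p + h) * q * 1"
      using pq h by (intro mult_left_mono) auto
    finally show ?thesis by simp
  qed
  have "m \<le> k * (t\<^sup>2 * p\<^sup>2 + q\<^sup>2 / t\<^sup>2)" using le t by blast
  also have "\<dots> \<le> k * ((q + h) * p + (p + h) * q)"
    using a b k by (intro mult_left_mono add_mono)
  also have "\<dots> = 2 * k * p * q + (k * (p + q)) * h" by (simp add: algebra_simps)
  also have "(k * (p + q)) * h \<le> (k * (p + q) + 1) * h"
    using h by (intro mult_right_mono) auto
  also have "\<dots> = e" using kpq by (simp add: h_def)
  finally show "m \<le> 2 * k * p * q + e" by simp
qed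

text \<open>Perturbations of modulus \<open>r\<close> bound the quadratic form \<open>\<langle>(A - B) x, B x\<rangle>\<close> by
  \<open>(norm (D x))\<^sup>2 / (2 * r)\<close>; polarization then bounds the sesquilinear form.\<close>

lemma factor_id_of_perturbation:
  fixes A B :: "'a::complex_hilbert \<Rightarrow>\<^sub>L 'b::complex_hilbert"
  assumes A: "A \<in> contractions" and B: "B \<in> contractions" and r: "0 < r"
    and le: "\<And>\<epsilon>. cmod \<epsilon> = r \<Longrightarrow> norm ((1 - \<epsilon>) *\<^sub>C B + \<epsilon> *\<^sub>C A) \<le> 1"
  obtains Y where "Y \<in> ops_between (defect_space B) (defect_space B)"
    "id_blinfun - (adj A o\<^sub>L B) = defect B o\<^sub>L Y o\<^sub>L defect B" "norm Y \<le> 1 + 1 / r"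
proof -
  let ?D = "defect B"
  have Ac: "is_clinear (blinfun_apply A)" and Bc: "is_clinear (blinfun_apply B)"
    using A B by (simp_all add: contractions_def)
  define \<Delta> where "\<Delta> = A - B"
  have \<Delta>c: "is_clinear (blinfun_apply \<Delta>)"
    unfolding \<Delta>_def by (rule is_clinear_diff[OF Ac Bc])
  \<comment> \<open>The squared norm of \<open>\<epsilon> *\<^sub>C \<Delta> x\<close> is discarded;
    only the mixed term is kept.\<close>
  have quad: "2 * (B x \<bullet> \<epsilon> *\<^sub>C \<Delta> x) \<le> (norm (?D x))\<^sup>2" if "cmod \<epsilon> = r" for \<epsilon> x
  proof -
    have e: "((1 - \<epsilon>) *\<^sub>C B + \<epsilon> *\<^sub>C A) x = B x + \<epsilon> *\<^sub>C \<Delta> x"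
      using scaleC_add_left[of "1 - \<epsilon>" \<epsilon> "B x"]
      by (simp add: \<Delta>_def blinfun.add_left blinfun.diff_left scaleC_blinfun.rep_eq scaleC_diff_right
          algebra_simps)
    have "norm (B x + \<epsilon> *\<^sub>C \<Delta> x) \<le> norm ((1 - \<epsilon>) *\<^sub>C B + \<epsilon> *\<^sub>C A) * norm x"
      unfolding e[symmetric] by (rule norm_blinfun)
    also have "\<dots> \<le> 1 * norm x"
      using le[OF that] by (rule mult_right_mono) simp
    finally have "(norm (B x + \<epsilon> *\<^sub>C \<Delta> x))\<^sup>2 \<le> (norm x)\<^sup>2"
      by (intro power_mono) auto
    moreover have "(norm (B x + \<epsilon> *\<^sub>C \<Delta> x))\<^sup>2
        = (norm (B x))\<^sup>2 + 2 * (B x \<bullet> \<epsilon> *\<^sub>C \<Delta> x) + (norm (\<epsilon> *\<^sub>C \<Delta> x))\<^sup>2"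
      by (simp add: power2_norm_eq_inner inner_add_left inner_add_right inner_commute)
    ultimately show ?thesis
      unfolding norm_defect_sq[OF B] using zero_le_power2[of "norm (\<epsilon> *\<^sub>C \<Delta> x)"] by linarith
  qed
  define b where "b x y = B x \<bullet> \<Delta> y" for x y
  have b_lin: "b (x + x') y = b x y + b x' y" "b x (y + y') = b x y + b x y'"
    "b (x - x') y = b x y - b x' y" "b x (y - y') = b x y - b x y'"
    "b (s *\<^sub>R x) y = s * b x y" "b x (s *\<^sub>R y) = s * b x y" for x x' y y' s
    by (simp_all add: b_def blinfun.add_right blinfun.diff_right blinfun.scaleR_right inner_simps)
  have b_ii: "b (\<i> *\<^sub>C x) (\<i> *\<^sub>C y) = b x y" for x y
    by (simp add: b_def is_clinear_scaleC[OF Bc] is_clinear_scaleC[OF \<Delta>c])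
  \<comment> \<open>Four values of \<epsilon> suffice: plus and minus \<open>r\<close> control the
    symmetric part of \<open>b\<close>, plus and minus \<open>r * \<i>\<close> in \<open>q2\<close>
    its antisymmetric part.\<close>
  have q1: "\<bar>2 * r * b x x\<bar> \<le> (norm (?D x))\<^sup>2" for x
    using quad[of "complex_of_real r" x] quad[of "complex_of_real (- r)" x] r
    by (simp add: b_def scaleC_of_real scaleC_minus_left abs_le_iff del: of_real_minus)
  have q2: "\<bar>2 * r * b x (\<i> *\<^sub>C x)\<bar> \<le> (norm (?D x))\<^sup>2" for x
  proof -
    have "(complex_of_real s * \<i>) *\<^sub>C \<Delta> x = s *\<^sub>R \<Delta> (\<i> *\<^sub>C x)" for s
      by (simp add: is_clinear_scaleC[OF \<Delta>c] scaleC_of_real[symmetric] scaleC_scaleC)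
    then show ?thesis
      using quad[of "complex_of_real r * \<i>" x] quad[of "complex_of_real (- r) * \<i>" x] r
      by (simp add: b_def norm_mult abs_le_iff del: of_real_minus)
  qed
  have par: "(norm (?D (x + y)))\<^sup>2 + (norm (?D (x - y)))\<^sup>2 = 2 * (norm (?D x))\<^sup>2 + 2 * (norm (?D y))\<^sup>2" for x y
    by (simp add: power2_norm_eq_inner blinfun.add_right blinfun.diff_right inner_simps inner_commute)
  have b1: "b x y \<le> 1 / (2 * r) * ((norm (?D x))\<^sup>2 + (norm (?D y))\<^sup>2)" for x y
  proof -
    \<comment> \<open>Chosen so that \<open>\<i> *\<^sub>C z = y\<close>: polarizing
      \<open>b x (\<i> *\<^sub>C x)\<close> at \<open>x, z\<close> then yields
      \<open>b x y - b y x\<close>.\<close>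
    define z where "z = - (\<i> *\<^sub>C y)"
    have y: "y = \<i> *\<^sub>C z" by (simp add: z_def scaleC_minus_right)
    have nz: "norm (?D z) = norm (?D y)"
      by (simp add: y is_clinear_scaleC[OF is_clinear_defect[OF B]] norm_scaleC)
    have s: "2 * (b x y + b y x) = b (x + y) (x + y) - b (x - y) (x - y)"
      by (simp add: b_lin)
    have t: "2 * (b x y - b y x) = b (x + z) (\<i> *\<^sub>C (x + z)) - b (x - z) (\<i> *\<^sub>C (x - z))"
    proof -
      have "b y x = b (\<i> *\<^sub>C y) (\<i> *\<^sub>C x)" by (simp add: b_ii)
      also have "\<dots> = - b z (\<i> *\<^sub>C x)"
        using b_lin(3)[of 0 z "\<i> *\<^sub>C x"] b_lin(5)[of 0 z] by (simp add: z_def b_def blinfun.minus_right)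
      finally have "b y x = - b z (\<i> *\<^sub>C x)" .
      moreover have "b x y = b x (\<i> *\<^sub>C z)" by (simp add: y)
      ultimately show ?thesis
        by (simp add: scaleC_add_right scaleC_diff_right b_lin)
    qed
    have "4 * b x y = (b (x + y) (x + y) - b (x - y) (x - y))
      + (b (x + z) (\<i> *\<^sub>C (x + z)) - b (x - z) (\<i> *\<^sub>C (x - z)))"
      unfolding s[symmetric] t[symmetric] by (simp add: algebra_simps)
    from arg_cong[OF this, of "\<lambda>u. 2 * r * u"]
    have "4 * (2 * r * b x y) = (2 * r * b (x + y) (x + y) - 2 * r * b (x - y) (x - y))
      + (2 * r * b (x + z) (\<i> *\<^sub>C (x + z)) - 2 * r * b (x - z) (\<i> *\<^sub>C (x - z)))"
      by (simp only: distrib_left right_diff_distrib mult_ac)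
    also have "\<dots> \<le> ((norm (?D (x + y)))\<^sup>2 + (norm (?D (x - y)))\<^sup>2)
      + ((norm (?D (x + z)))\<^sup>2 + (norm (?D (x - z)))\<^sup>2)"
      using q1[of "x + y"] q1[of "x - y"] q2[of "x + z"] q2[of "x - z"] by linarith
    also have "\<dots> = 4 * ((norm (?D x))\<^sup>2 + (norm (?D y))\<^sup>2)"
      unfolding par nz by simp
    finally show ?thesis using r by (simp add: field_simps)
  qed
  \<comment> \<open>Scaling \<open>x\<close> and \<open>y\<close> oppositely turns the sum of
    squares into a product. The constant is twice that of the quadratic form; this is harmless, as
    the final estimates in \<open>r\<close> come from the special radius and not from here.\<close>
  have b2: "b x y \<le> 1 / r * norm (?D x) * norm (?D y)" for x y
  proof -
    have "b x y \<le> 2 * (1 / (2 * r)) * norm (?D x) * norm (?D y)"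
    proof (rule le_two_mult_of_scaling)
      fix t :: real assume t: "0 < t"
      have "b (t *\<^sub>R x) ((1 / t) *\<^sub>R y) = b x y" using t by (simp add: b_lin)
      then show "b x y \<le> 1 / (2 * r) * (t\<^sup>2 * (norm (?D x))\<^sup>2 + (norm (?D y))\<^sup>2 / t\<^sup>2)"
        using b1[of "t *\<^sub>R x" "(1 / t) *\<^sub>R y"]
        by (simp add: blinfun.scaleR_right power_mult_distrib power_divide)
    qed (use r in auto)
    then show ?thesis by simp
  qed
  show ?thesis
  proof (rule two_sided_factorization[OF is_clinear_id_minus_adj_compose[OF A B] is_clinear_defect[OF B]
        is_clinear_defect[OF B] defect_symmetric[OF B]])
    fix x y
    have "(id_blinfun - (adj A o\<^sub>L B)) x \<bullet> y = ?D x \<bullet> ?D y + b (- x) y"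
      unfolding inner_id_minus_adj_compose[OF A]
      by (simp add: inner_defect[OF B] b_def \<Delta>_def
          blinfun.diff_left blinfun.minus_right inner_diff_right)
    also have "\<dots> \<le> norm (?D x) * norm (?D y) + 1 / r * norm (?D (- x)) * norm (?D y)"
      by (intro add_mono b2 norm_cauchy_schwarz)
    also have "\<dots> = (1 + 1 / r) * norm (?D x) * norm (?D y)"
      by (simp add: blinfun.minus_right algebra_simps)
    finally show "(id_blinfun - (adj A o\<^sub>L B)) x \<bullet> y \<le> (1 + 1 / r) * norm (?D x) * norm (?D y)" .
  qed (use r that in \<open>auto simp: defect_space_def\<close>)
qed

section \<open>Schur class functions\<close>

lemma cmod_cinner_le: "cmod (cinner x y) \<le> norm x * norm (y :: 'a :: complex_inner)"
proof -
  define u where "u = cnj (sgn (cinner x y))"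
  have "cmod (cinner x y) = Re (u * cinner x y)"
  proof (cases "cinner x y = 0")
    case False
    have "u * cinner x y = of_real (cmod (cinner x y))"
      using False by (simp add: u_def sgn_eq complex_norm_square[symmetric] power2_eq_square mult.commute)
    then show ?thesis by simp
  qed simp
  also have "\<dots> = (u *\<^sub>C x) \<bullet> y"
    by (simp add: inner_eq_Re_cinner cinner_scaleC_left)
  also have "\<dots> \<le> norm (u *\<^sub>C x) * norm y" by (rule norm_cauchy_schwarz)
  also have "\<dots> \<le> norm x * norm y"
    by (intro mult_right_mono) (auto simp: norm_scaleC u_def norm_sgn)
  finally show ?thesis .
qed

lemma schurD:
  assumes "F \<in> schur" "z \<in> \<D>"
  shows "F z \<in> contractions" "is_clinear (blinfun_apply (F z))" "norm (F z) \<le> 1"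
    "norm (F z x) \<le> norm x"
proof -
  show "F z \<in> contractions" using assms by (auto simp: schur_def)
  then show "is_clinear (blinfun_apply (F z))" and n: "norm (F z) \<le> 1"
    by (auto simp: contractions_def)
  show "norm (F z x) \<le> norm x"
    using norm_blinfun[of "F z" x] mult_right_mono[OF n, of "norm x"] by simp
qed

lemma holomorphic_cinner_schur:
  fixes F :: "complex \<Rightarrow> 'a::complex_inner \<Rightarrow>\<^sub>L 'b::complex_inner"
  assumes "F \<in> schur"
  shows "(\<lambda>z. cinner (F z x) y) holomorphic_on \<D>"
proof (rule holomorphic_onI)
  fix z :: complex assume "z \<in> \<D>"
  then have "\<exists>F'. (F has_derivative (\<lambda>h. h *\<^sub>C F')) (at z)"
    using assms by (simp add: schur_def analytic_on_disc_def)
  then obtain F' where F': "(F has_derivative (\<lambda>h. h *\<^sub>C F')) (at z)"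
    by blast
  have "bounded_linear (\<lambda>A :: 'a \<Rightarrow>\<^sub>L 'b. cinner (A x) y)"
    by (rule bounded_linear_compose[OF bounded_linear_cinner_left blinfun.bounded_linear_left])
  from bounded_linear.has_derivative[OF this F']
  have "((\<lambda>z. cinner (F z x) y) has_derivative (\<lambda>h. h * cinner (F' x) y)) (at z)"
    by (simp add: scaleC_blinfun.rep_eq cinner_scaleC_left)
  then have "((\<lambda>z. cinner (F z x) y) has_field_derivative cinner (F' x) y) (at z)"
    by (rule has_derivative_imp_has_field_derivative) (rule refl)
  then show "(\<lambda>z. cinner (F z x) y) field_differentiable at z within \<D>"
    by (meson field_differentiable_at_within field_differentiable_def)
qed

lemma maximum_modulus_constant:
  assumes "f holomorphic_on \<D>" "z \<in> \<D>" "w \<in> \<D>" "\<And>u. u \<in> \<D> \<Longrightarrow> cmod (f u) \<le> cmod (f w)"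
  shows "f z = f w"
proof -
  have "f constant_on \<D>"
    by (rule maximum_modulus_principle[OF assms(1), of \<D> w]) (use assms in auto)
  then show ?thesis
    using assms(2,3) by (auto simp: constant_on_def)
qed

text \<open>The holomorphic function \<open>f\<close> attains its maximum modulus, the squared norm
  of \<open>x\<close>, at \<open>w\<close>, so it is constant; Cauchy-Schwarz then leaves no room
  for \<open>F z x\<close> to be shorter than \<open>x\<close>.\<close>

lemma schur_isometric_point:
  fixes F :: "complex \<Rightarrow> 'a::complex_hilbert \<Rightarrow>\<^sub>L 'b::complex_hilbert"
  assumes F: "F \<in> schur" and z: "z \<in> \<D>" and w: "w \<in> \<D>" and eq: "norm (F w x) = norm x"
  shows "norm (F z x) = norm x"
proof (cases "x = 0")
  case False
  define f where "f z = cinner (F z x) (F w x)" for z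
  have fw: "cmod (f w) = norm x * norm x"
    by (simp add: f_def cinner_self eq norm_mult power2_eq_square)
  have le: "cmod (f u) \<le> norm (F u x) * norm x" for u
    unfolding f_def eq[symmetric] by (rule cmod_cinner_le)
  have "f z = f w"
  proof (rule maximum_modulus_constant[OF _ z w])
    show "f holomorphic_on \<D>" unfolding f_def by (rule holomorphic_cinner_schur[OF F])
    fix u :: complex assume u: "u \<in> \<D>"
    show "cmod (f u) \<le> cmod (f w)"
      unfolding fw by (rule order_trans[OF le mult_right_mono[OF schurD(4)[OF F u]]]) simp
  qed
  then have "norm x * norm x \<le> norm (F z x) * norm x"
    using le[of z] fw by simp
  then have "norm x \<le> norm (F z x)" using False by simp
  then show ?thesis using schurD(4)[OF F z, of x] by simp
qed simp

text \<open>The adjoint depends antiholomorphically on the point, so the maximum principle is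
  applied to the form of \<open>F z\<close> itself, with the fixed vector \<open>adj (F w) y\<close>
  inserted.\<close>

lemma schur_coisometric_point:
  fixes F :: "complex \<Rightarrow> 'a::complex_hilbert \<Rightarrow>\<^sub>L 'b::complex_hilbert"
  assumes F: "F \<in> schur" and z: "z \<in> \<D>" and w: "w \<in> \<D>" and eq: "norm (adj (F w) y) = norm y"
  shows "norm (adj (F z) y) = norm y"
proof (cases "y = 0")
  case False
  have adj_le: "norm (adj (F u) y) \<le> norm y" if "u \<in> \<D>" for u y
  proof -
    have "norm (adj (F u)) \<le> 1" using norm_adj_le[OF schurD(2)[OF F that]] schurD(3)[OF F that] by simp
    then show ?thesis using norm_blinfun[of "adj (F u)" y] mult_right_mono[of "norm (adj (F u))" 1 "norm y"] by simp
  qed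
  define f where "f z = cinner (F z (adj (F w) y)) y" for z
  have f: "f u = cinner (adj (F w) y) (adj (F u) y)" if "u \<in> \<D>" for u
    unfolding f_def by (rule cinner_adj[OF schurD(2)[OF F that]])
  have fw: "cmod (f w) = norm y * norm y"
    by (simp add: f[OF w] cinner_self eq norm_mult power2_eq_square)
  have le: "cmod (f u) \<le> norm y * norm (adj (F u) y)" if "u \<in> \<D>" for u
    unfolding f[OF that] eq[symmetric] by (rule cmod_cinner_le)
  have "f z = f w"
  proof (rule maximum_modulus_constant[OF _ z w])
    show "f holomorphic_on \<D>" unfolding f_def by (rule holomorphic_cinner_schur[OF F])
    fix u :: complex assume u: "u \<in> \<D>"
    show "cmod (f u) \<le> cmod (f w)"
      unfolding fw by (rule order_trans[OF le[OF u] mult_left_mono[OF adj_le[OF u]]]) simp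
  qed
  then have "norm y * norm y \<le> norm y * norm (adj (F z) y)"
    using le[OF z] fw by simp
  then have "norm y \<le> norm (adj (F z) y)" using False by simp
  then show ?thesis using adj_le[OF z, of y] by simp
next
  case True then show ?thesis by simp
qed

text \<open>The kernel of a defect operator consists of the vectors whose norm the contraction
  preserves, and the defect space is the orthogonal complement of this kernel; complements reverse
  the inclusion.\<close>

lemma defect_space_subset:
  fixes C C' :: "'a::complex_hilbert \<Rightarrow>\<^sub>L 'b::complex_hilbert"
  assumes C: "C \<in> contractions" and C': "C' \<in> contractions"
    and iso: "\<And>x. norm (C' x) = norm x \<Longrightarrow> norm (C x) = norm x"
  shows "defect_space C \<subseteq> defect_space C'"
proof
  fix w assume w: "w \<in> defect_space C"
  show "w \<in> defect_space C'"
    unfolding defect_space_def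
  proof (rule in_closure_rangeI)
    fix u assume "\<And>v. u \<bullet> defect C' v = 0"
    then have "defect C' u \<bullet> defect C' u = 0" by (simp add: defect_symmetric[OF C'])
    then have "norm (defect C' u) = 0" by simp
    then have "(norm (C' u))\<^sup>2 = (norm u)\<^sup>2" using norm_defect_sq[OF C', of u] by simp
    then have "norm (C u) = norm u" by (intro iso) simp
    then have "(norm (defect C u))\<^sup>2 = 0" unfolding norm_defect_sq[OF C] by simp
    then have "defect C u = 0" by simp
    then have "u \<bullet> defect C v = 0" for v by (simp add: defect_symmetric[OF C, symmetric])
    then show "u \<bullet> w = 0"
      by (intro orthogonal_closure[OF _ w[unfolded defect_space_def]]) auto
  qed
qed

lemma schur_defect_eq:
  fixes G :: "complex \<Rightarrow> 'a::complex_hilbert \<Rightarrow>\<^sub>L 'b::complex_hilbert"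
  assumes G: "G \<in> schur" and z: "z \<in> \<D>"
  shows "schur_defect G = defect_space (G z)" and "schur_codefect G = defect_space (adj (G z))"
proof -
  have 0: "0 \<in> \<D>" by simp
  note C = schurD(1)[OF G]
  show "schur_defect G = defect_space (G z)"
    unfolding schur_defect_def
    by (intro equalityI defect_space_subset C z 0) (auto intro: schur_isometric_point[OF G] z 0)
  show "schur_codefect G = defect_space (adj (G z))"
    unfolding schur_codefect_def
    by (intro equalityI defect_space_subset adj_contractions C z 0)
      (auto intro: schur_coisometric_point[OF G] z 0)
qed

section \<open>Taylor coefficients of weakly holomorphic functions\<close>

lemma cinner_add_right: "cinner x (y + z) = cinner x y + cinner x (z :: 'a :: complex_inner)"
  by (metis cinner_add_left cinner_commute complex_cnj_add)

text \<open>The scalar Taylor coefficients are conjugate linear in \<open>v\<close> and bounded by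
  Cauchy's inequality, so Riesz' theorem turns them into vectors. The vector series converges
  absolutely, and its sum is identified weakly.\<close>

lemma weak_taylor:
  fixes g :: "complex \<Rightarrow> 'a::complex_hilbert"
  assumes hol: "\<And>v. (\<lambda>z. cinner (g z) v) holomorphic_on \<D>"
    and bdd: "\<And>r. r < 1 \<Longrightarrow> \<exists>B. \<forall>z\<in>cball 0 r. norm (g z) \<le> B"
  obtains c where "\<And>z. z \<in> \<D> \<Longrightarrow> (\<lambda>n. z ^ n *\<^sub>C c n) sums g z"
    "\<And>r. 0 \<le> r \<Longrightarrow> r < 1 \<Longrightarrow> summable (\<lambda>n. norm (c n) * r ^ n)"
proof -
  define a where "a n v = (deriv ^^ n) (\<lambda>z. cinner (g z) v) 0 / fact n" for n v
  have a_sums: "(\<lambda>n. a n v * z ^ n) sums cinner (g z) v" if "z \<in> \<D>" for v z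
    using holomorphic_power_series[OF hol that, of v] by (simp add: a_def)
  have a_bound: "cmod (a n v) \<le> B * norm v / r ^ n"
    if r: "0 < r" "r < 1" and B: "\<forall>z\<in>cball 0 r. norm (g z) \<le> B" for r B n v
  proof -
    have sub: "cball 0 r \<subseteq> \<D>" "ball 0 r \<subseteq> \<D>" using r by auto
    have "cmod ((deriv ^^ n) (\<lambda>z. cinner (g z) v) 0) \<le> fact n * (B * norm v) / r ^ n"
    proof (rule Cauchy_inequality)
      show "(\<lambda>z. cinner (g z) v) holomorphic_on ball 0 r"
        using hol sub holomorphic_on_subset by blast
      show "continuous_on (cball 0 r) (\<lambda>z. cinner (g z) v)"
        using hol sub holomorphic_on_imp_continuous_on continuous_on_subset by blast
      fix z :: complex assume "norm (0 - z) = r"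
      then have "norm (g z) \<le> B" using B by simp
      then show "cmod (cinner (g z) v) \<le> B * norm v"
        by (rule order_trans[OF cmod_cinner_le mult_right_mono]) simp
    qed (use r in auto)
    then show ?thesis by (simp add: a_def norm_divide pos_divide_le_eq mult_ac)
  qed
  have a_add: "a n (v + w) = a n v + a n w" for n v w
    unfolding a_def cinner_add_right
    by (subst higher_deriv_add[OF hol hol]) (auto simp: add_divide_distrib)
  have a_scaleC: "a n (s *\<^sub>C v) = cnj s * a n v" for n s v
    unfolding a_def cinner_scaleC_right
    by (subst higher_deriv_cmult[OF hol]) auto
  \<comment> \<open>Real parts suffice: conjugate linearity moves \<open>z ^ n\<close> into the
    argument before the real part is taken.\<close>
  have "\<exists>c. \<forall>v. Re (a n v) = c \<bullet> v" for n
  proof -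
    have "bounded_linear (\<lambda>v. Re (a n v))"
    proof
      show "Re (a n (v + w)) = Re (a n v) + Re (a n w)" for v w by (simp add: a_add)
      show "Re (a n (s *\<^sub>R v)) = s *\<^sub>R Re (a n v)" for s v
        using a_scaleC[of n "complex_of_real s" v] by (simp add: scaleC_of_real)
      obtain B where B: "\<forall>z\<in>cball 0 (1/2). norm (g z) \<le> B" using bdd[of "1/2"] by auto
      have "norm (Re (a n v)) \<le> norm v * (B / (1/2) ^ n)" for v
        using order_trans[OF abs_Re_le_cmod a_bound[OF _ _ B]] by (simp add: mult_ac)
      then show "\<exists>K. \<forall>v. norm (Re (a n v)) \<le> norm v * K" by blast
    qed
    from riesz_closed_subspace[OF closed_UNIV subspace_UNIV this] show ?thesis by (metis UNIV_I)
  qed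
  then obtain c where c: "\<And>n v. Re (a n v) = c n \<bullet> v" by metis
  have c_bound: "norm (c n) \<le> B / r ^ n"
    if r: "0 < r" "r < 1" and B: "\<forall>z\<in>cball 0 r. norm (g z) \<le> B" for r B n
  proof -
    have B0: "0 \<le> B" using B r by (metis centre_in_cball less_imp_le norm_ge_zero order_trans)
    have "norm (c n) * norm (c n) = Re (a n (c n))"
      by (simp add: c power2_norm_eq_inner[symmetric] power2_eq_square)
    also have "\<dots> \<le> cmod (a n (c n))" by (rule complex_Re_le_cmod)
    also have "\<dots> \<le> B * norm (c n) / r ^ n" by (rule a_bound[OF r B])
    finally have "norm (c n) * norm (c n) \<le> (B / r ^ n) * norm (c n)" by simp
    then show ?thesis
      using B0 r by (cases "norm (c n) = 0") (auto intro: mult_right_le_imp_le[of _ "norm (c n)"])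
  qed
  have summ: "summable (\<lambda>n. norm (c n) * r ^ n)" if r: "0 \<le> r" "r < 1" for r
  proof -
    \<comment> \<open>A radius strictly between \<open>r\<close> and 1, giving a geometric majorant
      with ratio \<open>r / \<rho>\<close>.\<close>
    define \<rho> where "\<rho> = (1 + r) / 2"
    have \<rho>: "0 < \<rho>" "\<rho> < 1" "r < \<rho>" using r by (auto simp: \<rho>_def)
    obtain B where B: "\<forall>z\<in>cball 0 \<rho>. norm (g z) \<le> B" using bdd[OF \<rho>(2)] by blast
    show ?thesis
    proof (rule summable_comparison_test'[where N = 0])
      show "summable (\<lambda>n. B * (r / \<rho>) ^ n)"
        using r \<rho> by (intro summable_mult summable_geometric) auto
      show "norm (norm (c n) * r ^ n) \<le> B * (r / \<rho>) ^ n" for n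
      proof -
        have "norm (c n) * r ^ n \<le> B / \<rho> ^ n * r ^ n"
          using r by (intro mult_right_mono c_bound[OF \<rho>(1,2) B]) auto
        then show ?thesis using r by (simp add: power_divide)
      qed
    qed
  qed
  have sums: "(\<lambda>n. z ^ n *\<^sub>C c n) sums g z" if z: "z \<in> \<D>" for z
  proof -
    have "summable (\<lambda>n. norm (c n) * cmod z ^ n)" using z by (intro summ) auto
    then have "summable (\<lambda>n. norm (z ^ n *\<^sub>C c n))"
      by (simp add: norm_scaleC norm_power mult.commute)
    then have "summable (\<lambda>n. z ^ n *\<^sub>C c n)" by (rule summable_norm_cancel)
    then obtain s where s: "(\<lambda>n. z ^ n *\<^sub>C c n) sums s" by (auto simp: summable_def)
    have "s \<bullet> v = g z \<bullet> v" for v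
    proof -
      have "(\<lambda>n. (z ^ n *\<^sub>C c n) \<bullet> v) sums (s \<bullet> v)"
        by (rule bounded_linear.sums[OF bounded_linear_inner_left s])
      moreover have "(z ^ n *\<^sub>C c n) \<bullet> v = Re (a n v * z ^ n)" for n
        by (simp add: inner_scaleC_left c[symmetric] a_scaleC mult.commute)
      moreover have "(\<lambda>n. Re (a n v * z ^ n)) sums Re (cinner (g z) v)"
        by (rule bounded_linear.sums[OF bounded_linear_Re a_sums[OF z]])
      ultimately show ?thesis
        using sums_unique2 by (metis (no_types, lifting) ext inner_eq_Re_cinner)
    qed
    then have "s = g z" by (metis vector_eq_rdot)
    then show ?thesis using s by simp
  qed
  show ?thesis by (rule that[OF sums summ])
qed

section \<open>Multiplication operators on Hardy spaces\<close>

text \<open>Exchanging index and exponent makes the sum geometric, with ratio an \<open>N\<close>-th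
  root of unity that differs from 1 unless \<open>n = m\<close>.\<close>

lemma sum_root_unity_orthogonal:
  assumes "n < N" "m < N"
  shows "(\<Sum>k<N. cis (2 * pi * real k / real N) ^ n * cnj (cis (2 * pi * real k / real N)) ^ m)
    = (if n = m then of_nat N else 0)"
proof -
  define \<omega> where "\<omega> = (\<lambda>k::nat. cis (2 * pi * real k / real N))"
  define \<zeta> where "\<zeta> = \<omega> n * cnj (\<omega> m)"
  have N: "0 < N" using assms by simp
  have pow: "\<omega> k ^ n = \<omega> n ^ k" for k n
    unfolding \<omega>_def Complex.DeMoivre by (simp add: mult_ac)
  have pow_prod: "\<omega> k ^ n * cnj (\<omega> k) ^ m = \<zeta> ^ k" for k
    by (simp add: \<zeta>_def power_mult_distrib pow flip: complex_cnj_power)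
  have one: "\<omega> k ^ N = 1" for k
    unfolding \<omega>_def Complex.DeMoivre using N cis_multiple_2pi[of "real k"] by simp
  have inj: "inj_on \<omega> {..<N}"
    using Complex.bij_betw_roots_unity[OF N] unfolding \<omega>_def by (rule bij_betw_imp_inj_on)
  have unit: "\<omega> k * cnj (\<omega> k) = 1" for k
    by (simp add: \<omega>_def complex_norm_square[symmetric])
  have "(\<Sum>k<N. \<omega> k ^ n * cnj (\<omega> k) ^ m) = (\<Sum>k<N. \<zeta> ^ k)"
    by (simp add: pow_prod)
  also have "\<dots> = (if n = m then of_nat N else 0)"
  proof (cases "n = m")
    case True
    then show ?thesis by (simp add: \<zeta>_def unit)
  next
    case False
    have "\<zeta> \<noteq> 1"
    proof
      assume "\<zeta> = 1"
      then have "\<omega> n * (cnj (\<omega> m) * \<omega> m) = \<omega> m" by (simp add: \<zeta>_def mult.assoc[symmetric])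
      then have "\<omega> n = \<omega> m" using unit[of m] by (simp add: mult.commute)
      then show False using inj assms False by (auto dest: inj_onD)
    qed
    moreover have "\<zeta> ^ N = 1"
      using one by (simp add: \<zeta>_def power_mult_distrib flip: complex_cnj_power)
    ultimately show ?thesis using False by (simp add: geometric_sum)
  qed
  finally show ?thesis by (simp add: \<omega>_def)
qed

lemma cinner_sum_left: "cinner (sum f A) y = (\<Sum>i\<in>A. cinner (f i) (y :: 'a :: complex_inner))"
  by (rule linear_sum[OF bounded_linear.linear[OF bounded_linear_cinner_left]])

lemma cinner_sum_right: "cinner y (sum f A) = (\<Sum>i\<in>A. cinner (y :: 'a :: complex_inner) (f i))"
  by (subst cinner_commute, subst cinner_sum_left, subst cnj_sum) (simp flip: cinner_commute)

text \<open>Discrete Parseval identity; averages over roots of unity take the place of integrals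
  over circles.\<close>

lemma dft_parseval:
  fixes p :: "nat \<Rightarrow> 'a::complex_inner"
  shows "(\<Sum>k<N. (norm (\<Sum>n<N. cis (2 * pi * real k / real N) ^ n *\<^sub>C p n))\<^sup>2)
    = real N * (\<Sum>n<N. (norm (p n))\<^sup>2)"
proof -
  let ?w = "\<lambda>k. cis (2 * pi * real k / real N)"
  have sq: "complex_of_real ((norm (\<Sum>n<N. u n))\<^sup>2) = (\<Sum>n<N. \<Sum>m<N. cinner (u n) (u m))"
    for u :: "nat \<Rightarrow> 'a"
    unfolding cinner_self[symmetric] cinner_sum_left by (simp only: cinner_sum_right)
  have "complex_of_real (\<Sum>k<N. (norm (\<Sum>n<N. ?w k ^ n *\<^sub>C p n))\<^sup>2)
    = (\<Sum>k<N. \<Sum>n<N. \<Sum>m<N. ?w k ^ n * cnj (?w k) ^ m * cinner (p n) (p m))"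
    by (simp only: of_real_sum sq cinner_scaleC_left cinner_scaleC_right complex_cnj_power mult_ac)
  also have "\<dots> = (\<Sum>n<N. \<Sum>m<N. \<Sum>k<N. ?w k ^ n * cnj (?w k) ^ m * cinner (p n) (p m))"
    by (rule trans[OF sum.swap sum.cong[OF refl sum.swap]])
  also have "\<dots> = (\<Sum>n<N. \<Sum>m<N. (\<Sum>k<N. ?w k ^ n * cnj (?w k) ^ m) * cinner (p n) (p m))"
    by (simp only: sum_distrib_right)
  also have "\<dots> = (\<Sum>n<N. \<Sum>m<N. (if n = m then of_nat N else 0) * cinner (p n) (p m))"
    by (intro sum.cong refl, subst sum_root_unity_orthogonal) auto
  also have "\<dots> = (\<Sum>n<N. of_nat N * cinner (p n) (p n))"
    by (intro sum.cong refl) (simp add: if_distrib[of "\<lambda>x. x * _"] cong: if_cong)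
  also have "\<dots> = complex_of_real (real N * (\<Sum>n<N. (norm (p n))\<^sup>2))"
    by (simp add: cinner_self sum_distrib_left)
  finally show ?thesis by (simp only: of_real_eq_iff)
qed

lemma norm_suminf_minus_partial_le:
  fixes f :: "nat \<Rightarrow> 'a::banach"
  assumes "summable (\<lambda>n. norm (f n))"
  shows "norm (suminf f - sum f {..<N}) \<le> (\<Sum>n. norm (f (n + N)))"
proof -
  have "suminf f - sum f {..<N} = (\<Sum>n. f (n + N))"
    by (simp add: suminf_minus_initial_segment summable_norm_cancel assms)
  then show ?thesis
    using summable_norm[OF summable_ignore_initial_segment[OF assms]] by simp
qed

lemma summable_tail_tendsto_zero:
  fixes f :: "nat \<Rightarrow> real"
  assumes "summable f"
  shows "(\<lambda>N. \<Sum>n. f (n + N)) \<longlonglongrightarrow> 0"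
proof -
  have "(\<lambda>N. suminf f - sum f {..<N}) \<longlonglongrightarrow> suminf f - suminf f"
    by (intro tendsto_intros summable_LIMSEQ assms)
  then show ?thesis by (simp add: suminf_minus_initial_segment assms)
qed

text \<open>Averaging the pointwise inequality over the \<open>N\<close>-th roots of unity times \<open>r\<close> compares the
  square sums of the coefficients; then \<open>N \<rightarrow> \<infinity>\<close> and \<open>r \<rightarrow> 1\<close>.\<close>

lemma coefficients_sq_sum_le:
  fixes c :: "nat \<Rightarrow> 'b::complex_hilbert" and d :: "nat \<Rightarrow> 'a::complex_hilbert"
  assumes c: "\<And>r. 0 \<le> r \<Longrightarrow> r < 1 \<Longrightarrow> summable (\<lambda>n. norm (c n) * r ^ n)"
    and d: "\<And>r. 0 \<le> r \<Longrightarrow> r < 1 \<Longrightarrow> summable (\<lambda>n. norm (d n) * r ^ n)"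
    and le: "\<And>z. z \<in> \<D> \<Longrightarrow> norm (\<Sum>n. z ^ n *\<^sub>C c n) \<le> norm (\<Sum>n. z ^ n *\<^sub>C d n)"
    and d2: "summable (\<lambda>n. (norm (d n))\<^sup>2)"
  shows "(\<Sum>n<M. (norm (c n))\<^sup>2) \<le> (\<Sum>n. (norm (d n))\<^sup>2)"
proof -
  let ?S = "\<Sum>n. (norm (d n))\<^sup>2"
  have main: "(\<Sum>n<M. r ^ (2 * n) * (norm (c n))\<^sup>2) \<le> ?S" if r: "0 < r" "r < 1" for r
  proof -
    \<comment> \<open>The cost of truncating both series after \<open>N\<close> terms on the circle
      of radius \<open>r\<close>.\<close>
    define e where "e N = (\<Sum>n. norm (c (n + N)) * r ^ (n + N)) + (\<Sum>n. norm (d (n + N)) * r ^ (n + N))" for N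
    define B where "B = (\<Sum>n. norm (d n) * r ^ n)"
    have cr: "summable (\<lambda>n. norm (c n) * r ^ n)" and dr: "summable (\<lambda>n. norm (d n) * r ^ n)"
      using r by (auto intro: c d)
    have "e \<longlonglongrightarrow> 0 + 0"
      unfolding e_def
      by (intro tendsto_add summable_tail_tendsto_zero[OF cr] summable_tail_tendsto_zero[OF dr])
    then have e0: "e \<longlonglongrightarrow> 0" by simp
    have pt: "(norm (\<Sum>n<N. z ^ n *\<^sub>C c n))\<^sup>2 \<le> (norm (\<Sum>n<N. z ^ n *\<^sub>C d n))\<^sup>2 + e N * (2 * B + e N)"
      if z: "cmod z = r" for z N
    proof -
      have nc: "norm (z ^ n *\<^sub>C c n) = norm (c n) * r ^ n" and nd: "norm (z ^ n *\<^sub>C d n) = norm (d n) * r ^ n" for n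
        by (simp_all add: norm_scaleC norm_power z mult.commute)
      have sc: "summable (\<lambda>n. norm (z ^ n *\<^sub>C c n))" and sd: "summable (\<lambda>n. norm (z ^ n *\<^sub>C d n))"
        unfolding nc nd by (rule cr dr)+
      let ?c = "\<Sum>n. z ^ n *\<^sub>C c n" and ?d = "\<Sum>n. z ^ n *\<^sub>C d n"
      let ?cN = "\<Sum>n<N. z ^ n *\<^sub>C c n" and ?dN = "\<Sum>n<N. z ^ n *\<^sub>C d n"
      have tc: "norm (?c - ?cN) \<le> (\<Sum>n. norm (c (n + N)) * r ^ (n + N))"
        using norm_suminf_minus_partial_le[OF sc, of N] unfolding nc .
      have td: "norm (?d - ?dN) \<le> (\<Sum>n. norm (d (n + N)) * r ^ (n + N))"
        using norm_suminf_minus_partial_le[OF sd, of N] unfolding nd .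
      have "norm ?c \<le> norm ?d" using z r by (intro le) auto
      then have 1: "norm ?cN \<le> norm ?dN + e N"
        using tc td norm_triangle_sub[of ?cN ?c] norm_triangle_sub[of ?d ?dN]
        by (simp add: e_def norm_minus_commute)
      have "norm ?dN \<le> (\<Sum>n<N. norm (d n) * r ^ n)"
        using norm_sum[of "\<lambda>n. z ^ n *\<^sub>C d n" "{..<N}"] by (simp add: nd)
      also have "\<dots> \<le> B" unfolding B_def using r by (intro sum_le_suminf dr) auto
      finally have 2: "norm ?dN \<le> B" .
      have eN: "0 \<le> e N"
        unfolding e_def
        by (rule add_nonneg_nonneg[OF order_trans[OF norm_ge_zero tc] order_trans[OF norm_ge_zero td]])
      have "(norm ?cN)\<^sup>2 \<le> (norm ?dN + e N)\<^sup>2" using 1 by (intro power_mono) auto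
      also have "\<dots> = (norm ?dN)\<^sup>2 + e N * (2 * norm ?dN + e N)"
        by (simp add: power2_eq_square algebra_simps)
      also have "\<dots> \<le> (norm ?dN)\<^sup>2 + e N * (2 * B + e N)"
        using 2 eN by (intro add_left_mono mult_left_mono) auto
      finally show ?thesis .
    qed
    have fin: "(\<Sum>n<M. r ^ (2 * n) * (norm (c n))\<^sup>2) \<le> ?S + e N * (2 * B + e N)"
      if "M \<le> N" "0 < N" for N
    proof -
      define w where "w = (\<lambda>k::nat. cis (2 * pi * real k / real N))"
      have P: "(\<Sum>k<N. (norm (\<Sum>n<N. (of_real r * w k) ^ n *\<^sub>C x n))\<^sup>2)
          = real N * (\<Sum>n<N. r ^ (2 * n) * (norm (x n))\<^sup>2)" for x :: "nat \<Rightarrow> 'z::complex_inner"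
      proof -
        have "(of_real r * w k) ^ n *\<^sub>C x n = w k ^ n *\<^sub>C (r ^ n *\<^sub>R x n)" for k n
          unfolding scaleC_of_real[symmetric] scaleC_scaleC
          by (simp add: power_mult_distrib mult.commute)
        then show ?thesis
          using r dft_parseval[of N "\<lambda>n. r ^ n *\<^sub>R x n"]
          by (simp add: w_def power_mult_distrib power_mult power2_eq_square mult_ac
              power_mult[of _ 2] power_even_eq power_commutes)
      qed
      have "real N * (\<Sum>n<N. r ^ (2 * n) * (norm (c n))\<^sup>2)
        \<le> (\<Sum>k<N. (norm (\<Sum>n<N. (of_real r * w k) ^ n *\<^sub>C d n))\<^sup>2 + e N * (2 * B + e N))"
        unfolding P[symmetric] using r by (intro sum_mono pt) (simp add: norm_mult w_def)
      also have "\<dots> = real N * ((\<Sum>n<N. r ^ (2 * n) * (norm (d n))\<^sup>2) + e N * (2 * B + e N))"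
        by (simp add: sum.distrib P distrib_left)
      finally have "(\<Sum>n<N. r ^ (2 * n) * (norm (c n))\<^sup>2)
          \<le> (\<Sum>n<N. r ^ (2 * n) * (norm (d n))\<^sup>2) + e N * (2 * B + e N)"
        using \<open>0 < N\<close> by simp
      also have "(\<Sum>n<N. r ^ (2 * n) * (norm (d n))\<^sup>2) \<le> (\<Sum>n<N. 1 * (norm (d n))\<^sup>2)"
        using r by (intro sum_mono mult_right_mono power_le_one) auto
      also have "\<dots> \<le> ?S" using d2 by (simp add: sum_le_suminf)
      finally have "(\<Sum>n<N. r ^ (2 * n) * (norm (c n))\<^sup>2) \<le> ?S + e N * (2 * B + e N)" by simp
      moreover have "(\<Sum>n<M. r ^ (2 * n) * (norm (c n))\<^sup>2) \<le> (\<Sum>n<N. r ^ (2 * n) * (norm (c n))\<^sup>2)"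
        using r \<open>M \<le> N\<close> by (intro sum_mono2) auto
      ultimately show ?thesis by linarith
    qed
    have "(\<lambda>N. ?S + e N * (2 * B + e N)) \<longlonglongrightarrow> ?S + 0 * (2 * B + 0)"
      by (intro tendsto_intros e0)
    then have "(\<lambda>N. ?S + e N * (2 * B + e N)) \<longlonglongrightarrow> ?S" by simp
    moreover have "\<exists>K. \<forall>N\<ge>K. (\<Sum>n<M. r ^ (2 * n) * (norm (c n))\<^sup>2) \<le> ?S + e N * (2 * B + e N)"
      using fin by (intro exI[of _ "Suc M"]) auto
    ultimately show ?thesis by (rule LIMSEQ_le_const)
  qed
  \<comment> \<open>A finite sum is continuous in \<open>r\<close>, so the bound extends to
    \<open>r = 1\<close>.\<close>
  have "closed {r. (\<Sum>n<M. r ^ (2 * n) * (norm (c n))\<^sup>2) \<le> ?S}"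
    by (intro closed_Collect_le continuous_intros)
  then have "closure {0<..<1} \<subseteq> {r. (\<Sum>n<M. r ^ (2 * n) * (norm (c n))\<^sup>2) \<le> ?S}"
    using main by (intro closure_minimal) auto
  moreover have "(1::real) \<in> closure {0<..<1}" by simp
  ultimately have "1 \<in> {r. (\<Sum>n<M. r ^ (2 * n) * (norm (c n))\<^sup>2) \<le> ?S}"
    by (rule subsetD)
  then show ?thesis by simp
qed

section \<open>The multiplication operator of a Schur function is a contraction\<close>

lemma hardy_eval_add:
  fixes g h :: "'a::complex_hilbert hardy"
  assumes "z \<in> \<D>"
  shows "hardy_eval (g + h) z = hardy_eval g z + hardy_eval h z"
  unfolding hardy_eval_def
  by (simp add: plus_hardy.rep_eq scaleC_add_right
      suminf_add[OF summable_hardy_eval[OF assms] summable_hardy_eval[OF assms]])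

lemma hardy_eval_scaleC:
  fixes h :: "'a::complex_hilbert hardy"
  assumes "z \<in> \<D>"
  shows "hardy_eval (s *\<^sub>C h) z = s *\<^sub>C hardy_eval h z"
  unfolding hardy_eval_def
    bounded_linear.suminf[OF bounded_linear_scaleC summable_hardy_eval[OF assms]]
  by (simp add: scaleC_hardy.rep_eq scaleC_scaleC mult.commute)

lemma summable_hcoeffs_power:
  fixes h :: "'a::complex_hilbert hardy"
  assumes "0 \<le> r" "r < 1"
  shows "summable (\<lambda>n. norm (hcoeffs h n) * r ^ n)"
proof (rule summable_comparison_test'[where N = 0])
  show "summable (\<lambda>n. norm h * r ^ n)"
    using assms by (intro summable_mult summable_geometric) auto
  show "norm (norm (hcoeffs h n) * r ^ n) \<le> norm h * r ^ n" for n
    using assms by (simp add: mult_right_mono norm_hcoeffs_le)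
qed

text \<open>Tested against a vector, the product is a locally uniform limit of finite sums of
  holomorphic functions, so it has a Taylor series by \<open>weak_taylor\<close>. Its coefficients
  are square summable because the values of \<open>F\<close> do not increase norms
  pointwise.\<close>

lemma schur_times_hardy:
  fixes F :: "complex \<Rightarrow> 'a::complex_hilbert \<Rightarrow>\<^sub>L 'b::complex_hilbert"
    and h :: "'a hardy"
  assumes F: "F \<in> schur"
  obtains k where "norm k \<le> norm h" "\<And>z. z \<in> \<D> \<Longrightarrow> hardy_eval k z = F z (hardy_eval h z)"
proof -
  define g where "g z = F z (hardy_eval h z)" for z
  have g_sums: "(\<lambda>n. z ^ n * cinner (F z (hcoeffs h n)) v) sums cinner (g z) v" if z: "z \<in> \<D>" for z v
  proof -
    have "bounded_linear (\<lambda>x. cinner (F z x) v)"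
      by (rule bounded_linear_compose[OF bounded_linear_cinner_left blinfun.bounded_linear_right])
    from bounded_linear.sums[OF this summable_sums[OF summable_hardy_eval[OF z, of h]]]
    show ?thesis
      by (simp add: g_def hardy_eval_def is_clinear_scaleC[OF schurD(2)[OF F z]] cinner_scaleC_left)
  qed
  have "(\<lambda>z. \<Sum>n. z ^ n * cinner (F z (hcoeffs h n)) v) holomorphic_on \<D>" for v
  proof (rule holomorphic_uniform_sequence[OF open_ball])
    show "(\<lambda>z. \<Sum>n<N. z ^ n * cinner (F z (hcoeffs h n)) v) holomorphic_on \<D>" for N
      by (intro holomorphic_intros holomorphic_cinner_schur[OF F])
    fix z :: complex assume "z \<in> \<D>"
    then obtain e where e: "0 < e" "cball z e \<subseteq> \<D>"
      using open_contains_cball open_ball by blast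
    \<comment> \<open>The point of largest modulus of a compact ball inside the disc gives one
      geometric majorant for the whole ball.\<close>
    obtain s where s: "0 \<le> s" "s < 1" "cball z e \<subseteq> cball 0 s"
    proof -
      have "compact (cmod ` cball z e)" "cmod ` cball z e \<noteq> {}"
        using e by (auto intro!: compact_continuous_image continuous_intros)
      then obtain w where w: "w \<in> cball z e" "\<forall>u\<in>cball z e. cmod u \<le> cmod w"
        using compact_attains_sup[of "cmod ` cball z e"] by auto
      then show thesis using e by (intro that[of "cmod w"]) auto
    qed
    have "uniform_limit (cball z e) (\<lambda>N z. \<Sum>n<N. z ^ n * cinner (F z (hcoeffs h n)) v)
      (\<lambda>z. \<Sum>n. z ^ n * cinner (F z (hcoeffs h n)) v) sequentially"
    proof (rule Weierstrass_m_test)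
      show "summable (\<lambda>n. norm (hcoeffs h n) * s ^ n * norm v)"
        using s by (intro summable_mult2 summable_hcoeffs_power)
      fix n w assume w: "w \<in> cball z e"
      then have wD: "w \<in> \<D>" and ws: "cmod w \<le> s" using e s by auto
      have "cmod (cinner (F w (hcoeffs h n)) v) \<le> norm (hcoeffs h n) * norm v"
        by (rule order_trans[OF cmod_cinner_le mult_right_mono[OF schurD(4)[OF F wD]]]) simp
      moreover have "cmod w ^ n \<le> s ^ n" using ws by (intro power_mono) auto
      ultimately have "cmod w ^ n * cmod (cinner (F w (hcoeffs h n)) v) \<le> s ^ n * (norm (hcoeffs h n) * norm v)"
        using s by (intro mult_mono) auto
      then show "norm (w ^ n * cinner (F w (hcoeffs h n)) v) \<le> norm (hcoeffs h n) * s ^ n * norm v"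
        by (simp add: norm_mult norm_power mult_ac)
    qed
    then show "\<exists>d. 0 < d \<and> cball z d \<subseteq> \<D> \<and> uniform_limit (cball z d)
      (\<lambda>N z. \<Sum>n<N. z ^ n * cinner (F z (hcoeffs h n)) v) (\<lambda>z. \<Sum>n. z ^ n * cinner (F z (hcoeffs h n)) v) sequentially"
      using e by blast
  qed
  then have hol: "(\<lambda>z. cinner (g z) v) holomorphic_on \<D>" for v
    by (rule holomorphic_transform) (use g_sums in \<open>simp add: sums_iff\<close>)
  have bdd: "\<exists>B. \<forall>z\<in>cball 0 r. norm (g z) \<le> B" if r: "r < 1" for r
  proof (intro exI ballI)
    fix z :: complex assume z: "z \<in> cball 0 r"
    then have zD: "z \<in> \<D>" and r0: "0 \<le> r"
      using r order_trans[OF norm_ge_zero[of z]] by auto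
    have nz: "norm (z ^ n *\<^sub>C hcoeffs h n) \<le> norm (hcoeffs h n) * r ^ n" for n
      using z unfolding norm_scaleC norm_power mult.commute[of "norm (hcoeffs h n)"]
      by (intro mult_right_mono power_mono) auto
    have sr: "summable (\<lambda>n. norm (hcoeffs h n) * r ^ n)"
      by (rule summable_hcoeffs_power[OF r0 r])
    have "norm (g z) \<le> norm (hardy_eval h z)"
      unfolding g_def by (rule schurD(4)[OF F zD])
    also have "\<dots> \<le> (\<Sum>n. norm (hcoeffs h n) * r ^ n)"
      unfolding hardy_eval_def by (rule norm_suminf_le[OF nz sr])
    finally show "norm (g z) \<le> (\<Sum>n. norm (hcoeffs h n) * r ^ n)" .
  qed
  obtain c where c: "\<And>z. z \<in> \<D> \<Longrightarrow> (\<lambda>n. z ^ n *\<^sub>C c n) sums g z"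
    "\<And>r. 0 \<le> r \<Longrightarrow> r < 1 \<Longrightarrow> summable (\<lambda>n. norm (c n) * r ^ n)"
    using weak_taylor[OF hol bdd] by metis
  have partial: "(\<Sum>n<M. (norm (c n))\<^sup>2) \<le> (\<Sum>n. (norm (hcoeffs h n))\<^sup>2)" for M
  proof (rule coefficients_sq_sum_le[OF c(2) summable_hcoeffs_power _ summable_hcoeffs])
    fix z :: complex assume z: "z \<in> \<D>"
    then show "norm (\<Sum>n. z ^ n *\<^sub>C c n) \<le> norm (\<Sum>n. z ^ n *\<^sub>C hcoeffs h n)"
      using sums_unique[OF c(1)[OF z]] schurD(4)[OF F z, of "hardy_eval h z"]
      by (simp add: g_def hardy_eval_def)
  qed
  then have "summable (\<lambda>n. (norm (c n))\<^sup>2)"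
    by (intro summableI_nonneg_bounded[where x = "\<Sum>n. (norm (hcoeffs h n))\<^sup>2"]) auto
  then have k: "hcoeffs (Abs_hardy c) = c" and s: "summable (\<lambda>n. (norm (c n))\<^sup>2)"
    by (simp_all add: Abs_hardy_inverse)
  show ?thesis
  proof (rule that[of "Abs_hardy c"])
    have "(norm (Abs_hardy c))\<^sup>2 \<le> (norm h)\<^sup>2"
      unfolding norm_hardy_eq k using partial by (intro suminf_le_const[OF s])
    then show "norm (Abs_hardy c) \<le> norm h" by (rule power2_le_imp_le) simp
    show "hardy_eval (Abs_hardy c) z = F z (hardy_eval h z)" if "z \<in> \<D>" for z
      unfolding hardy_eval_def[of "Abs_hardy c"] k using sums_unique[OF c(1)[OF that]] by (simp add: g_def)
  qed
qed

lemma mult_op_eqI: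
  fixes F :: "complex \<Rightarrow> 'a::complex_hilbert \<Rightarrow>\<^sub>L 'b::complex_hilbert"
  assumes T: "\<And>h z. z \<in> \<D> \<Longrightarrow> hardy_eval (blinfun_apply T h) z = F z (hardy_eval h z)"
  shows "mult_op F = T"
  unfolding mult_op_def
proof (rule the_equality)
  show "\<forall>h. \<forall>z\<in>\<D>. hardy_eval (blinfun_apply T h) z = F z (hardy_eval h z)" using T by blast
  show "S = T" if "\<forall>h. \<forall>z\<in>\<D>. hardy_eval (blinfun_apply S h) z = F z (hardy_eval h z)"
    for S :: "'a hardy \<Rightarrow>\<^sub>L 'b hardy"
    by (rule blinfun_eqI, rule hardy_eval_inject) (use that T in simp)
qed

lemma mult_op_schur:
  fixes F :: "complex \<Rightarrow> 'a::complex_hilbert \<Rightarrow>\<^sub>L 'b::complex_hilbert"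
  assumes F: "F \<in> schur"
  shows "mult_op F \<in> contractions"
    and "z \<in> \<D> \<Longrightarrow> hardy_eval (mult_op F h) z = F z (hardy_eval h z)"
proof -
  have "\<forall>h. \<exists>k. norm k \<le> norm h \<and> (\<forall>z\<in>\<D>. hardy_eval k z = F z (hardy_eval h z))"
    using schur_times_hardy[OF F] by metis
  then obtain t where t: "\<And>h. norm (t h) \<le> norm h"
    "\<And>h z. z \<in> \<D> \<Longrightarrow> hardy_eval (t h) z = F z (hardy_eval h z)"
    by metis
  have t_scaleC: "t (s *\<^sub>C h) = s *\<^sub>C t h" for s h
    by (rule hardy_eval_inject)
      (simp add: t(2) hardy_eval_scaleC is_clinear_scaleC[OF schurD(2)[OF F]])
  have "bounded_linear t"
  proof
    show "t (g + h) = t g + t h" for g h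
      by (rule hardy_eval_inject) (simp add: t(2) hardy_eval_add blinfun.add_right)
    show "t (s *\<^sub>R h) = s *\<^sub>R t h" for s h
      using t_scaleC[of "complex_of_real s"] by (simp add: scaleC_of_real)
    show "\<exists>K. \<forall>h. norm (t h) \<le> norm h * K"
      using t(1) by (intro exI[of _ 1]) simp
  qed
  then have T: "blinfun_apply (Blinfun t) h = t h" for h
    by (simp add: bounded_linear_Blinfun_apply)
  have eq: "mult_op F = Blinfun t"
    by (rule mult_op_eqI) (simp add: T t(2))
  show "mult_op F \<in> contractions"
    unfolding eq contractions_def is_clinear_iff_scaleC
    using t(1) by (auto simp: T t_scaleC intro!: norm_blinfun_bound)
  show "hardy_eval (mult_op F h) z = F z (hardy_eval h z)" if "z \<in> \<D>"
    using that by (simp add: eq T t(2))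
qed

text \<open>Test the operator against Szego kernels \<open>k w = x / (1 - w * cnj z)\<close>, which reproduce the
  evaluation at \<open>z\<close>.\<close>

lemma contraction_of_mult_contraction:
  fixes C :: "'a::complex_hilbert \<Rightarrow>\<^sub>L 'b::complex_hilbert" and T :: "'a hardy \<Rightarrow>\<^sub>L 'b hardy"
  assumes z: "z \<in> \<D>" and T: "\<And>h. hardy_eval (T h) z = C (hardy_eval h z)" and T1: "norm T \<le> 1"
  shows "norm C \<le> 1"
proof (rule norm_blinfun_bound)
  define q where "q = (cmod z)\<^sup>2"
  have q: "0 \<le> q" "q < 1" using z by (auto simp: q_def power_less_one_iff)
  have qn: "cmod z ^ n * cmod z ^ n = q ^ n" for n
    by (simp add: q_def power2_eq_square power_mult_distrib)
  have geo: "(\<lambda>n. q ^ n) sums (1 / (1 - q))" using q by (intro geometric_sums) simp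
  have ksq: "(\<lambda>n. (norm (cnj z ^ n *\<^sub>C x))\<^sup>2) sums ((norm x)\<^sup>2 / (1 - q))" for x :: "'c::complex_hilbert"
    using sums_mult[OF geo, of "(norm x)\<^sup>2"]
    by (simp add: norm_scaleC norm_power power_mult_distrib power2_eq_square[of "_ ^ _"] qn mult.commute)
  have kc: "hcoeffs (Abs_hardy (\<lambda>n. cnj z ^ n *\<^sub>C x)) = (\<lambda>n. cnj z ^ n *\<^sub>C x)" for x :: "'c::complex_hilbert"
    using ksq[of x] by (simp add: Abs_hardy_inverse sums_iff)
  have kn: "(norm (Abs_hardy (\<lambda>n. cnj z ^ n *\<^sub>C x)))\<^sup>2 = (norm x)\<^sup>2 / (1 - q)" for x :: "'c::complex_hilbert"
    unfolding norm_hardy_eq kc using ksq[of x] by (simp add: sums_iff)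
  have keval: "hardy_eval (Abs_hardy (\<lambda>n. cnj z ^ n *\<^sub>C x)) z = (1 / (1 - q)) *\<^sub>R x" for x :: "'c::complex_hilbert"
  proof -
    have "complex_of_real q = z * cnj z"
      unfolding q_def by (rule complex_norm_square)
    then have "z ^ n *\<^sub>C cnj z ^ n *\<^sub>C x = q ^ n *\<^sub>R x" for n
      unfolding scaleC_scaleC scaleC_of_real[symmetric] by (simp add: power_mult_distrib)
    then show ?thesis
      unfolding hardy_eval_def kc
      using sums_unique[OF bounded_linear.sums[OF bounded_linear_scaleR_left geo, of x]] by simp
  qed
  have repr: "h \<bullet> Abs_hardy (\<lambda>n. cnj z ^ n *\<^sub>C y) = hardy_eval h z \<bullet> y" for h and y :: "'c::complex_hilbert"
  proof -
    have "(\<lambda>n. (z ^ n *\<^sub>C hcoeffs h n) \<bullet> y) sums (hardy_eval h z \<bullet> y)"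
      unfolding hardy_eval_def
      by (rule bounded_linear.sums[OF bounded_linear_inner_left summable_sums[OF summable_hardy_eval[OF z]]])
    then show ?thesis
      by (simp add: inner_hardy_def kc inner_scaleC_left sums_iff)
  qed
  fix x
  define y where "y = C x"
  define kx where "kx = Abs_hardy (\<lambda>n. cnj z ^ n *\<^sub>C x)"
  define ky where "ky = Abs_hardy (\<lambda>n. cnj z ^ n *\<^sub>C y)"
  \<comment> \<open>At \<open>z\<close> the kernel of \<open>x\<close> takes the value
    \<open>x / (1 - q)\<close>, and its squared norm is that of \<open>x\<close> divided by
    \<open>1 - q\<close>; so \<open>1 / (1 - q)\<close> occurs on both sides and cancels.\<close>
  have "(1 / (1 - q)) * (norm y)\<^sup>2 = T kx \<bullet> ky"
    by (simp add: kx_def ky_def repr T keval y_def blinfun.scaleR_right power2_norm_eq_inner)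
  also have "\<dots> \<le> norm (T kx) * norm ky" by (rule norm_cauchy_schwarz)
  also have "\<dots> \<le> norm kx * norm ky"
    using norm_blinfun[of T kx] mult_right_mono[OF T1, of "norm kx"] by (intro mult_right_mono) auto
  also have "\<dots> = (1 / (1 - q)) * (norm x * norm y)"
  proof (rule power2_eq_imp_eq)
    show "(norm kx * norm ky)\<^sup>2 = ((1 / (1 - q)) * (norm x * norm y))\<^sup>2"
      unfolding power_mult_distrib kx_def ky_def kn by (simp add: power2_eq_square)
  qed (use q in auto)
  finally have "(norm y)\<^sup>2 \<le> norm x * norm y"
    using q by (simp add: divide_le_cancel)
  then show "norm (C x) \<le> 1 * norm x"
    by (cases "norm y = 0") (simp_all add: power2_eq_square y_def)
qed simp

section \<open>Pairs of Schur class functions\<close>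

text \<open>A crude radius for mere existence, with \<rho> serving as both bounds: the terms are 1/2
  and at most 1/8. The exact root is used only for the quantitative estimates.\<close>

lemma perturbation_radius_le:
  fixes \<rho> :: real
  assumes "1 \<le> \<rho>"
  shows "2 * \<rho> * (1 / (4 * \<rho>)) + (2 * \<rho> - 1) * (1 / (4 * \<rho>))\<^sup>2 \<le> 1"
proof -
  have "(2 * \<rho> - 1) * (1 / (4 * \<rho>))\<^sup>2 \<le> 2 * \<rho> * (1 / (4 * \<rho>))\<^sup>2"
    by (intro mult_right_mono) auto
  also have "\<dots> = 1 / (8 * \<rho>)" using assms by (simp add: power2_eq_square)
  also have "\<dots> \<le> 1 / 8" using assms by simp
  finally show ?thesis using assms by simp
qed

lemma bounded_linear_scaleC_blinfun:
  "bounded_linear (\<lambda>A :: 'a::real_normed_vector \<Rightarrow>\<^sub>L 'b::complex_inner. c *\<^sub>C A)"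
proof -
  have "c *\<^sub>C A = (c *\<^sub>C id_blinfun) o\<^sub>L A" for A :: "'a \<Rightarrow>\<^sub>L 'b"
    by (rule blinfun_eqI) (simp add: scaleC_blinfun.rep_eq)
  then show ?thesis
    using bounded_bilinear.bounded_linear_right[OF bounded_bilinear_blinfun_compose] by simp
qed

text \<open>Analyticity and complex linearity hold for every \<epsilon>; only the norm bound carries
  information.\<close>

lemma schur_affine_combination:
  fixes F G :: "complex \<Rightarrow> 'a::complex_hilbert \<Rightarrow>\<^sub>L 'b::complex_hilbert"
  assumes F: "F \<in> schur" and G: "G \<in> schur"
    and le: "\<And>z. z \<in> \<D> \<Longrightarrow> norm ((1 - \<epsilon>) *\<^sub>C G z + \<epsilon> *\<^sub>C F z) \<le> 1"
  shows "(\<lambda>z. (1 - \<epsilon>) *\<^sub>C G z + \<epsilon> *\<^sub>C F z) \<in> schur"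
  unfolding schur_def
proof (intro CollectI conjI)
  show "analytic_on_disc (\<lambda>z. (1 - \<epsilon>) *\<^sub>C G z + \<epsilon> *\<^sub>C F z)"
    unfolding analytic_on_disc_def
  proof
    fix z :: complex assume z: "z \<in> \<D>"
    have "\<exists>F'. (F has_derivative (\<lambda>h. h *\<^sub>C F')) (at z)" "\<exists>G'. (G has_derivative (\<lambda>h. h *\<^sub>C G')) (at z)"
      using F G z by (simp_all add: schur_def analytic_on_disc_def)
    then obtain F' G' where F': "(F has_derivative (\<lambda>h. h *\<^sub>C F')) (at z)"
      and G': "(G has_derivative (\<lambda>h. h *\<^sub>C G')) (at z)"
      by blast
    have "(\<lambda>h. (1 - \<epsilon>) *\<^sub>C h *\<^sub>C G' + \<epsilon> *\<^sub>C h *\<^sub>C F') = (\<lambda>h. h *\<^sub>C ((1 - \<epsilon>) *\<^sub>C G' + \<epsilon> *\<^sub>C F'))"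
      by (simp add: scaleC_add_right scaleC_scaleC mult.commute)
    then have "((\<lambda>z. (1 - \<epsilon>) *\<^sub>C G z + \<epsilon> *\<^sub>C F z) has_derivative
        (\<lambda>h. h *\<^sub>C ((1 - \<epsilon>) *\<^sub>C G' + \<epsilon> *\<^sub>C F'))) (at z)"
      using has_derivative_add[OF bounded_linear.has_derivative[OF bounded_linear_scaleC_blinfun G']
          bounded_linear.has_derivative[OF bounded_linear_scaleC_blinfun F'], of "1 - \<epsilon>" \<epsilon>]
      by (simp only:)
    then show "\<exists>H. ((\<lambda>z. (1 - \<epsilon>) *\<^sub>C G z + \<epsilon> *\<^sub>C F z) has_derivative (\<lambda>h. h *\<^sub>C H)) (at z)"
      by blast
  qed
  have "is_clinear (blinfun_apply ((1 - \<epsilon>) *\<^sub>C G z + \<epsilon> *\<^sub>C F z))" if "z \<in> \<D>" for z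
    using schurD(2)[OF F that] schurD(2)[OF G that]
    by (simp add: is_clinear_iff_scaleC blinfun.add_left scaleC_blinfun.rep_eq scaleC_add_right
        scaleC_scaleC mult.commute)
  then show "(\<lambda>z. (1 - \<epsilon>) *\<^sub>C G z + \<epsilon> *\<^sub>C F z) ` \<D> \<subseteq> contractions"
    using le by (auto simp: contractions_def)
qed

lemma hardy_eval_affine_combination:
  fixes F G :: "complex \<Rightarrow> 'a::complex_hilbert \<Rightarrow>\<^sub>L 'b::complex_hilbert"
  assumes F: "F \<in> schur" and G: "G \<in> schur" and z: "z \<in> \<D>"
  shows "hardy_eval (((1 - \<epsilon>) *\<^sub>C mult_op G + \<epsilon> *\<^sub>C mult_op F) h) z
    = ((1 - \<epsilon>) *\<^sub>C G z + \<epsilon> *\<^sub>C F z) (hardy_eval h z)"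
  by (simp add: blinfun.add_left scaleC_blinfun.rep_eq hardy_eval_add[OF z] hardy_eval_scaleC[OF z]
      mult_op_schur(2)[OF F z] mult_op_schur(2)[OF G z])

text \<open>The perturbation estimate is carried out on the Hardy spaces and brought down to each
  point of the disc by the Szego kernels.\<close>

lemma SCPO_iii_of_prec_inf:
  fixes F G :: "complex \<Rightarrow> 'a::complex_hilbert \<Rightarrow>\<^sub>L 'b::complex_hilbert"
  assumes F: "F \<in> schur" and G: "G \<in> schur" and prec: "F \<prec>\<^sub>\<infinity> G"
  shows "\<exists>r. SCPO_iii F G r"
proof -
  note TF = mult_op_schur(1)[OF F] and TG = mult_op_schur(1)[OF G]
  obtain X where "mult_op F - mult_op G = defect (adj (mult_op G)) o\<^sub>L X o\<^sub>L defect (mult_op G)"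
    using prec unfolding prec_inf_def prec_def by blast
  from factor_id_of_factor_difference[OF TF TG this]
  obtain Y where Y: "Y \<in> ops_between (defect_space (mult_op G)) (defect_space (mult_op G))"
    "id_blinfun - (adj (mult_op F) o\<^sub>L mult_op G) = defect (mult_op G) o\<^sub>L Y o\<^sub>L defect (mult_op G)"
    by metis
  interpret factored_id "mult_op F" "mult_op G" Y
    by unfold_locales (rule TF TG Y)+
  \<comment> \<open>The lower bound 1 is what \<open>perturbation_radius_le\<close>
    requires.\<close>
  define \<rho> where "\<rho> = max 1 (norm Y)"
  have \<rho>: "1 \<le> \<rho>" "norm Y \<le> \<rho>" by (simp_all add: \<rho>_def)
  have "SCPO_iii F G (1 / (4 * \<rho>))"
    unfolding SCPO_iii_def
  proof (intro conjI allI impI)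
    fix \<epsilon> assume \<epsilon>: "cmod \<epsilon> \<le> 1 / (4 * \<rho>)"
    have "norm ((1 - \<epsilon>) *\<^sub>C mult_op G + \<epsilon> *\<^sub>C mult_op F) \<le> 1"
    proof (rule perturbation_contraction[OF \<rho>(2) _ _ perturbation_radius_le[OF \<rho>(1)] \<epsilon>])
      show "Y (defect (mult_op G) x) \<bullet> defect (mult_op G) x \<le> \<rho> * (norm (defect (mult_op G) x))\<^sup>2" for x
        by (rule order_trans[OF factor_inner_le mult_right_mono[OF \<rho>(2)]]) simp
    qed (use \<rho> in simp)
    then show "(\<lambda>z. (1 - \<epsilon>) *\<^sub>C G z + \<epsilon> *\<^sub>C F z) \<in> schur"
      by (intro schur_affine_combination[OF F G]
          contraction_of_mult_contraction[OF _ hardy_eval_affine_combination[OF F G]]) auto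
  qed (use \<rho> in simp)
  then show ?thesis by blast
qed

text \<open>The multiplication operator of an affine combination is the affine combination of the
  multiplication operators, so the perturbations are contractions on the Hardy spaces and the
  criterion for a single pair applies.\<close>

lemma prec_inf_of_SCPO_iii:
  fixes F G :: "complex \<Rightarrow> 'a::complex_hilbert \<Rightarrow>\<^sub>L 'b::complex_hilbert"
  assumes F: "F \<in> schur" and G: "G \<in> schur" and iii: "SCPO_iii F G r"
  shows "F \<prec>\<^sub>\<infinity> G"
proof -
  note TF = mult_op_schur(1)[OF F] and TG = mult_op_schur(1)[OF G]
  have r: "0 < r" using iii by (simp add: SCPO_iii_def)
  have "norm ((1 - \<epsilon>) *\<^sub>C mult_op G + \<epsilon> *\<^sub>C mult_op F) \<le> 1" if "cmod \<epsilon> = r" for \<epsilon>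
  proof -
    have "(\<lambda>z. (1 - \<epsilon>) *\<^sub>C G z + \<epsilon> *\<^sub>C F z) \<in> schur"
      using iii that by (simp add: SCPO_iii_def)
    then have "mult_op (\<lambda>z. (1 - \<epsilon>) *\<^sub>C G z + \<epsilon> *\<^sub>C F z) \<in> contractions"
      by (rule mult_op_schur(1))
    moreover have "mult_op (\<lambda>z. (1 - \<epsilon>) *\<^sub>C G z + \<epsilon> *\<^sub>C F z) = (1 - \<epsilon>) *\<^sub>C mult_op G + \<epsilon> *\<^sub>C mult_op F"
      by (rule mult_op_eqI) (rule hardy_eval_affine_combination[OF F G])
    ultimately show ?thesis by (simp add: contractions_def)
  qed
  from factor_id_of_perturbation[OF TF TG r this]
  obtain Y where Y: "Y \<in> ops_between (defect_space (mult_op G)) (defect_space (mult_op G))"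
    "id_blinfun - (adj (mult_op F) o\<^sub>L mult_op G) = defect (mult_op G) o\<^sub>L Y o\<^sub>L defect (mult_op G)"
    by metis
  interpret factored_id "mult_op F" "mult_op G" Y
    by unfold_locales (rule TF TG Y)+
  \<comment> \<open>Adding 1 to \<open>norm Y\<close> guarantees \<open>1 \<le> 2 * \<tau>\<close>
    even if the defect space is trivial.\<close>
  have "Y (defect (mult_op G) x) \<bullet> defect (mult_op G) x \<le> (norm Y + 1) * (norm (defect (mult_op G) x))\<^sup>2" for x
    by (rule order_trans[OF factor_inner_le mult_right_mono]) auto
  moreover have "1 \<le> 2 * (norm Y + 1)" by (rule order_trans[of _ "2 * 1"]) auto
  ultimately show ?thesis
    using factor_difference[of "norm Y + 1"] unfolding prec_inf_def prec_def by metis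
qed

section \<open>Equivalence of the pointwise conditions\<close>

lemma bounded_imageI_norm_le:
  assumes "\<And>z. z \<in> A \<Longrightarrow> norm (f z) \<le> b"
  shows "bounded (f ` A)"
  using assms by (auto simp: bounded_iff)

text \<open>Only boundedness in the point is demanded, so the factors can be chosen point by point;
  by \<open>schur_defect_eq\<close> they all act on the same defect space.\<close>

lemma SCPO_ii_of_i:
  fixes F G :: "complex \<Rightarrow> 'a::complex_hilbert \<Rightarrow>\<^sub>L 'b::complex_hilbert"
  assumes F: "F \<in> schur" and G: "G \<in> schur" and i: "SCPO_i F G Q"
  obtains R where "SCPO_ii F G R" "\<And>z. z \<in> \<D> \<Longrightarrow> norm (R z) \<le> 1 + norm (Q z)"
proof -
  have "\<forall>z\<in>\<D>. \<exists>Y. Y \<in> ops_between (schur_defect G) (schur_defect G) \<and>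
    id_blinfun - (adj (F z) o\<^sub>L G z) = defect (G z) o\<^sub>L Y o\<^sub>L defect (G z) \<and> norm Y \<le> 1 + norm (Q z)"
  proof
    fix z :: complex assume z: "z \<in> \<D>"
    then have "F z - G z = defect (adj (G z)) o\<^sub>L Q z o\<^sub>L defect (G z)"
      using i by (simp add: SCPO_i_def)
    from factor_id_of_factor_difference[OF schurD(1)[OF F z] schurD(1)[OF G z] this]
    show "\<exists>Y. Y \<in> ops_between (schur_defect G) (schur_defect G) \<and>
      id_blinfun - (adj (F z) o\<^sub>L G z) = defect (G z) o\<^sub>L Y o\<^sub>L defect (G z) \<and> norm Y \<le> 1 + norm (Q z)"
      unfolding schur_defect_eq(1)[OF G z] by metis
  qed
  then obtain R where R: "\<forall>z\<in>\<D>. R z \<in> ops_between (schur_defect G) (schur_defect G) \<and>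
    id_blinfun - (adj (F z) o\<^sub>L G z) = defect (G z) o\<^sub>L R z o\<^sub>L defect (G z) \<and> norm (R z) \<le> 1 + norm (Q z)"
    by (rule bchoice[THEN exE])
  obtain b where b: "\<And>z. z \<in> \<D> \<Longrightarrow> norm (Q z) \<le> b"
    using i unfolding SCPO_i_def bounded_iff by blast
  have "bounded (R ` \<D>)"
    by (rule bounded_imageI_norm_le[where b = "1 + b"]) (use R b in force)
  then show ?thesis
    using that R unfolding SCPO_ii_def by blast
qed

lemma factored_id_of_SCPO_ii:
  fixes F G :: "complex \<Rightarrow> 'a::complex_hilbert \<Rightarrow>\<^sub>L 'b::complex_hilbert"
  assumes F: "F \<in> schur" and G: "G \<in> schur" and ii: "SCPO_ii F G R" and z: "z \<in> \<D>"
  shows "factored_id (F z) (G z) (R z)"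
proof
  show "R z \<in> ops_between (defect_space (G z)) (defect_space (G z))"
    using ii z unfolding SCPO_ii_def schur_defect_eq(1)[OF G z, symmetric] by blast
qed (use ii z in \<open>auto simp: SCPO_ii_def intro: schurD(1)[OF F] schurD(1)[OF G]\<close>)

text \<open>Lets a norm bound obtained for some \<open>R'\<close> be transferred to a given
  \<open>R\<close>.\<close>

lemma SCPO_ii_unique:
  fixes F G :: "complex \<Rightarrow> 'a::complex_hilbert \<Rightarrow>\<^sub>L 'b::complex_hilbert"
  assumes F: "F \<in> schur" and G: "G \<in> schur"
    and R: "SCPO_ii F G R" and R': "SCPO_ii F G R'" and z: "z \<in> \<D>"
  shows "R z = R' z"
proof -
  interpret R: factored_id "F z" "G z" "R z" by (rule factored_id_of_SCPO_ii[OF F G R z])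
  interpret R': factored_id "F z" "G z" "R' z" by (rule factored_id_of_SCPO_ii[OF F G R' z])
  show ?thesis
    by (rule two_sided_factor_unique[OF is_clinear_defect[OF R.B] defect_symmetric[OF R.B]
          R.Y[unfolded defect_space_def] R'.Y[unfolded defect_space_def]])
      (simp add: R.eq[symmetric] R'.eq[symmetric])
qed

lemma SCPO_i_of_ii:
  fixes F G :: "complex \<Rightarrow> 'a::complex_hilbert \<Rightarrow>\<^sub>L 'b::complex_hilbert"
  assumes F: "F \<in> schur" and G: "G \<in> schur" and ii: "SCPO_ii F G R"
    and \<rho>: "\<And>z. z \<in> \<D> \<Longrightarrow> norm (R z) \<le> \<rho>"
    and \<tau>: "\<And>z d. z \<in> \<D> \<Longrightarrow> R z d \<bullet> d \<le> \<tau> * (norm d)\<^sup>2" and \<tau>1: "1 \<le> 2 * \<tau>"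
  obtains Q where "SCPO_i F G Q" "\<And>z. z \<in> \<D> \<Longrightarrow> norm (Q z) \<le> \<rho> + sqrt (2 * \<tau> - 1)"
proof -
  let ?b = "\<rho> + sqrt (2 * \<tau> - 1)"
  have "\<forall>z\<in>\<D>. \<exists>X. X \<in> ops_between (schur_defect G) (schur_codefect G) \<and>
    F z - G z = defect (adj (G z)) o\<^sub>L X o\<^sub>L defect (G z) \<and> norm X \<le> ?b"
  proof
    fix z :: complex assume z: "z \<in> \<D>"
    interpret factored_id "F z" "G z" "R z" by (rule factored_id_of_SCPO_ii[OF F G ii z])
    obtain X where "X \<in> ops_between (defect_space (G z)) (defect_space (adj (G z)))"
      "F z - G z = defect (adj (G z)) o\<^sub>L X o\<^sub>L defect (G z)" "norm X \<le> norm (R z) + sqrt (2 * \<tau> - 1)"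
      using factor_difference[OF \<tau>[OF z] \<tau>1] by metis
    then show "\<exists>X. X \<in> ops_between (schur_defect G) (schur_codefect G) \<and>
      F z - G z = defect (adj (G z)) o\<^sub>L X o\<^sub>L defect (G z) \<and> norm X \<le> ?b"
      using \<rho>[OF z] unfolding schur_defect_eq[OF G z] by force
  qed
  then obtain Q where Q: "\<forall>z\<in>\<D>. Q z \<in> ops_between (schur_defect G) (schur_codefect G) \<and>
    F z - G z = defect (adj (G z)) o\<^sub>L Q z o\<^sub>L defect (G z) \<and> norm (Q z) \<le> ?b"
    by (rule bchoice[THEN exE])
  have "bounded (Q ` \<D>)"
    by (rule bounded_imageI_norm_le[where b = ?b]) (use Q in blast)
  then show ?thesis
    using that Q unfolding SCPO_i_def by blast
qed

lemma SCPO_iii_of_ii: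
  fixes F G :: "complex \<Rightarrow> 'a::complex_hilbert \<Rightarrow>\<^sub>L 'b::complex_hilbert"
  assumes F: "F \<in> schur" and G: "G \<in> schur" and ii: "SCPO_ii F G R"
    and \<rho>: "\<And>z. z \<in> \<D> \<Longrightarrow> norm (R z) \<le> \<rho>"
    and \<tau>: "\<And>z d. z \<in> \<D> \<Longrightarrow> R z d \<bullet> d \<le> \<tau> * (norm d)\<^sup>2"
    and r: "0 < r" "2 * \<rho> * r + (2 * \<tau> - 1) * r\<^sup>2 \<le> 1"
  shows "SCPO_iii F G r"
  unfolding SCPO_iii_def
proof (intro conjI allI impI)
  fix \<epsilon> assume \<epsilon>: "cmod \<epsilon> \<le> r"
  show "(\<lambda>z. (1 - \<epsilon>) *\<^sub>C G z + \<epsilon> *\<^sub>C F z) \<in> schur"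
  proof (rule schur_affine_combination[OF F G])
    fix z :: complex assume z: "z \<in> \<D>"
    interpret factored_id "F z" "G z" "R z" by (rule factored_id_of_SCPO_ii[OF F G ii z])
    show "norm ((1 - \<epsilon>) *\<^sub>C G z + \<epsilon> *\<^sub>C F z) \<le> 1"
      by (rule perturbation_contraction[OF \<rho>[OF z] _ \<tau>[OF z] r(2) \<epsilon>]) (use r in simp)
  qed
qed (rule r)

lemma SCPO_ii_of_iv:
  fixes F G :: "complex \<Rightarrow> 'a::complex_hilbert \<Rightarrow>\<^sub>L 'b::complex_hilbert"
  assumes F: "F \<in> schur" and G: "G \<in> schur" and iv: "SCPO_iv F G r"
  obtains R where "SCPO_ii F G R"
proof -
  have r: "0 < r" using iv by (simp add: SCPO_iv_def)
  have "\<forall>z\<in>\<D>. \<exists>Y. Y \<in> ops_between (schur_defect G) (schur_defect G) \<and>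
    id_blinfun - (adj (F z) o\<^sub>L G z) = defect (G z) o\<^sub>L Y o\<^sub>L defect (G z) \<and> norm Y \<le> 1 + 1 / r"
  proof
    fix z :: complex assume z: "z \<in> \<D>"
    have "norm ((1 - \<epsilon>) *\<^sub>C G z + \<epsilon> *\<^sub>C F z) \<le> 1" if "cmod \<epsilon> = r" for \<epsilon>
      using iv that z schurD(3)[of "\<lambda>z. (1 - \<epsilon>) *\<^sub>C G z + \<epsilon> *\<^sub>C F z" z] by (simp add: SCPO_iv_def)
    from factor_id_of_perturbation[OF schurD(1)[OF F z] schurD(1)[OF G z] r this]
    show "\<exists>Y. Y \<in> ops_between (schur_defect G) (schur_defect G) \<and>
      id_blinfun - (adj (F z) o\<^sub>L G z) = defect (G z) o\<^sub>L Y o\<^sub>L defect (G z) \<and> norm Y \<le> 1 + 1 / r"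
      unfolding schur_defect_eq(1)[OF G z] by metis
  qed
  then obtain R where R: "\<forall>z\<in>\<D>. R z \<in> ops_between (schur_defect G) (schur_defect G) \<and>
    id_blinfun - (adj (F z) o\<^sub>L G z) = defect (G z) o\<^sub>L R z o\<^sub>L defect (G z) \<and> norm (R z) \<le> 1 + 1 / r"
    by (rule bchoice[THEN exE])
  have "bounded (R ` \<D>)"
    by (rule bounded_imageI_norm_le[where b = "1 + 1 / r"]) (use R in blast)
  then show ?thesis
    using that R unfolding SCPO_ii_def by blast
qed

section \<open>Suprema and the quantitative estimates\<close>

lemma norm_le_sup_norm:
  assumes "bounded (Q ` \<D>)" "z \<in> \<D>"
  shows "norm (Q z) \<le> sup_norm Q"
proof -
  obtain b where "\<And>z. z \<in> \<D> \<Longrightarrow> norm (Q z) \<le> b"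
    using assms(1) unfolding bounded_iff by blast
  then have "bdd_above ((\<lambda>z. norm (Q z)) ` \<D>)" by (intro bdd_aboveI2)
  then show ?thesis unfolding sup_norm_def using assms(2) by (intro cSUP_upper)
qed

lemma sup_norm_le:
  assumes "\<And>z. z \<in> \<D> \<Longrightarrow> norm (Q z) \<le> b"
  shows "sup_norm Q \<le> b"
  unfolding sup_norm_def using assms by (intro cSUP_least) auto

lemma SCPO_ii_inner_le:
  assumes ii: "SCPO_ii F G R" and z: "z \<in> \<D>"
  shows "R z d \<bullet> d \<le> sup_norm (\<lambda>z. Re_op (R z)) * (norm d)\<^sup>2"
    and "norm (R z) \<le> sup_norm R"
proof -
  have bdd: "bounded (R ` \<D>)" using ii by (simp add: SCPO_ii_def)
  note R = norm_le_sup_norm[OF bdd]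
  show "norm (R z) \<le> sup_norm R" using z by (rule R)
  have c: "is_clinear (blinfun_apply (R z))" if "z \<in> \<D>" for z
  proof -
    have "R z \<in> ops_between (schur_defect G) (schur_defect G)"
      using ii that unfolding SCPO_ii_def by blast
    then show ?thesis by (simp add: ops_between_def)
  qed
  have "bounded ((\<lambda>z. Re_op (R z)) ` \<D>)"
    by (rule bounded_imageI_norm_le[where b = "sup_norm R"]) (rule order_trans[OF norm_Re_op_le[OF c] R])
  then have "norm (Re_op (R z)) \<le> sup_norm (\<lambda>z. Re_op (R z))"
    using z by (rule norm_le_sup_norm)
  then show "R z d \<bullet> d \<le> sup_norm (\<lambda>z. Re_op (R z)) * (norm d)\<^sup>2"
    by (intro order_trans[OF inner_le_norm_Re_op[OF c[OF z]] mult_right_mono]) auto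
qed

text \<open>Evaluated at one nonzero defect vector, the lower bound 1/2 for the real part of
  \<open>R 0\<close> makes the radicand \<open>2 * \<tau> - 1\<close> nonnegative.\<close>

lemma sup_norm_Re_ge_half:
  fixes F G :: "complex \<Rightarrow> 'a::complex_hilbert \<Rightarrow>\<^sub>L 'b::complex_hilbert"
  assumes F: "F \<in> schur" and G: "G \<in> schur" and ii: "SCPO_ii F G R" and ne: "schur_defect G \<noteq> {0}"
  shows "1 \<le> 2 * sup_norm (\<lambda>z. Re_op (R z))" "1 \<le> 2 * sup_norm R"
proof -
  have 0: "0 \<in> \<D>" by simp
  interpret factored_id "F 0" "G 0" "R 0" by (rule factored_id_of_SCPO_ii[OF F G ii 0])
  obtain x where x: "defect (G 0) x \<noteq> 0"
  proof (rule ccontr)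
    assume "\<not> thesis"
    then have "\<And>x. defect (G 0) x = 0" using that by blast
    then have "range (defect (G 0)) = {0}" by auto
    then show False using ne by (simp add: schur_defect_def defect_space_def)
  qed
  let ?d = "defect (G 0) x"
  have d: "0 < (norm ?d)\<^sup>2" using x by simp
  have *: "1 \<le> 2 * b" if "R 0 ?d \<bullet> ?d \<le> b * (norm ?d)\<^sup>2" for b
  proof -
    have "1 * (norm ?d)\<^sup>2 \<le> (2 * b) * (norm ?d)\<^sup>2"
      using half_le_Re[of x] that by simp
    then show ?thesis using d by (rule mult_right_le_imp_le)
  qed
  show "1 \<le> 2 * sup_norm (\<lambda>z. Re_op (R z))" by (rule * [OF SCPO_ii_inner_le(1)[OF ii 0]])
  show "1 \<le> 2 * sup_norm R"
    by (rule * [OF order_trans[OF factor_inner_le mult_right_mono[OF SCPO_ii_inner_le(2)[OF ii 0]]]]) simp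
qed

lemma ops_between_trivial:
  assumes "X \<in> ops_between {0} N"
  shows "X = 0"
  by (rule blinfun_eqI) (use assms in \<open>simp add: ops_between_def cinner_eq_inner complex_eq_iff\<close>)

text \<open>Degenerate case: every vector is orthogonal to \<open>{0}\<close>, so the factor
  vanishes everywhere.\<close>

lemma SCPO_trivial_defect:
  fixes F G :: "complex \<Rightarrow> 'a::complex_hilbert \<Rightarrow>\<^sub>L 'b::complex_hilbert"
  assumes G: "G \<in> schur" and triv: "schur_defect G = {0}" and i: "SCPO_i F G Q" and z: "z \<in> \<D>"
  shows "Q z = 0" "F z = G z"
proof -
  have "Q z \<in> ops_between {0} (schur_codefect G)" using i z triv by (auto simp: SCPO_i_def)
  then show "Q z = 0" by (rule ops_between_trivial)
  moreover have "F z - G z = defect (adj (G z)) o\<^sub>L Q z o\<^sub>L defect (G z)"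
    using i z unfolding SCPO_i_def by blast
  ultimately show "F z = G z" by simp
qed

text \<open>With \<open>t = \<rho> + s\<close>, the positive root of
  \<open>t\<^sup>2 = 2 * \<rho> * t + (2 * \<tau> - 1)\<close>, the radius \<open>r = 1 / t\<close>
  meets the perturbation estimate with equality. As \<open>s\<close> is at least
  \<open>sqrt (2 * \<tau> - 1)\<close>, both \<rho> and the bound for \<open>Q\<close> are at most
  \<open>t\<close>.\<close>

lemma SCPO_bounds:
  fixes F G :: "complex \<Rightarrow> 'a::complex_hilbert \<Rightarrow>\<^sub>L 'b::complex_hilbert"
  assumes F: "F \<in> schur" and G: "G \<in> schur" and ii: "SCPO_ii F G R" and ne: "schur_defect G \<noteq> {0}"
  defines "\<rho> \<equiv> sup_norm R" and "\<tau> \<equiv> sup_norm (\<lambda>z. Re_op (R z))"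
  defines "r \<equiv> inverse (\<rho> + sqrt (\<rho>\<^sup>2 + 2 * \<tau> - 1))"
  obtains Q where "SCPO_i F G Q" "SCPO_iii F G r" "sup_norm Q \<le> \<rho> + sqrt (2 * \<tau> - 1)"
    "\<rho> \<le> 1 + sup_norm Q" "sup_norm Q \<le> (2 + 2 * sqrt r + r) / (2 * r)" "\<rho> \<le> (2 + r) / (2 * r)"
proof -
  have \<tau>1: "1 \<le> 2 * \<tau>" and \<rho>1: "1 \<le> 2 * \<rho>"
    using sup_norm_Re_ge_half[OF F G ii ne] by (simp_all add: \<rho>_def \<tau>_def)
  have R: "norm (R z) \<le> \<rho>" "R z d \<bullet> d \<le> \<tau> * (norm d)\<^sup>2" if "z \<in> \<D>" for z d
    using SCPO_ii_inner_le[OF ii that] by (simp_all add: \<rho>_def \<tau>_def)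
  obtain Q where Q: "SCPO_i F G Q" "\<And>z. z \<in> \<D> \<Longrightarrow> norm (Q z) \<le> \<rho> + sqrt (2 * \<tau> - 1)"
    using SCPO_i_of_ii[OF F G ii R \<tau>1] by metis
  have Qs: "sup_norm Q \<le> \<rho> + sqrt (2 * \<tau> - 1)" using Q(2) by (rule sup_norm_le)
  \<comment> \<open>The estimate holds for the \<open>R'\<close> constructed from \<open>Q\<close>,
    which equals \<open>R\<close> on the disc by uniqueness.\<close>
  have "\<rho> \<le> 1 + sup_norm Q"
    unfolding \<rho>_def
  proof (rule sup_norm_le)
    fix z :: complex assume z: "z \<in> \<D>"
    obtain R' where R': "SCPO_ii F G R'" "\<And>z. z \<in> \<D> \<Longrightarrow> norm (R' z) \<le> 1 + norm (Q z)"
      using SCPO_ii_of_i[OF F G Q(1)] by metis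
    have "norm (Q z) \<le> sup_norm Q"
      using Q(1) z by (intro norm_le_sup_norm) (auto simp: SCPO_i_def)
    then show "norm (R z) \<le> 1 + sup_norm Q"
      using R'(2)[OF z] by (simp add: SCPO_ii_unique[OF F G ii R'(1) z])
  qed
  define s where "s = sqrt (\<rho>\<^sup>2 + 2 * \<tau> - 1)"
  have s2: "s\<^sup>2 = \<rho>\<^sup>2 + 2 * \<tau> - 1" and s0: "0 \<le> s"
    using \<tau>1 add_nonneg_nonneg[OF zero_le_power2[of \<rho>], of "2 * \<tau> - 1"]
    by (simp_all add: s_def add_diff_eq)
  have s_ge: "sqrt (2 * \<tau> - 1) \<le> s" unfolding s_def by (intro real_sqrt_le_mono) simp
  define t where "t = \<rho> + s"
  have t0: "0 < t" using \<rho>1 s0 by (simp add: t_def)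
  have r: "r = 1 / t" by (simp add: r_def t_def s_def inverse_eq_divide)
  have r0: "0 < r" using t0 by (simp add: r)
  have "2 * \<rho> * t + (2 * \<tau> - 1) = t\<^sup>2"
    using s2 by (simp add: t_def power2_eq_square algebra_simps)
  then have "2 * \<rho> * r + (2 * \<tau> - 1) * r\<^sup>2 = 1"
    using t0 by (simp add: r field_simps power2_eq_square)
  then have iii: "SCPO_iii F G r"
    using r0 R by (intro SCPO_iii_of_ii[OF F G ii]) auto
  \<comment> \<open>In terms of \<open>t\<close> the right-hand sides are \<open>t + 1/2\<close> and
    \<open>t + sqrt t + 1/2\<close>.\<close>
  have "t \<le> (2 + r) / (2 * r)" "t \<le> (2 + 2 * sqrt r + r) / (2 * r)"
    using r0 t0 by (simp_all add: pos_le_divide_eq) (simp_all add: r)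
  then show ?thesis
    using that[OF Q(1) iii Qs \<open>\<rho> \<le> 1 + sup_norm Q\<close>] Qs s_ge s0 by (simp add: t_def)
qed

theorem theorem2p6:
  fixes F G :: "complex \<Rightarrow> 'u::complex_hilbert \<Rightarrow>\<^sub>L 'y::complex_hilbert"
  assumes "separable_space (euclidean :: 'u topology)"
    and "separable_space (euclidean :: 'y topology)"
    and "F \<in> schur" and "G \<in> schur"
  shows "(F \<prec>\<^sub>\<infinity> G \<longleftrightarrow> (\<exists>Q. SCPO_i F G Q))
    \<and> (F \<prec>\<^sub>\<infinity> G \<longleftrightarrow> (\<exists>R. SCPO_ii F G R))
    \<and> (F \<prec>\<^sub>\<infinity> G \<longleftrightarrow> (\<exists>r. SCPO_iii F G r))
    \<and> (F \<prec>\<^sub>\<infinity> G \<longleftrightarrow> (\<exists>r. SCPO_iv F G r))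
    \<and> (F \<prec>\<^sub>\<infinity> G \<longrightarrow>
        (\<exists>Q R r. SCPO_i F G Q \<and> SCPO_ii F G R \<and> SCPO_iii F G r \<and> SCPO_iv F G r
          \<and> (schur_defect G \<noteq> {0} \<longrightarrow>
               sup_norm Q \<le> sup_norm R + sqrt (2 * sup_norm (\<lambda>z. Re_op (R z)) - 1))
          \<and> sup_norm R \<le> 1 + sup_norm Q
          \<and> sup_norm Q \<le> (2 + 2 * sqrt r + r) / (2 * r)
          \<and> sup_norm R \<le> (2 + r) / (2 * r)
          \<and> (schur_defect G \<noteq> {0} \<longrightarrow>
               r \<ge> inverse (sup_norm R
                     + sqrt ((sup_norm R)\<^sup>2 + 2 * sup_norm (\<lambda>z. Re_op (R z)) - 1)))))"
proof -
  note F = assms(3) and G = assms(4)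
  have i_ii: "\<exists>R. SCPO_ii F G R" if "SCPO_i F G Q" for Q
    using SCPO_ii_of_i[OF F G that] by metis
  have ii_i_iii: "(\<exists>Q. SCPO_i F G Q) \<and> (\<exists>r. SCPO_iii F G r)" if ii: "SCPO_ii F G R" for R
  proof
    define \<rho> where "\<rho> = max 1 (sup_norm R)"
    have \<rho>: "1 \<le> \<rho>" by (simp add: \<rho>_def)
    have n: "norm (R z) \<le> \<rho>" if "z \<in> \<D>" for z
      using SCPO_ii_inner_le(2)[OF ii that] by (simp add: \<rho>_def)
    have q: "R z d \<bullet> d \<le> \<rho> * (norm d)\<^sup>2" if z: "z \<in> \<D>" for z d
      by (rule order_trans[OF factored_id.factor_inner_le[OF factored_id_of_SCPO_ii[OF F G ii z]]
            mult_right_mono[OF n[OF z]]]) simp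
    show "\<exists>Q. SCPO_i F G Q"
      using SCPO_i_of_ii[OF F G ii n q] \<rho> by fastforce
    have "0 < 1 / (4 * \<rho>)" using \<rho> by simp
    then show "\<exists>r. SCPO_iii F G r"
      using SCPO_iii_of_ii[OF F G ii n q _ perturbation_radius_le[OF \<rho>]] by blast
  qed
  have iii_iv: "SCPO_iv F G r" if "SCPO_iii F G r" for r
    using that by (simp add: SCPO_iii_def SCPO_iv_def)
  have iv_ii: "\<exists>R. SCPO_ii F G R" if "SCPO_iv F G r" for r
    using SCPO_ii_of_iv[OF F G that] by metis
  have prec_iii: "F \<prec>\<^sub>\<infinity> G \<longleftrightarrow> (\<exists>r. SCPO_iii F G r)"
    using SCPO_iii_of_prec_inf[OF F G] prec_inf_of_SCPO_iii[OF F G] by blast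
  have bounds: "\<exists>Q R r. SCPO_i F G Q \<and> SCPO_ii F G R \<and> SCPO_iii F G r \<and> SCPO_iv F G r
          \<and> (schur_defect G \<noteq> {0} \<longrightarrow>
               sup_norm Q \<le> sup_norm R + sqrt (2 * sup_norm (\<lambda>z. Re_op (R z)) - 1))
          \<and> sup_norm R \<le> 1 + sup_norm Q
          \<and> sup_norm Q \<le> (2 + 2 * sqrt r + r) / (2 * r)
          \<and> sup_norm R \<le> (2 + r) / (2 * r)
          \<and> (schur_defect G \<noteq> {0} \<longrightarrow>
               r \<ge> inverse (sup_norm R
                     + sqrt ((sup_norm R)\<^sup>2 + 2 * sup_norm (\<lambda>z. Re_op (R z)) - 1)))"
    if prec: "F \<prec>\<^sub>\<infinity> G"
  proof -
    \<comment> \<open>By uniqueness on the disc it does not matter which \<open>R\<close> is taken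
      here.\<close>
    obtain R where ii: "SCPO_ii F G R" using prec prec_iii iii_iv iv_ii by metis
    show ?thesis
    proof (cases "schur_defect G = {0}")
      case False
      let ?r = "inverse (sup_norm R + sqrt ((sup_norm R)\<^sup>2 + 2 * sup_norm (\<lambda>z. Re_op (R z)) - 1))"
      obtain Q where "SCPO_i F G Q" "SCPO_iii F G ?r"
        "sup_norm Q \<le> sup_norm R + sqrt (2 * sup_norm (\<lambda>z. Re_op (R z)) - 1)"
        "sup_norm R \<le> 1 + sup_norm Q" "sup_norm Q \<le> (2 + 2 * sqrt ?r + ?r) / (2 * ?r)"
        "sup_norm R \<le> (2 + ?r) / (2 * ?r)"
        using SCPO_bounds[OF F G ii False] by blast
      then show ?thesis
        using ii iii_iv by (intro exI[of _ Q] exI[of _ R] exI[of _ ?r]) simp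
    next
      case True
      obtain Q where i: "SCPO_i F G Q" using ii_i_iii[OF ii] by blast
      note Q0 = SCPO_trivial_defect[OF G True i]
      have R0: "R z = 0" if z: "z \<in> \<D>" for z
      proof -
        have "R z \<in> ops_between {0} (schur_defect G)" using ii z True by (auto simp: SCPO_ii_def)
        then show ?thesis by (rule ops_between_trivial)
      qed
      have "sup_norm Q = 0" "sup_norm R = 0"
        by (simp_all add: sup_norm_def Q0(1) R0 cong: SUP_cong_simp)
      \<comment> \<open>Here \<open>F\<close> and \<open>G\<close> agree on the disc, so the affine
        combination equals \<open>G\<close> there for every \<epsilon>; the value 1 is
        arbitrary.\<close>
      moreover have "SCPO_iii F G 1"
        unfolding SCPO_iii_def
      proof (intro conjI allI impI)
        fix \<epsilon> :: complex
        show "(\<lambda>z. (1 - \<epsilon>) *\<^sub>C G z + \<epsilon> *\<^sub>C F z) \<in> schur"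
          by (rule schur_affine_combination[OF F G])
            (simp add: Q0(2) schurD(3)[OF G] flip: scaleC_add_left)
      qed simp
      ultimately show ?thesis
        using i ii iii_iv True by (intro exI[of _ Q] exI[of _ R] exI[of _ "1::real"]) simp
    qed
  qed
  have i: "F \<prec>\<^sub>\<infinity> G \<longleftrightarrow> (\<exists>Q. SCPO_i F G Q)"
    and ii: "F \<prec>\<^sub>\<infinity> G \<longleftrightarrow> (\<exists>R. SCPO_ii F G R)"
    and iv: "F \<prec>\<^sub>\<infinity> G \<longleftrightarrow> (\<exists>r. SCPO_iv F G r)"
    using prec_iii i_ii ii_i_iii iii_iv iv_ii by meson+
  show ?thesis
    by (intro conjI impI i ii prec_iii iv) (rule bounds)
qed

end
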